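(* Let $n$ be a positive integer, let $p\in[1,2)$, and let $v\in \mathrm H^1(\mathbb R^n,dx)$ have compact support. For any large enough integer $d\ge n$, define $u_d$ on $\mathbb S^d$ by $$u_d(\omega)=v\big(\sqrt d\,\omega_1,\sqrt d\,\omega_2,\ldots,\sqrt d\,\omega_n\big),\qquad \omega=(\omega_1,\omega_2,\ldots,\omega_{d+1})\in\mathbb S^d\subset\mathbb R^{d+1}.$$ Then $$\lim_{d\to+\infty}\frac1d\left(\|\nabla u_d\|_{\mathrm L^2(\mathbb S^d,d\mu_d)}^2-\frac d{2-p}\Big(\|u_d\|_{\mathrm L^2(\mathbb S^d,d\mu_d)}^2-\|u_d\|_{\mathrm L^p(\mathbb S^d,d\mu_d)}^2\Big)\right)=\|\nabla v\|_{\mathrm L^2(\mathbb R^n,d\gamma)}^2-\frac1{2-p}\Big(\|v\|_{\mathrm L^2(\mathbb R^n,d\gamma)}^2-\|v\|_{\mathrm L^p(\mathbb R^n,d\gamma)}^2\Big).$$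
   Context: $\mathbb S^d$ is the unit sphere of $\mathbb R^{d+1}$ with its standard metric, $\mu_d$ is the uniform probability measure on $\mathbb S^d$, and $\nabla u_d$ is the Riemannian gradient on $\mathbb S^d$. $d\gamma(y)=(2\pi)^{-n/2}e^{-|y|^2/2}\,dy$ is the centred normalized Gaussian probability measure on $\mathbb R^n$. *)

theory Defs
  imports "HOL-Analysis.Analysis"
begin

text \<open>
  Since the dimension varies inside the statement, points of \<open>\<real>\<^sup>m\<close> are represented by
  functions of type \<^typ>\<open>nat \<Rightarrow> real\<close> that are extensional on the index set \<open>{..<m}\<close>.
  Coordinates are numbered from \<open>0\<close>. The Euclidean norm of \<open>x\<close> is \<open>L2_set x {..<m}\<close>; the
  topology is the one induced by the product topology on \<^typ>\<open>nat \<Rightarrow> real\<close>, which on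
  extensional functions is the Euclidean one.
\<close>

definition Rn :: "nat \<Rightarrow> (nat \<Rightarrow> real) set" where
  "Rn m = ({..<m} \<rightarrow>\<^sub>E UNIV)"

definition leb :: "nat \<Rightarrow> (nat \<Rightarrow> real) measure" where
  "leb m = PiM {..<m} (\<lambda>_. lborel)"

definition gauss :: "nat \<Rightarrow> (nat \<Rightarrow> real) measure" where
  "gauss m = density (leb m)
     (\<lambda>y. ennreal ((2 * pi) powr (- (real m / 2)) * exp (- (L2_set y {..<m})\<^sup>2 / 2)))"

definition Lp_norm :: "'a measure \<Rightarrow> real \<Rightarrow> ('a \<Rightarrow> real) \<Rightarrow> real" where
  "Lp_norm M p f = (\<integral>x. \<bar>f x\<bar> powr p \<partial>M) powr (1 / p)"

definition square_integrable :: "'a measure \<Rightarrow> ('a \<Rightarrow> real) \<Rightarrow> bool" where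
  "square_integrable M f \<longleftrightarrow> f \<in> borel_measurable M \<and> integrable M (\<lambda>x. (f x)\<^sup>2)"


subsection \<open>Smooth functions\<close>

definition pd :: "nat \<Rightarrow> ((nat \<Rightarrow> real) \<Rightarrow> real) \<Rightarrow> (nat \<Rightarrow> real) \<Rightarrow> real" where
  "pd i f x = deriv (\<lambda>t. f (x(i := t))) (x i)"

primrec Ck :: "nat \<Rightarrow> nat \<Rightarrow> ((nat \<Rightarrow> real) \<Rightarrow> real) \<Rightarrow> bool" where
  "Ck m 0 f \<longleftrightarrow> continuous_on (Rn m) f"
| "Ck m (Suc k) f \<longleftrightarrow> continuous_on (Rn m) f \<and>
     (\<forall>i<m. (\<forall>x\<in>Rn m. (\<lambda>t. f (x(i := t))) differentiable (at (x i))) \<and> Ck m k (pd i f))"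

definition smooth :: "nat \<Rightarrow> ((nat \<Rightarrow> real) \<Rightarrow> real) \<Rightarrow> bool" where
  "smooth m f \<longleftrightarrow> (\<forall>k. Ck m k f)"

definition test_function :: "nat \<Rightarrow> ((nat \<Rightarrow> real) \<Rightarrow> real) \<Rightarrow> bool" where
  "test_function m \<phi> \<longleftrightarrow> smooth m \<phi> \<and> (\<exists>K. compact K \<and> (\<forall>x\<in>Rn m - K. \<phi> x = 0))"


subsection \<open>The Sobolev space \<open>H\<^sup>1(\<real>\<^sup>m, dx)\<close>\<close>

text \<open>Elements of \<open>L\<^sup>2\<close> and \<open>H\<^sup>1\<close> are given by Borel representatives;
  gradients are vector fields \<open>g\<close> with components \<open>g x i\<close>, determined up to null sets.\<close>

definition has_weak_grad ::
    "nat \<Rightarrow> ((nat \<Rightarrow> real) \<Rightarrow> real) \<Rightarrow> ((nat \<Rightarrow> real) \<Rightarrow> nat \<Rightarrow> real) \<Rightarrow> bool" where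
  "has_weak_grad m v g \<longleftrightarrow>
     (\<forall>i<m. square_integrable (leb m) (\<lambda>x. g x i) \<and>
       (\<forall>\<phi>. test_function m \<phi> \<longrightarrow>
          (\<integral>x. v x * pd i \<phi> x \<partial>leb m) = - (\<integral>x. g x i * \<phi> x \<partial>leb m)))"

definition H1 :: "nat \<Rightarrow> ((nat \<Rightarrow> real) \<Rightarrow> real) set" where
  "H1 m = {v. square_integrable (leb m) v \<and> (\<exists>g. has_weak_grad m v g)}"

definition weak_grad :: "nat \<Rightarrow> ((nat \<Rightarrow> real) \<Rightarrow> real) \<Rightarrow> (nat \<Rightarrow> real) \<Rightarrow> nat \<Rightarrow> real" where
  "weak_grad m v = (SOME g. has_weak_grad m v g)"

text \<open>Compact support in the sense of classes modulo null sets.\<close>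

definition compactly_supported :: "nat \<Rightarrow> ((nat \<Rightarrow> real) \<Rightarrow> real) \<Rightarrow> bool" where
  "compactly_supported m v \<longleftrightarrow> (\<exists>K. compact K \<and> (AE x in leb m. x \<notin> K \<longrightarrow> v x = 0))"


subsection \<open>The unit sphere of \<open>\<real>\<^sup>d\<^sup>+\<^sup>1\<close>\<close>

definition Sph :: "nat \<Rightarrow> (nat \<Rightarrow> real) set" where
  "Sph d = {x \<in> Rn (Suc d). L2_set x {..<Suc d} = 1}"

text \<open>The normalised surface measure is the cone measure: the measure of \<open>A \<subseteq> \<S>\<^sup>d\<close> is the
  proportion of the unit ball of \<open>\<real>\<^sup>d\<^sup>+\<^sup>1\<close> occupied by the cone over \<open>A\<close> with apex \<open>0\<close>.
  The origin, where the radial projection does not hit the sphere, is a null set.\<close>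

definition radial_proj :: "nat \<Rightarrow> (nat \<Rightarrow> real) \<Rightarrow> nat \<Rightarrow> real" where
  "radial_proj d x = (\<lambda>i\<in>{..<Suc d}. x i / L2_set x {..<Suc d})"

definition sph_measure :: "nat \<Rightarrow> (nat \<Rightarrow> real) measure" where
  "sph_measure d = restrict_space
     (distr (uniform_measure (leb (Suc d)) {x \<in> Rn (Suc d). L2_set x {..<Suc d} \<le> 1})
            (leb (Suc d)) (radial_proj d))
     (Sph d)"

text \<open>Smooth tangent vector fields on the sphere are the restrictions of smooth vector fields
  on \<open>\<real>\<^sup>d\<^sup>+\<^sup>1\<close> which are tangent along the sphere. The Riemannian divergence of such a field
  is the trace over the tangent space of the ambient derivative: \<open>tr ((I - \<omega> \<omega>\<^sup>T) DX(\<omega>))\<close>.\<close>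

definition sph_tangent_field :: "nat \<Rightarrow> ((nat \<Rightarrow> real) \<Rightarrow> nat \<Rightarrow> real) \<Rightarrow> bool" where
  "sph_tangent_field d X \<longleftrightarrow> (\<forall>i<Suc d. smooth (Suc d) (\<lambda>x. X x i)) \<and>
     (\<forall>\<omega>\<in>Sph d. (\<Sum>i<Suc d. \<omega> i * X \<omega> i) = 0)"

definition sph_div :: "nat \<Rightarrow> ((nat \<Rightarrow> real) \<Rightarrow> nat \<Rightarrow> real) \<Rightarrow> (nat \<Rightarrow> real) \<Rightarrow> real" where
  "sph_div d X \<omega> = (\<Sum>i<Suc d. pd i (\<lambda>x. X x i) \<omega>)
     - (\<Sum>i<Suc d. \<Sum>j<Suc d. \<omega> i * \<omega> j * pd j (\<lambda>x. X x i) \<omega>)"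

text \<open>The weak Riemannian gradient is a square integrable tangent field, expressed in the
  coordinates of \<open>\<real>\<^sup>d\<^sup>+\<^sup>1\<close>; its Riemannian length is the Euclidean one.\<close>

definition has_weak_sph_grad ::
    "nat \<Rightarrow> ((nat \<Rightarrow> real) \<Rightarrow> real) \<Rightarrow> ((nat \<Rightarrow> real) \<Rightarrow> nat \<Rightarrow> real) \<Rightarrow> bool" where
  "has_weak_sph_grad d u G \<longleftrightarrow>
     (\<forall>i<Suc d. square_integrable (sph_measure d) (\<lambda>\<omega>. G \<omega> i)) \<and>
     (AE \<omega> in sph_measure d. (\<Sum>i<Suc d. \<omega> i * G \<omega> i) = 0) \<and>
     (\<forall>X. sph_tangent_field d X \<longrightarrow>
        (\<integral>\<omega>. u \<omega> * sph_div d X \<omega> \<partial>sph_measure d)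
          = - (\<integral>\<omega>. (\<Sum>i<Suc d. G \<omega> i * X \<omega> i) \<partial>sph_measure d))"

definition sph_H1 :: "nat \<Rightarrow> ((nat \<Rightarrow> real) \<Rightarrow> real) set" where
  "sph_H1 d = {u. square_integrable (sph_measure d) u \<and> (\<exists>G. has_weak_sph_grad d u G)}"

definition sph_grad :: "nat \<Rightarrow> ((nat \<Rightarrow> real) \<Rightarrow> real) \<Rightarrow> (nat \<Rightarrow> real) \<Rightarrow> nat \<Rightarrow> real" where
  "sph_grad d u = (SOME G. has_weak_sph_grad d u G)"


definition sph_lift :: "nat \<Rightarrow> ((nat \<Rightarrow> real) \<Rightarrow> real) \<Rightarrow> nat \<Rightarrow> (nat \<Rightarrow> real) \<Rightarrow> real" where
  "sph_lift n v d \<omega> = v (\<lambda>i\<in>{..<n}. sqrt (real d) * \<omega> i)"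

end

theory Submission
  imports Defs "HOL-Probability.Distributions"
begin

text \<open>
  The law of \<open>y = \<surd>d (\<omega>\<^sub>1, \<dots>, \<omega>\<^sub>n)\<close> under the uniform measure on the
  sphere has a density proportional to \<open>(1 - |y|\<^sup>2/d)\<^sup>a\<close> with \<open>a = (d - n - 1)/2\<close>. It tends to the
  Gaussian and is dominated by a multiple of \<open>exp (- |y|\<^sup>2/4)\<close>, so the \<open>L\<^sup>2\<close> and \<open>L\<^sup>p\<close> norms converge by
  dominated convergence. If \<open>g\<close> is the weak gradient of \<open>v\<close>, extended by \<open>0\<close> to \<open>d + 1\<close> components, the
  weak gradient of \<open>u\<^sub>d\<close> is \<open>\<surd>d (g - (\<omega> \<bullet> g) \<omega>)\<close>, evaluated at \<open>y\<close>. Its squared length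
  \<open>d |g|\<^sup>2 - (y \<bullet> g)\<^sup>2\<close>, divided by \<open>d\<close>, tends to \<open>|g|\<^sup>2\<close>.

  That this field is the weak gradient is checked on mollifications of \<open>v\<close>, where it is the divergence
  theorem on the sphere, itself a consequence of the invariance of the measure under planar rotations.
  The mollification is removed by the continuity of translations in \<open>L\<^sup>1\<close>. Weak gradients on the sphere are
  unique up to null sets, so the chosen one may be replaced by the explicit field.
\<close>

section \<open>Smooth functions\<close>

text \<open>No chain rule applies to u_d, since v is only weakly differentiable. All derivatives are
  therefore put on a kernel \<open>kern n \<epsilon> y z\<close>: for frozen z it is smooth on the
  ambient space and obeys the divergence theorem on the sphere; for frozen y it is a test function
  in z and obeys the definition of the weak gradient of v. Fubini joins the two. L1 convergence of
  the mollifications then suffices: test fields are bounded on the compact sphere, and the law of y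
  has a density at most 1/Z with respect to Lebesgue measure, Z being the integral of the
  unnormalised weight. This bound uses a nonnegative exponent a, that is, d > n. Functions in L2
  become integrable by truncation to a cube containing the image of the sphere. The rate 1/4 comes
  from 1 - t <= exp (-t) and a >= d/4, valid for d >= 2n + 2. It also tames (y . g)^2: the product
  with exp (-|y|^2/4) is at most 4 |g|^2.\<close>

lemma Rn_upd: "x \<in> Rn m \<Longrightarrow> i < m \<Longrightarrow> x(i := t) \<in> Rn m"
  by (auto simp: Rn_def PiE_iff extensional_def)

lemma restrict_in_Rn [simp]: "restrict f {..<m} \<in> Rn m"
  by (auto simp: Rn_def)

lemma space_leb: "space (leb m) = Rn m"
  by (simp add: leb_def Rn_def space_PiM)

section \<open>Topology and measurability on extensional functions\<close>

lemma continuous_on_coordinate: "continuous_on S (\<lambda>x::nat \<Rightarrow> real. x i)"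
  by (rule continuous_on_subset[OF continuous_on_product_coordinates]) auto

lemma continuous_on_into_Rn:
  fixes f :: "'a::topological_space \<Rightarrow> nat \<Rightarrow> real"
  assumes "\<And>i. i < m \<Longrightarrow> continuous_on S (\<lambda>x. f x i)" and "\<And>x. x \<in> S \<Longrightarrow> f x \<in> Rn m"
  shows "continuous_on S f"
proof (rule continuous_on_coordinatewise_then_product)
  fix i
  show "continuous_on S (\<lambda>x. f x i)"
  proof (cases "i < m")
    case False
    then have "f x i = undefined" if "x \<in> S" for x
      using assms(2)[OF that] by (auto simp: Rn_def PiE_iff extensional_def)
    then show ?thesis by (simp cong: continuous_on_cong)
  qed (use assms in auto)
qed

text \<open>Tychonoff: extensionality is itself a product condition, with the factor
  \<open>{undefined}\<close> at every index outside \<open>{..<m}\<close>, so the box is a product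
  of compact sets over all of \<open>nat\<close>.\<close>

lemma compact_box: "compact (PiE {..<m} (\<lambda>_. {-a..a::real}))"
proof -
  have "PiE {..<m} (\<lambda>_. {-a..a::real}) = PiE UNIV (\<lambda>i. if i < m then {-a..a} else {undefined})"
    by (auto simp: PiE_iff extensional_def split: if_splits)
  moreover have "compactin (product_topology (\<lambda>_. euclidean) UNIV)
      (PiE UNIV (\<lambda>i. if i < m then {-a..a} else {undefined::real}))"
    by (subst compactin_PiE) (auto simp: compactin_euclidean_iff)
  ultimately show ?thesis
    by (simp add: euclidean_product_topology compactin_euclidean_iff)
qed

lemma L2_set_lessThan_sq: "(L2_set x {..<m})\<^sup>2 = (\<Sum>i<m. (x i)\<^sup>2)"
  by (simp add: L2_set_def sum_nonneg)

lemma Sph_iff: "x \<in> Sph d \<longleftrightarrow> x \<in> Rn (Suc d) \<and> (\<Sum>i<Suc d. (x i)\<^sup>2) = 1"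
  unfolding Sph_def L2_set_def by (auto simp del: sum.lessThan_Suc)

lemma Sph_Rn: "x \<in> Sph d \<Longrightarrow> x \<in> Rn (Suc d)"
  by (simp add: Sph_iff)

lemma Sph_coordinate_le:
  assumes "x \<in> Sph d" "i < Suc d" shows "\<bar>x i\<bar> \<le> 1"
proof -
  have "(x i)\<^sup>2 \<le> (\<Sum>i<Suc d. (x i)\<^sup>2)"
    by (rule member_le_sum) (use assms in auto)
  then show ?thesis using assms by (simp add: Sph_iff abs_square_le_1 del: sum.lessThan_Suc)
qed

text \<open>The cube already enforces extensionality, so the sphere is cut out of it by a single
  equation that is closed in the whole product space.\<close>

lemma compact_Sph: "compact (Sph d)"
proof -
  have "Sph d = PiE {..<Suc d} (\<lambda>_. {-1..1}) \<inter> {x. (\<Sum>i<Suc d. (x i)\<^sup>2) = 1}"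
    using Sph_coordinate_le[of _ d]
    by (auto simp: Sph_iff Rn_def PiE_iff abs_le_iff minus_le_iff extensional_def
        simp del: sum.lessThan_Suc; metis)
  moreover have "closed {x::nat \<Rightarrow> real. (\<Sum>i<Suc d. (x i)\<^sup>2) = 1}"
    by (intro closed_Collect_eq continuous_intros continuous_on_coordinate)
  ultimately show ?thesis by (metis compact_Int_closed compact_box)
qed

lemma bounded_on_Sph:
  assumes "continuous_on (Rn (Suc d)) f"
  obtains C :: real where "C \<ge> 0" "\<And>x. x \<in> Sph d \<Longrightarrow> \<bar>f x\<bar> \<le> C"
proof -
  have "compact (f ` Sph d)"
    by (intro compact_continuous_image compact_Sph continuous_on_subset[OF assms]) (auto simp: Sph_Rn)
  then have "bounded (f ` Sph d)" by (rule compact_imp_bounded)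
  then obtain C where "\<forall>y\<in>f ` Sph d. norm y \<le> C" by (auto simp: bounded_iff)
  then show ?thesis by (intro that[of "max C 0"]) auto
qed

text \<open>In a countable product the coordinates generate the Borel sets. The identity from
  \<open>leb m\<close> into \<open>nat => real\<close> is therefore measurable: coordinates below
  \<open>m\<close> are measurable, and the others are constant on \<open>Rn m\<close>. It remains to
  compose with \<open>f\<close>.\<close>

lemma continuous_on_Rn_measurable:
  assumes "continuous_on (Rn m) (f :: _ \<Rightarrow> real)"
  shows "f \<in> borel_measurable (leb m)"
proof -
  have id: "(\<lambda>x. x) \<in> measurable (leb m) (restrict_space borel (Rn m))"
  proof (rule measurable_restrict_space2)
    show "(\<lambda>x. x) \<in> space (leb m) \<rightarrow> Rn m" by (simp add: space_leb)
    have "(\<lambda>x. x) \<in> measurable (leb m) (PiM UNIV (\<lambda>_. borel))"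
    proof (rule measurable_PiM_single')
      fix i :: nat
      show "(\<lambda>x. x i) \<in> borel_measurable (leb m)"
      proof (cases "i < m")
        case True
        then show ?thesis unfolding leb_def by (intro measurable_component_singleton[where M="\<lambda>_. lborel", simplified]) auto
      next
        case False
        then have "(\<lambda>x. x i) \<in> borel_measurable (leb m) \<longleftrightarrow> (\<lambda>x. undefined :: real) \<in> borel_measurable (leb m)"
          by (intro measurable_cong) (auto simp: space_leb Rn_def PiE_iff extensional_def)
        then show ?thesis by simp
      qed
    qed auto
    then show "(\<lambda>x. x) \<in> borel_measurable (leb m)"
      using measurable_cong_sets[OF refl sets_PiM_equal_borel] by blast
  qed
  show ?thesis
    using measurable_comp[OF id borel_measurable_continuous_on_restrict[OF assms]] by (simp add: o_def)
qed

section \<open>Partial derivatives and the classes \<open>Ck\<close>\<close>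

lemma pd_cong:
  assumes "\<And>x. x \<in> Rn m \<Longrightarrow> f x = g x" "x \<in> Rn m" "i < m"
  shows "pd i f x = pd i g x"
  using assms by (simp add: pd_def Rn_upd)

text \<open>The lines \<open>x(i := t)\<close> never leave \<open>Rn m\<close>, so only values there
  are seen. This allows a derivative known by formula on \<open>Rn m\<close> alone to replace
  \<open>pd\<close>.\<close>

lemma Ck_cong:
  assumes "\<And>x. x \<in> Rn m \<Longrightarrow> f x = g x" shows "Ck m k f \<longleftrightarrow> Ck m k g"
  using assms
proof (induction k arbitrary: f g)
  case (Suc k)
  have "Ck m k (pd i f) \<longleftrightarrow> Ck m k (pd i g)" if "i < m" for i
    by (rule Suc.IH) (use that Suc.prems in \<open>auto intro!: pd_cong\<close>)
  moreover have "(\<lambda>t. f (x(i := t))) = (\<lambda>t. g (x(i := t)))" if "x \<in> Rn m" "i < m" for x i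
    by (intro ext Suc.prems Rn_upd that)
  ultimately show ?case using Suc.prems by (auto cong: continuous_on_cong)
qed (auto cong: continuous_on_cong)

lemma Ck_continuous: "Ck m k f \<Longrightarrow> continuous_on (Rn m) f"
  by (cases k) auto

lemma Ck_SucD: "Ck m (Suc k) f \<Longrightarrow> Ck m k f"
  by (induction k arbitrary: f) auto

lemma Ck_pd: "Ck m (Suc k) f \<Longrightarrow> i < m \<Longrightarrow> Ck m k (pd i f)"
  by simp

text \<open>The definition gives differentiability only at the base value \<open>x i\<close>;
  applied at the moved point \<open>x(i := t)\<close> it gives it along the whole line.\<close>

lemma Ck_has_derivative:
  assumes "Ck m (Suc k) f" "x \<in> Rn m" "i < m"
  shows "((\<lambda>t. f (x(i := t))) has_real_derivative pd i f (x(i := t))) (at t)"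
proof -
  have "(\<lambda>s. f ((x(i := t))(i := s))) differentiable (at ((x(i := t)) i))"
    using assms(1,3) Rn_upd[OF assms(2,3), of t] unfolding Ck.simps by blast
  then have "(\<lambda>s. f (x(i := s))) differentiable (at t)" by simp
  then show ?thesis
    by (simp add: pd_def DERIV_deriv_iff_real_differentiable)
qed

lemma Ck_has_derivative_at:
  assumes "Ck m (Suc k) f" "x \<in> Rn m" "i < m"
  shows "((\<lambda>t. f (x(i := t))) has_real_derivative pd i f x) (at (x i))"
  using Ck_has_derivative[OF assms, of "x i"] unfolding fun_upd_triv .

lemma pd_eqI:
  "((\<lambda>t. f (x(i := t))) has_real_derivative D) (at (x i)) \<Longrightarrow> pd i f x = D"
  by (simp add: pd_def DERIV_imp_deriv)

text \<open>Inductive closure proofs can thus name the derivatives by formula instead of computing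
  \<open>pd\<close>: uniqueness of derivatives identifies \<open>D i\<close> with
  \<open>pd i f\<close> on \<open>Rn m\<close>, and \<open>Ck_cong\<close> transfers the
  class.\<close>

lemma Ck_SucI:
  assumes "continuous_on (Rn m) f"
    and "\<And>i x. i < m \<Longrightarrow> x \<in> Rn m \<Longrightarrow> ((\<lambda>t. f (x(i := t))) has_real_derivative D i x) (at (x i))"
    and "\<And>i. i < m \<Longrightarrow> Ck m k (D i)"
  shows "Ck m (Suc k) f"
proof -
  have "Ck m k (pd i f)" if "i < m" for i
  proof (subst Ck_cong)
    show "pd i f x = D i x" if "x \<in> Rn m" for x
      using pd_eqI[OF assms(2)[OF \<open>i < m\<close> that]] .
  qed (use that in \<open>rule assms(3)\<close>)
  then show ?thesis
    using assms(1,2) by (auto simp: real_differentiable_def)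
qed

lemma pd_mult:
  assumes "Ck m (Suc k) f" "Ck m (Suc l) g" "x \<in> Rn m" "i < m"
  shows "pd i (\<lambda>x. f x * g x) x = pd i f x * g x + f x * pd i g x"
  using DERIV_mult'[OF Ck_has_derivative_at[OF assms(1,3,4)] Ck_has_derivative_at[OF assms(2,3,4)]]
  unfolding fun_upd_triv by (intro pd_eqI) (simp only: add.commute)

lemma Ck_add: "Ck m k f \<Longrightarrow> Ck m k g \<Longrightarrow> Ck m k (\<lambda>x. f x + g x)"
proof (induction k arbitrary: f g)
  case 0
  then show ?case by (auto intro!: continuous_intros)
next
  case (Suc k)
  show ?case
  proof (rule Ck_SucI)
    show "continuous_on (Rn m) (\<lambda>x. f x + g x)"
      by (intro continuous_intros Ck_continuous[OF Suc.prems(1)] Ck_continuous[OF Suc.prems(2)])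
    show "((\<lambda>t. f (x(i := t)) + g (x(i := t))) has_real_derivative pd i f x + pd i g x) (at (x i))"
      if "i < m" "x \<in> Rn m" for i x
      by (intro DERIV_add Ck_has_derivative_at[OF Suc.prems(1) that(2,1)]
          Ck_has_derivative_at[OF Suc.prems(2) that(2,1)])
  qed (use Suc in auto)
qed

lemma Ck_mult: "Ck m k f \<Longrightarrow> Ck m k g \<Longrightarrow> Ck m k (\<lambda>x. f x * g x)"
proof (induction k arbitrary: f g)
  case 0
  then show ?case by (auto intro!: continuous_intros)
next
  case (Suc k)
  show ?case
  proof (rule Ck_SucI)
    show "continuous_on (Rn m) (\<lambda>x. f x * g x)"
      by (intro continuous_intros Ck_continuous[OF Suc.prems(1)] Ck_continuous[OF Suc.prems(2)])
    show "((\<lambda>t. f (x(i := t)) * g (x(i := t))) has_real_derivative f x * pd i g x + pd i f x * g x) (at (x i))"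
      if "i < m" "x \<in> Rn m" for i x
      using DERIV_mult'[OF Ck_has_derivative_at[OF Suc.prems(1) that(2,1)]
        Ck_has_derivative_at[OF Suc.prems(2) that(2,1)]] unfolding fun_upd_triv .
    \<comment> \<open>The induction hypothesis wants both factors of order \<open>k\<close>; the
      undifferentiated one is lowered from \<open>Suc k\<close> by \<open>Ck_SucD\<close>.\<close>
    show "Ck m k (\<lambda>x. f x * pd i g x + pd i f x * g x)" if "i < m" for i
      by (intro Ck_add Suc.IH Ck_pd[OF Suc.prems(1) that] Ck_pd[OF Suc.prems(2) that]
          Ck_SucD[OF Suc.prems(1)] Ck_SucD[OF Suc.prems(2)])
  qed
qed

lemma pd_const [simp]: "pd i (\<lambda>x. c) x = 0"
  by (simp add: pd_def)

lemma Ck_const [simp]: "Ck m k (\<lambda>x. c)"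
proof (induction k arbitrary: c)
  case (Suc k)
  have "pd i (\<lambda>x. c) = (\<lambda>x. 0)" for i
    by (rule ext) simp
  with Suc[of 0] show ?case by simp
qed simp

text \<open>A smooth function of one variable is presented by the sequence of its derivatives.\<close>

definition deriv_seq :: "(nat \<Rightarrow> real \<Rightarrow> real) \<Rightarrow> bool" where
  "deriv_seq F \<longleftrightarrow> (\<forall>k t. (F k has_real_derivative F (Suc k) t) (at t))"

text \<open>Leaving \<open>j\<close> free closes the induction: differentiation in coordinate
  \<open>l\<close> turns \<open>F j\<close> into \<open>F (Suc j)\<close>, and any other coordinate
  gives 0.\<close>

lemma Ck_deriv_seq:
  assumes "deriv_seq F" shows "Ck m k (\<lambda>x. F j (x l))" 
proof (induction k arbitrary: j)
  have cont: "continuous_on (Rn m) (\<lambda>x. F j (x l))" for j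
  proof (rule continuous_on_compose2[of UNIV "F j"])
    show "continuous_on UNIV (F j)"
      using assms by (auto simp: deriv_seq_def continuous_on_eq_continuous_at intro!: DERIV_isCont)
  qed (auto intro: continuous_on_coordinate)
  case 0
  then show ?case by (simp add: cont)
  case (Suc k)
  show ?case
  proof (rule Ck_SucI[where D="\<lambda>i x. if i = l then F (Suc j) (x l) else 0"])
    show "((\<lambda>t. F j ((x(i := t)) l)) has_real_derivative (if i = l then F (Suc j) (x l) else 0)) (at (x i))" for i x
      using assms by (auto simp: deriv_seq_def)
    show "Ck m k (\<lambda>x. if i = l then F (Suc j) (x l) else 0)" for i
      using Suc[of "Suc j"] by (cases "i = l") auto
  qed (rule cont)
qed

lemma deriv_seq_affine:
  assumes "deriv_seq F" shows "deriv_seq (\<lambda>k t. c ^ k * F k (c * t + a))"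
  unfolding deriv_seq_def
proof (intro allI)
  fix k t
  have "(F k has_real_derivative F (Suc k) (c * t + a)) (at (c * t + a))"
    using assms by (simp add: deriv_seq_def)
  then have "((\<lambda>t. F k (c * t + a)) has_real_derivative F (Suc k) (c * t + a) * c) (at t)"
    by (rule DERIV_chain2) (auto intro!: derivative_eq_intros)
  from DERIV_cmult[OF this, of "c ^ k"]
  show "((\<lambda>t. c ^ k * F k (c * t + a)) has_real_derivative c ^ Suc k * F (Suc k) (c * t + a)) (at t)"
    by (simp add: mult_ac)
qed

lemma smooth_deriv_seq: "deriv_seq F \<Longrightarrow> smooth m (\<lambda>x. F 0 (x l))"
  by (simp add: smooth_def Ck_deriv_seq)

lemma smooth_coordinate: "smooth m (\<lambda>x. x l)"
proof -
  have "deriv_seq (\<lambda>k t. if k = 0 then t else if k = 1 then 1 else 0)"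
    unfolding deriv_seq_def by (auto intro!: derivative_eq_intros)
  from smooth_deriv_seq[OF this] show ?thesis by simp
qed

lemma smooth_const [simp]: "smooth m (\<lambda>x. c)"
  by (simp add: smooth_def)

lemma smooth_add: "smooth m f \<Longrightarrow> smooth m g \<Longrightarrow> smooth m (\<lambda>x. f x + g x)"
  by (simp add: smooth_def Ck_add)

lemma smooth_mult: "smooth m f \<Longrightarrow> smooth m g \<Longrightarrow> smooth m (\<lambda>x. f x * g x)"
  by (simp add: smooth_def Ck_mult)

lemma smooth_prod: "(\<And>i. i \<in> I \<Longrightarrow> smooth m (f i)) \<Longrightarrow> smooth m (\<lambda>x. \<Prod>i\<in>I. f i x)"
  by (induction I rule: infinite_finite_induct) (auto intro!: smooth_mult)

lemma smooth_Ck: "smooth m f \<Longrightarrow> Ck m k f"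
  by (simp add: smooth_def)

lemma smooth_pd: "smooth m f \<Longrightarrow> i < m \<Longrightarrow> smooth m (pd i f)"
  unfolding smooth_def using Ck_pd by blast

lemma smooth_continuous: "smooth m f \<Longrightarrow> continuous_on (Rn m) f"
  using Ck_continuous smooth_Ck by blast

lemma pd_coordinate: "pd i (\<lambda>x. x j) x = (if i = j then 1 else 0)"
  by (rule pd_eqI) (auto intro!: derivative_eq_intros)

text \<open>The derivatives of \<open>exp (-1/t)\<close> have the form \<open>P (1/t) exp (-1/t)\<close> with a polynomial \<open>P\<close>.\<close>

primrec flat_poly :: "nat \<Rightarrow> real poly" where
  "flat_poly 0 = 1"
| "flat_poly (Suc k) = [:0, 0, 1:] * (flat_poly k - pderiv (flat_poly k))"

definition flat :: "nat \<Rightarrow> real \<Rightarrow> real" where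
  "flat k t = (if t > 0 then poly (flat_poly k) (1 / t) * exp (- 1 / t) else 0)"

lemma poly_exp_neg_tendsto: "((\<lambda>s. poly P s * exp (- s)) \<longlongrightarrow> (0::real)) at_top"
proof -
  have "((\<lambda>s. \<Sum>i\<le>degree P. coeff P i * (s ^ i / exp s)) \<longlongrightarrow> (\<Sum>i\<le>degree P. coeff P i * 0)) at_top"
    by (intro tendsto_sum tendsto_mult tendsto_const tendsto_power_div_exp_0)
  then show ?thesis by (simp add: poly_altdef sum_divide_distrib exp_minus divide_inverse sum_distrib_left sum_distrib_right mult_ac)
qed

lemma deriv_seq_flat: "deriv_seq flat"
  unfolding deriv_seq_def
proof (intro allI)
  fix k and t :: real
  consider "t < 0" | "t > 0" | "t = 0" by linarith
  then show "(flat k has_real_derivative flat (Suc k) t) (at t)"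
  proof cases
    case 1
    have "((\<lambda>t. 0) has_real_derivative 0) (at t)" by simp
    then have "(flat k has_real_derivative 0) (at t)"
      by (rule has_field_derivative_transform_within_open[of _ _ _ "{..<0}"]) (use 1 in \<open>auto simp: flat_def\<close>)
    with 1 show ?thesis by (simp add: flat_def)
  next
    case 2
    \<comment> \<open>The chain rule gives \<open>(P (1/t) - P' (1/t)) / t^2 * exp (-1/t)\<close>,
      whence the recursion for \<open>flat_poly\<close> with the factor
      \<open>[:0, 0, 1:]\<close>.\<close>
    have "((\<lambda>t. poly (flat_poly k) (1 / t) * exp (- 1 / t)) has_real_derivative flat (Suc k) t) (at t)"
      using 2 by (auto intro!: derivative_eq_intros poly_DERIV[THEN DERIV_chain2]
          simp: flat_def field_simps power2_eq_square)
    then show ?thesis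
      by (rule has_field_derivative_transform_within_open[of _ _ _ "{0<..}"]) (use 2 in \<open>auto simp: flat_def\<close>)
  next
    case 3
    have "((\<lambda>h. flat k h / h) \<longlongrightarrow> 0) (at_right 0)"
    proof -
      \<comment> \<open>The division by \<open>h\<close> in the difference quotient is absorbed as
        one more power of 1/h, and s = 1/h tends to infinity from the right.\<close>
      have "((\<lambda>h. poly ([:0,1:] * flat_poly k) (inverse h) * exp (- (inverse h))) \<longlongrightarrow> 0) (at_right (0::real))"
        by (rule filterlim_compose[OF poly_exp_neg_tendsto filterlim_inverse_at_top_right])
      then show ?thesis
        by (rule Lim_transform_eventually)
          (auto simp: flat_def eventually_at_filter field_simps)
    qed
    moreover have "((\<lambda>h. flat k h / h) \<longlongrightarrow> 0) (at_left 0)"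
      by (rule Lim_transform_eventually[OF tendsto_const]) (auto simp: flat_def eventually_at_filter)
    ultimately have "((\<lambda>h. flat k h / h) \<longlongrightarrow> 0) (at 0)"
      by (simp add: filterlim_split_at)
    with 3 show ?thesis by (simp add: DERIV_def flat_def)
  qed
qed

lemma flat_0: "flat 0 t = (if t > 0 then exp (- 1 / t) else 0)"
  by (simp add: flat_def)

lemma flat_bounds: "0 \<le> flat 0 t" "flat 0 t \<le> 1"
  by (auto simp: flat_0)

text \<open>For t > a the exponent is -1/((k + 1)(t - a)) and tends to 0; for t <= a every term
  vanishes. Products of these functions approximate indicators of orthants by smooth test
  functions.\<close>

lemma flat_tendsto_indicator:
  "(\<lambda>k. flat 0 (real (Suc k) * (t - a))) \<longlonglongrightarrow> indicator {a<..} t"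
proof (cases "t > a")
  case True
  have "(\<lambda>k. exp (- (1 / (t - a)) * (1 / real (Suc k)))) \<longlonglongrightarrow> exp (- (1 / (t - a)) * 0)"
    by (intro tendsto_intros LIMSEQ_Suc lim_1_over_n)
  moreover have "flat 0 (real (Suc k) * (t - a)) = exp (- (1 / (t - a)) * (1 / real (Suc k)))" for k
    using True by (simp add: flat_0 zero_less_mult_iff mult.commute del: of_nat_Suc)
  ultimately show ?thesis using True by (simp del: of_nat_Suc)
next
  case False
  then have "flat 0 (real (Suc k) * (t - a)) = 0" for k
    by (auto simp: flat_0 zero_less_mult_iff simp del: of_nat_Suc)
  with False show ?thesis by simp
qed

section \<open>Lebesgue measure under affine maps and rotations\<close>

interpretation lborel_prod: product_sigma_finite "\<lambda>_::nat. lborel :: real measure"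
  by standard

lemma measurable_leb_component: "i < m \<Longrightarrow> (\<lambda>x. x i) \<in> borel_measurable (leb m)"
  unfolding leb_def using measurable_component_singleton[of i "{..<m}" "\<lambda>_. lborel"] by simp

lemma measurable_into_leb:
  assumes "\<And>i. i < m \<Longrightarrow> (\<lambda>x. f x i) \<in> borel_measurable M"
    and "\<And>x. x \<in> space M \<Longrightarrow> f x \<in> Rn m"
  shows "f \<in> measurable M (leb m)"
  unfolding leb_def using assms by (intro measurable_PiM_single') (auto simp: Rn_def)

lemma sigma_finite_leb: "sigma_finite_measure (leb m)"
  unfolding leb_def by (rule lborel_prod.sigma_finite) simp

lemma sets_leb_PiE: "(\<And>i. i < m \<Longrightarrow> A i \<in> sets borel) \<Longrightarrow> PiE {..<m} A \<in> sets (leb m)"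
  unfolding leb_def by (rule sets_PiM_I_finite) auto

lemma emeasure_leb_PiE:
  "(\<And>i. i < m \<Longrightarrow> A i \<in> sets borel) \<Longrightarrow> emeasure (leb m) (PiE {..<m} A) = (\<Prod>i<m. emeasure lborel (A i))"
  unfolding leb_def by (rule lborel_prod.emeasure_PiM) auto

lemma measurable_PiM_affine:
  "(\<lambda>x. \<lambda>i\<in>J. t i + c * x i) \<in> measurable (PiM J (\<lambda>_. lborel)) (PiM J (\<lambda>_. lborel :: real measure))"
  by (rule measurable_restrict) (auto intro!: borel_measurable_add borel_measurable_times
      measurable_component_singleton[where M="\<lambda>_. lborel", simplified])

text \<open>Boxes determine the measure, and on a box each coordinate contributes one factor |c|. A
  general index set is kept because the volume of balls is later needed in the block of coordinates
  beyond the first n.\<close>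

lemma PiM_affine:
  assumes "c \<noteq> 0" and J: "finite J"
  shows "density (distr (PiM J (\<lambda>_. lborel)) (PiM J (\<lambda>_. lborel)) (\<lambda>x. \<lambda>i\<in>J. t i + c * x i))
    (\<lambda>_. ennreal (\<bar>c\<bar> ^ card J)) = PiM (J :: nat set) (\<lambda>_. lborel)"
proof (rule lborel_prod.PiM_eqI)
  fix A :: "nat \<Rightarrow> real set" assume "\<And>i. i \<in> J \<Longrightarrow> A i \<in> sets lborel"
  then have A: "\<And>i. i \<in> J \<Longrightarrow> A i \<in> sets borel" by simp
  let ?P = "PiM J (\<lambda>_. lborel :: real measure)" and ?T = "\<lambda>x. \<lambda>i\<in>J. t i + c * x i"
  have pre: "(\<lambda>x. t i + c * x) -` A i \<in> sets borel" if "i \<in> J" for i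
    using measurable_sets[OF _ A[OF that], of "\<lambda>x. t i + c * x" lborel] by simp
  have one: "ennreal \<bar>c\<bar> * emeasure lborel ((\<lambda>x. t i + c * x) -` A i) = emeasure lborel (A i)" if "i \<in> J" for i
    using A[OF that] pre[OF that] assms
    by (subst (2) lborel_real_affine[OF assms(1), of "t i"])
      (simp add: emeasure_density nn_integral_cmult emeasure_distr del: lborel_real_affine)
  have "?T -` PiE J A \<inter> space ?P = PiE J (\<lambda>i. (\<lambda>x. t i + c * x) -` A i)"
    by (auto simp: space_PiM PiE_iff)
  then have "emeasure (density (distr ?P ?P ?T) (\<lambda>_. ennreal (\<bar>c\<bar> ^ card J))) (PiE J A)
     = ennreal (\<bar>c\<bar> ^ card J) * (\<Prod>i\<in>J. emeasure lborel ((\<lambda>x. t i + c * x) -` A i))"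
    using A pre J by (simp add: emeasure_density nn_integral_cmult_indicator emeasure_distr measurable_PiM_affine
        sets_PiM_I_finite lborel_prod.emeasure_PiM)
  also have "\<dots> = (\<Prod>i\<in>J. ennreal \<bar>c\<bar> * emeasure lborel ((\<lambda>x. t i + c * x) -` A i))"
    by (simp add: prod.distrib ennreal_power)
  also have "\<dots> = (\<Prod>i\<in>J. emeasure lborel (A i))"
    by (intro prod.cong one) auto
  finally show "emeasure (density (distr ?P ?P ?T) (\<lambda>_. ennreal (\<bar>c\<bar> ^ card J))) (PiE J A)
     = (\<Prod>i\<in>J. emeasure lborel (A i))" .
qed (use J in simp_all)

lemma nn_integral_PiM_affine:
  fixes J :: "nat set"
  assumes "c \<noteq> 0" "finite J" "f \<in> borel_measurable (PiM J (\<lambda>_. lborel))"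
  shows "(\<integral>\<^sup>+x. f x \<partial>PiM J (\<lambda>_. lborel))
    = ennreal (\<bar>c\<bar> ^ card J) * (\<integral>\<^sup>+x. f (\<lambda>i\<in>J. t i + c * x i) \<partial>PiM J (\<lambda>_. lborel))"
  using assms measurable_comp[OF measurable_PiM_affine assms(3)]
  by (subst PiM_affine[OF assms(1,2), of t, symmetric])
    (simp add: nn_integral_density nn_integral_distr measurable_PiM_affine nn_integral_cmult o_def)

lemma measurable_leb_affine: "(\<lambda>x. \<lambda>i\<in>{..<m}. t i + c * x i) \<in> measurable (leb m) (leb m)"
  unfolding leb_def by (rule measurable_PiM_affine)

lemma nn_integral_leb_affine:
  assumes "c \<noteq> 0" "f \<in> borel_measurable (leb m)"
  shows "(\<integral>\<^sup>+x. f x \<partial>leb m) = ennreal (\<bar>c\<bar> ^ m) * (\<integral>\<^sup>+x. f (\<lambda>i\<in>{..<m}. t i + c * x i) \<partial>leb m)"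
  using nn_integral_PiM_affine[of c "{..<m}" f t] assms by (simp add: leb_def)

lemma distr_leb_affine:
  assumes "\<bar>c\<bar> = 1"
  shows "distr (leb m) (leb m) (\<lambda>x. \<lambda>i\<in>{..<m}. t i + c * x i) = leb m"
  using PiM_affine[of c "{..<m}" t] assms by (auto simp: density_1 leb_def)

section \<open>Shears and planar rotations\<close>

lemma distr_leb_shear:
  assumes ij: "i < m" "j < m" "i \<noteq> j"
  shows "(\<lambda>x. x(i := x i + a * x j)) \<in> measurable (leb m) (leb m)" (is ?m)
    and "distr (leb m) (leb m) (\<lambda>x. x(i := x i + a * x j)) = leb m"
proof -
  let ?S = "\<lambda>x::nat \<Rightarrow> real. x(i := x i + a * x j)"
  show m: ?m
  proof (rule measurable_into_leb)
    fix l assume "l < m"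
    then show "(\<lambda>x. (x(i := x i + a * x j)) l) \<in> borel_measurable (leb m)"
      using ij by (cases "l = i")
        (auto intro!: measurable_leb_component borel_measurable_add borel_measurable_times)
  qed (use ij in \<open>auto simp: space_leb intro!: Rn_upd\<close>)
  show "distr (leb m) (leb m) ?S = leb m"
  proof (rule measure_eqI)
    fix A assume "A \<in> sets (distr (leb m) (leb m) ?S)"
    then have A: "A \<in> sets (leb m)" by simp
    let ?J = "{..<m} - {i}"
    have ins: "insert i ?J = {..<m}" using ij by auto
    have fI: "(indicator A :: _ \<Rightarrow> ennreal) \<in> borel_measurable (leb m)" using A by simp
    have fS: "(\<lambda>x. indicator A (?S x) :: ennreal) \<in> borel_measurable (leb m)"
      using measurable_comp[OF m fI] by (simp add: o_def)
    have upd: "x(i := y) \<in> Rn m" if "x \<in> space (PiM ?J (\<lambda>_. lborel))" for x and y :: real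
      using that ij by (auto simp: space_PiM Rn_def PiE_iff extensional_def)
    have sec: "(\<lambda>y. indicator A (x(i := y)) :: ennreal) \<in> borel_measurable borel"
      if x: "x \<in> space (PiM ?J (\<lambda>_. lborel))" for x
    proof -
      have "(\<lambda>y. x(i := y)) \<in> measurable borel (leb m)"
      proof (rule measurable_into_leb)
        show "(\<lambda>y. (x(i := y)) l) \<in> borel_measurable borel" for l
          by (cases "l = i") auto
      qed (rule upd[OF x])
      from measurable_comp[OF this fI] show ?thesis by (simp add: o_def)
    qed
    have "emeasure (distr (leb m) (leb m) ?S) A = (\<integral>\<^sup>+x. indicator A (?S x) \<partial>leb m)"
      using nn_integral_distr[OF m, of "indicator A"] A by simp
    \<comment> \<open>Coordinate \<open>i\<close> is integrated innermost. As j differs from i, the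
      shear then acts as a translation by \<open>a * x j\<close>, a constant of the inner
      integral.\<close>
    also have "\<dots> = (\<integral>\<^sup>+x. (\<integral>\<^sup>+y. indicator A (?S (x(i := y))) \<partial>lborel) \<partial>PiM ?J (\<lambda>_. lborel))"
      using lborel_prod.product_nn_integral_insert[of ?J i "\<lambda>x. indicator A (?S x)"] fS ins
      unfolding leb_def by simp
    also have "\<dots> = (\<integral>\<^sup>+x. (\<integral>\<^sup>+y. indicator A (x(i := a * x j + 1 * y)) \<partial>lborel) \<partial>PiM ?J (\<lambda>_. lborel))"
      using ij by (simp add: add.commute)
    also have "\<dots> = (\<integral>\<^sup>+x. (\<integral>\<^sup>+y. indicator A (x(i := y)) \<partial>lborel) \<partial>PiM ?J (\<lambda>_. lborel))"
    proof (rule nn_integral_cong)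
      fix x assume "x \<in> space (PiM ?J (\<lambda>_. lborel :: real measure))"
      from nn_integral_real_affine[OF sec[OF this], of 1 "a * x j"]
      show "(\<integral>\<^sup>+y. indicator A (x(i := a * x j + 1 * y)) \<partial>lborel) = (\<integral>\<^sup>+y. indicator A (x(i := y)) \<partial>lborel)"
        by simp
    qed
    also have "\<dots> = (\<integral>\<^sup>+x. indicator A x \<partial>leb m)"
      using lborel_prod.product_nn_integral_insert[of ?J i "indicator A"] fI ins
      unfolding leb_def by simp
    finally show "emeasure (distr (leb m) (leb m) ?S) A = emeasure (leb m) A"
      using A by simp
  qed simp
qed

definition rot :: "nat \<Rightarrow> nat \<Rightarrow> real \<Rightarrow> real \<Rightarrow> (nat \<Rightarrow> real) \<Rightarrow> nat \<Rightarrow> real" where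
  "rot i j c s x = x(i := c * x i - s * x j, j := s * x i + c * x j)"

text \<open>Shears preserve Lebesgue measure by Fubini, hence so do rotations.\<close>

lemma rot_eq_shears:
  assumes "c\<^sup>2 + s\<^sup>2 = 1" "c \<noteq> -1" "i \<noteq> j"
  defines "S \<equiv> \<lambda>x::nat \<Rightarrow> real. x(i := x i + (- s / (1 + c)) * x j)"
  shows "rot i j c s = S \<circ> (\<lambda>x. x(j := x j + s * x i)) \<circ> S"
proof
  fix x
  \<comment> \<open>The tangent of half the rotation angle; the half turn c = -1 is the one rotation
    without such a factorisation. The identities s t = 1 - c and t (1 + c) = s are all that is
    used.\<close>
  define t where "t = s / (1 + c)"
  have c1: "1 + c \<noteq> 0" using assms(2) by linarith
  have "s * s = (1 - c) * (1 + c)" using assms(1) by (simp add: power2_eq_square algebra_simps)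
  then have st: "s * t = 1 - c" using c1 by (simp add: t_def)
  have tc: "t * (1 + c) = s" using c1 by (simp add: t_def)
  have S: "S = (\<lambda>x. x(i := x i - t * x j))" by (simp add: S_def t_def)
  have b: "x j + s * (x i - t * x j) = s * x i + c * x j"
  proof -
    have "x j + s * (x i - t * x j) = s * x i + (1 - s * t) * x j" by (simp add: algebra_simps)
    then show ?thesis by (simp add: st)
  qed
  have a: "x i - t * x j - t * (s * x i + c * x j) = c * x i - s * x j"
  proof -
    have "x i - t * x j - t * (s * x i + c * x j) = (1 - s * t) * x i - (t * (1 + c)) * x j" by (simp add: algebra_simps)
    then show ?thesis by (simp add: st tc)
  qed
  show "rot i j c s x = (S \<circ> (\<lambda>x. x(j := x j + s * x i)) \<circ> S) x"
    using assms(3) a b by (auto simp: S rot_def fun_eq_iff)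
qed

lemma distr_leb_rot:
  assumes "c\<^sup>2 + s\<^sup>2 = 1" "c \<noteq> -1" "i < m" "j < m" "i \<noteq> j"
  shows "rot i j c s \<in> measurable (leb m) (leb m)" "distr (leb m) (leb m) (rot i j c s) = leb m"
proof -
  let ?S = "\<lambda>x::nat \<Rightarrow> real. x(i := x i + (- s / (1 + c)) * x j)"
  let ?T = "\<lambda>x::nat \<Rightarrow> real. x(j := x j + s * x i)"
  have S: "?S \<in> measurable (leb m) (leb m)" "distr (leb m) (leb m) ?S = leb m"
    by (rule distr_leb_shear; use assms in simp)+
  have T: "?T \<in> measurable (leb m) (leb m)" "distr (leb m) (leb m) ?T = leb m"
    by (rule distr_leb_shear; use assms in simp)+
  have eq: "rot i j c s = ?S \<circ> (?T \<circ> ?S)"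
    using rot_eq_shears[OF assms(1,2,5)] by (simp add: o_assoc)
  have TS: "?T \<circ> ?S \<in> measurable (leb m) (leb m)" by (rule measurable_comp[OF S(1) T(1)])
  show "rot i j c s \<in> measurable (leb m) (leb m)"
    unfolding eq by (rule measurable_comp[OF TS S(1)])
  show "distr (leb m) (leb m) (rot i j c s) = leb m"
    unfolding eq distr_distr[OF S(1) TS, symmetric] distr_distr[OF T(1) S(1), symmetric] S(2) T(2) ..
qed

lemma sum_rot_sq:
  assumes "c\<^sup>2 + s\<^sup>2 = 1" "i < m" "j < m" "i \<noteq> j"
  shows "(\<Sum>k<m. (rot i j c s x k)\<^sup>2) = (\<Sum>k<m. (x k)\<^sup>2)"
proof -
  have split: "(\<Sum>k<m. f k) = f i + f j + (\<Sum>k\<in>{..<m} - {i, j}. f k)" for f :: "nat \<Rightarrow> real"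
    using assms by (subst sum.subset_diff[of "{i, j}"]) auto
  have "(c * x i - s * x j)\<^sup>2 + (s * x i + c * x j)\<^sup>2 = (c\<^sup>2 + s\<^sup>2) * ((x i)\<^sup>2 + (x j)\<^sup>2)"
    by (simp add: power2_eq_square algebra_simps)
  then show ?thesis
    using assms by (simp add: split rot_def)
qed

lemma rot_Rn: "x \<in> Rn m \<Longrightarrow> i < m \<Longrightarrow> j < m \<Longrightarrow> rot i j c s x \<in> Rn m"
  by (simp add: rot_def Rn_upd)

section \<open>The cone measure on the sphere\<close>

definition uball :: "nat \<Rightarrow> (nat \<Rightarrow> real) set" where
  "uball m = {x \<in> Rn m. (\<Sum>i<m. (x i)\<^sup>2) \<le> 1}"

lemma measurable_uniform_leb: "f \<in> measurable (leb m) N \<Longrightarrow> f \<in> measurable (uniform_measure (leb m) A) N"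
  by (simp cong: measurable_cong_sets)

lemma uball_Rn: "uball m \<subseteq> Rn m"
  by (auto simp: uball_def)

lemma uball_eq: "uball m = {x \<in> Rn m. L2_set x {..<m} \<le> 1}"
  by (auto simp: uball_def L2_set_def)

lemma measurable_sum_sq: "(\<lambda>x. \<Sum>i<m. (x i)\<^sup>2) \<in> borel_measurable (leb m)"
  by (intro borel_measurable_sum borel_measurable_power measurable_leb_component) auto

lemma sets_uball [simp]: "uball m \<in> sets (leb m)"
  using measurable_sum_sq[of m] unfolding uball_def space_leb[symmetric] by measurable

text \<open>The ball lies between two cubes of positive and of finite measure; both bounds are
  required for normalising Lebesgue measure on it.\<close>

lemma emeasure_uball: "emeasure (leb m) (uball m) \<noteq> 0" "emeasure (leb m) (uball m) \<noteq> \<infinity>"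
proof -
  \<comment> \<open>Since a <= 1, a sum of m squares bounded by a^2 is at most m a <= 1.
    \<open>Suc m\<close> keeps a positive also for m = 0.\<close>
  define a where "a = 1 / real (Suc m)"
  have "PiE {..<m} (\<lambda>_. {-a..a}) \<subseteq> uball m"
  proof
    fix x :: "nat \<Rightarrow> real" assume x: "x \<in> PiE {..<m} (\<lambda>_. {-a..a})"
    have "(\<Sum>i<m. (x i)\<^sup>2) \<le> (\<Sum>i<m. a)"
    proof (rule sum_mono)
      fix i assume "i \<in> {..<m}"
      with x have "\<bar>x i\<bar> \<le> a" by (auto simp: PiE_iff abs_le_iff minus_le_iff)
      then have "(x i)\<^sup>2 \<le> a\<^sup>2" by (metis abs_ge_zero power2_abs power_mono)
      also have "a\<^sup>2 \<le> a" unfolding power2_eq_square by (rule mult_left_le) (auto simp: a_def)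
      finally show "(x i)\<^sup>2 \<le> a" .
    qed
    also have "\<dots> \<le> 1" by (simp add: a_def)
    finally show "x \<in> uball m" using x by (auto simp: uball_def Rn_def PiE_iff)
  qed
  then have "emeasure (leb m) (PiE {..<m} (\<lambda>_. {-a..a})) \<le> emeasure (leb m) (uball m)"
    by (rule emeasure_mono) simp
  moreover have "0 < emeasure (leb m) (PiE {..<m} (\<lambda>_. {-a..a}))"
    by (subst emeasure_leb_PiE) (auto simp: a_def ennreal_power)
  ultimately show "emeasure (leb m) (uball m) \<noteq> 0" by auto
  have "uball m \<subseteq> PiE {..<m} (\<lambda>_. {-1..1})"
  proof
    fix x assume x: "x \<in> uball m"
    have "\<bar>x i\<bar> \<le> 1" if "i < m" for i
    proof -
      have "(x i)\<^sup>2 \<le> (\<Sum>i<m. (x i)\<^sup>2)" by (rule member_le_sum) (use that in auto)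
      also have "\<dots> \<le> 1" using x by (simp add: uball_def)
      finally show ?thesis by (simp add: abs_square_le_1)
    qed
    with x show "x \<in> PiE {..<m} (\<lambda>_. {-1..1})"
      by (auto simp: uball_def Rn_def PiE_iff abs_le_iff minus_le_iff)
  qed
  then have "emeasure (leb m) (uball m) \<le> emeasure (leb m) (PiE {..<m} (\<lambda>_. {-1..1}))"
    by (rule emeasure_mono) (simp add: sets_leb_PiE)
  also have "\<dots> < \<infinity>" by (subst emeasure_leb_PiE) (auto simp: power_less_top_ennreal)
  finally show "emeasure (leb m) (uball m) \<noteq> \<infinity>" by simp
qed

lemma L2_set_rot:
  assumes "c\<^sup>2 + s\<^sup>2 = 1" "i < m" "j < m" "i \<noteq> j"
  shows "L2_set (rot i j c s x) {..<m} = L2_set x {..<m}"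
  by (simp add: L2_set_def sum_rot_sq[OF assms])

lemma radial_proj_measurable: "radial_proj d \<in> measurable (leb (Suc d)) (leb (Suc d))"
proof (rule measurable_into_leb)
  have "(\<lambda>x. L2_set x {..<Suc d}) \<in> borel_measurable (leb (Suc d))"
    unfolding L2_set_def using measurable_sum_sq[of "Suc d"] by measurable
  then show "(\<lambda>x. radial_proj d x i) \<in> borel_measurable (leb (Suc d))" if "i < Suc d" for i
    using that by (simp add: radial_proj_def borel_measurable_divide measurable_leb_component)
qed (simp add: radial_proj_def)

text \<open>The cone measure before its restriction to \<open>Sph d\<close>. It lives on the
  sigma-algebra of \<open>leb (Suc d)\<close>, so measurability and changes of variables are
  inherited from the ambient space.\<close>

definition sph_full :: "nat \<Rightarrow> (nat \<Rightarrow> real) measure" where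
  "sph_full d = distr (uniform_measure (leb (Suc d)) (uball (Suc d))) (leb (Suc d)) (radial_proj d)"

lemma sph_measure_eq: "sph_measure d = restrict_space (sph_full d) (Sph d)"
  by (simp add: sph_measure_def sph_full_def uball_eq)

lemma sets_sph_full [simp]: "sets (sph_full d) = sets (leb (Suc d))"
  by (simp add: sph_full_def)

lemma space_sph_full [simp]: "space (sph_full d) = Rn (Suc d)"
  by (simp add: sph_full_def space_leb)

lemma Sph_sets: "Sph d \<in> sets (leb (Suc d))"
proof -
  have "Sph d = {x \<in> space (leb (Suc d)). (\<Sum>i<Suc d. (x i)\<^sup>2) = 1}"
    by (auto simp: Sph_iff space_leb simp del: sum.lessThan_Suc)
  then show ?thesis using measurable_sum_sq[of "Suc d"] by (simp del: sum.lessThan_Suc)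
qed

lemma Sph_Int_Rn [simp]: "Sph d \<inter> Rn (Suc d) = Sph d"
  using Sph_Rn by auto

lemma Sph_Int_space [simp]: "Sph d \<inter> space (sph_full d) \<in> sets (sph_full d)"
  using Sph_sets[of d] by simp

lemma space_sph_measure [simp]: "space (sph_measure d) = Sph d"
  using Sph_Rn[of _ d] by (auto simp: sph_measure_eq space_restrict_space)

text \<open>Only the origin fails to be projected to the sphere: division by zero sends it to
  itself. It is a box with degenerate sides, hence null because there is at least one
  coordinate.\<close>

lemma AE_sph_full_Sph: "AE x in sph_full d. x \<in> Sph d"
proof -
  have "emeasure (leb (Suc d)) {\<lambda>i\<in>{..<Suc d}. 0} = 0"
  proof -
    have "{\<lambda>i\<in>{..<Suc d}. 0::real} = PiE {..<Suc d} (\<lambda>_. {0})"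
      by (auto simp: PiE_iff extensional_def fun_eq_iff)
    moreover have "emeasure (leb (Suc d)) (PiE {..<Suc d} (\<lambda>_. {0})) = 0"
      by (subst emeasure_leb_PiE) auto
    ultimately show ?thesis by simp
  qed
  moreover have sng: "{\<lambda>i\<in>{..<Suc d}. 0} \<in> sets (leb (Suc d))"
  proof -
    have "{\<lambda>i\<in>{..<Suc d}. 0::real} = PiE {..<Suc d} (\<lambda>_. {0})"
      by (auto simp: PiE_iff extensional_def fun_eq_iff)
    moreover have "PiE {..<Suc d} (\<lambda>_. {0::real}) \<in> sets (leb (Suc d))"
      by (rule sets_leb_PiE) auto
    ultimately show ?thesis by simp
  qed
  ultimately have "AE x in leb (Suc d). x \<noteq> (\<lambda>i\<in>{..<Suc d}. 0)"
    by (intro AE_I[where N="{\<lambda>i\<in>{..<Suc d}. 0}"]) auto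
  then have "AE x in leb (Suc d). radial_proj d x \<in> Sph d"
  proof (rule AE_mp, intro AE_I2 impI)
    fix x assume x: "x \<in> space (leb (Suc d))" "x \<noteq> (\<lambda>i\<in>{..<Suc d}. 0)"
    have "L2_set x {..<Suc d} \<noteq> 0"
    proof
      assume "L2_set x {..<Suc d} = 0"
      then have "\<forall>i\<in>{..<Suc d}. x i = 0" by (simp add: L2_set_eq_0_iff)
      then have "x = (\<lambda>i\<in>{..<Suc d}. 0)"
        using x(1) by (auto simp: space_leb Rn_def PiE_iff extensional_def)
      with x(2) show False by simp
    qed
    moreover have "(\<Sum>i<Suc d. (x i)\<^sup>2) = (L2_set x {..<Suc d})\<^sup>2" by (simp add: L2_set_lessThan_sq)
    ultimately show "radial_proj d x \<in> Sph d"
      by (simp add: Sph_iff radial_proj_def power_divide sum_divide_distrib[symmetric] del: sum.lessThan_Suc)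
  qed
  then have "AE x in uniform_measure (leb (Suc d)) (uball (Suc d)). radial_proj d x \<in> Sph d"
    by (intro AE_uniform_measureI) auto
  moreover have "{x \<in> space (leb (Suc d)). x \<in> Sph d} = Sph d"
    by (auto simp: space_leb Sph_Rn)
  ultimately show ?thesis
    unfolding sph_full_def
    by (subst AE_distr_iff) (auto simp: Sph_sets measurable_uniform_leb[OF radial_proj_measurable])
qed

text \<open>The complement of the sphere is null for \<open>sph_full\<close>, so restricting and
  pushing back changes nothing. Every integral over the sphere thereby becomes one over the unit
  ball.\<close>

lemma distr_sph_full:
  shows "(\<lambda>x. x) \<in> measurable (sph_measure d) (leb (Suc d))"
    and "distr (sph_measure d) (leb (Suc d)) (\<lambda>x. x) = sph_full d"
proof -
  have "(\<lambda>x. x) \<in> measurable (sph_full d) (leb (Suc d))"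
    by (rule measurable_ident_sets) simp
  then show m: "(\<lambda>x. x) \<in> measurable (sph_measure d) (leb (Suc d))"
    unfolding sph_measure_eq by (rule measurable_restrict_space1)
  show "distr (sph_measure d) (leb (Suc d)) (\<lambda>x. x) = sph_full d"
  proof (rule measure_eqI)
    fix A assume "A \<in> sets (distr (sph_measure d) (leb (Suc d)) (\<lambda>x. x))"
    then have A: "A \<in> sets (leb (Suc d))" by simp
    have "emeasure (distr (sph_measure d) (leb (Suc d)) (\<lambda>x. x)) A = emeasure (sph_measure d) (A \<inter> Sph d)"
      using A m by (simp add: emeasure_distr)
    also have "\<dots> = emeasure (sph_full d) (A \<inter> Sph d)"
      unfolding sph_measure_eq by (rule emeasure_restrict_space) (auto simp: Sph_sets)
    also have "\<dots> = emeasure (sph_full d) A"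
      using A Sph_sets[of d] AE_sph_full_Sph[of d] by (intro emeasure_eq_AE) (auto intro!: sets.Int)
    finally show "emeasure (distr (sph_measure d) (leb (Suc d)) (\<lambda>x. x)) A = emeasure (sph_full d) A" .
  qed simp
qed

lemma measurable_sph: "f \<in> measurable (leb (Suc d)) N \<Longrightarrow> f \<in> measurable (sph_measure d) N"
  using measurable_comp[OF distr_sph_full(1)] by (simp add: o_def)

lemma emeasure_sph_measure: "emeasure (sph_measure d) (Sph d) = 1"
proof -
  have "emeasure (sph_measure d) (Sph d) = emeasure (sph_full d) (Sph d)"
    unfolding sph_measure_eq by (rule emeasure_restrict_space) (auto simp: Sph_sets)
  also have "\<dots> = emeasure (sph_full d) (Rn (Suc d))"
    using Sph_sets[of d] AE_sph_full_Sph[of d] sets.top[of "leb (Suc d)"] Sph_Rn[of _ d]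
    by (intro emeasure_eq_AE) (auto simp: space_leb elim!: AE_mp)
  also have "\<dots> = emeasure (uniform_measure (leb (Suc d)) (uball (Suc d)))
      (radial_proj d -` Rn (Suc d) \<inter> Rn (Suc d))"
    unfolding sph_full_def using sets.top[of "leb (Suc d)"]
    by (subst emeasure_distr[OF measurable_uniform_leb[OF radial_proj_measurable]]) (simp_all add: space_leb)
  also have "radial_proj d -` Rn (Suc d) \<inter> Rn (Suc d) = Rn (Suc d)"
    by (auto simp: radial_proj_def)
  also have "emeasure (uniform_measure (leb (Suc d)) (uball (Suc d))) (Rn (Suc d)) =
      emeasure (leb (Suc d)) (uball (Suc d)) / emeasure (leb (Suc d)) (uball (Suc d))"
    using sets.top[of "leb (Suc d)"] by (simp add: space_leb Int_absorb2[OF uball_Rn])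
  also have "\<dots> = 1"
    using emeasure_uball[of "Suc d"] by (simp add: ennreal_divide_self top.not_eq_extremum)
  finally show ?thesis .
qed

lemma finite_sph_measure: "finite_measure (sph_measure d)"
  by (rule finite_measureI) (simp add: emeasure_sph_measure)

text \<open>A rotation preserves the norm, hence commutes with the radial projection and maps the
  ball to itself; it also preserves Lebesgue measure. The invariance is thus read off in the
  ball.\<close>

lemma integral_sph_rot:
  fixes f :: "(nat \<Rightarrow> real) \<Rightarrow> real"
  assumes "c\<^sup>2 + s\<^sup>2 = 1" "c \<noteq> -1" "i < Suc d" "j < Suc d" "i \<noteq> j"
    and f: "f \<in> borel_measurable (leb (Suc d))"
  shows "(\<integral>x. f (rot i j c s x) \<partial>sph_measure d) = (\<integral>x. f x \<partial>sph_measure d)"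
proof -
  let ?m = "Suc d" and ?R = "rot i j c s"
  let ?U = "uniform_measure (leb ?m) (uball ?m)"
  have R: "?R \<in> measurable (leb ?m) (leb ?m)" by (rule distr_leb_rot) fact+
  have fR: "(\<lambda>x. f (?R x)) \<in> borel_measurable (leb ?m)" using measurable_comp[OF R f] by (simp add: o_def)
  have RU: "?R \<in> measurable ?U (leb ?m)" "radial_proj d \<in> measurable ?U (leb ?m)"
    by (rule measurable_uniform_leb, rule R, rule measurable_uniform_leb, rule radial_proj_measurable)
  have red: "(\<integral>x. g x \<partial>sph_measure d) = (\<integral>x. g (radial_proj d x) \<partial>?U)"
    if "g \<in> borel_measurable (leb ?m)" for g :: "_ \<Rightarrow> real"
    using integral_distr[OF distr_sph_full(1)[of d] that] integral_distr[OF RU(2) that]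
    by (simp add: distr_sph_full(2) sph_full_def)
  have distrU: "distr ?U (leb ?m) ?R = ?U"
  proof (rule measure_eqI)
    fix A assume "A \<in> sets (distr ?U (leb ?m) ?R)"
    then have A: "A \<in> sets (leb ?m)" by simp
    have pre: "?R -` A \<inter> Rn ?m \<in> sets (leb ?m)" using measurable_sets[OF R A] by (simp add: space_leb)
    have "emeasure (distr ?U (leb ?m) ?R) A = emeasure ?U (?R -` A \<inter> Rn ?m)"
      using A RU by (simp add: emeasure_distr space_leb)
    also have "\<dots> = emeasure (leb ?m) (uball ?m \<inter> (?R -` A \<inter> Rn ?m)) / emeasure (leb ?m) (uball ?m)"
      using pre by simp
    also have "uball ?m \<inter> (?R -` A \<inter> Rn ?m) = ?R -` (uball ?m \<inter> A) \<inter> space (leb ?m)"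
      using assms rot_Rn[of _ ?m i j c s]
      by (auto simp: uball_def space_leb sum_rot_sq simp del: sum.lessThan_Suc)
    also have "emeasure (leb ?m) \<dots> = emeasure (distr (leb ?m) (leb ?m) ?R) (uball ?m \<inter> A)"
      by (rule emeasure_distr[OF R, symmetric]) (use A in auto)
    also have "distr (leb ?m) (leb ?m) ?R = leb ?m" by (rule distr_leb_rot) fact+
    finally show "emeasure (distr ?U (leb ?m) ?R) A = emeasure ?U A" using A by simp
  qed simp
  have comm: "?R (radial_proj d x) = radial_proj d (?R x)" for x
    unfolding radial_proj_def L2_set_rot[OF assms(1,3,4,5)]
    using assms(3-5) by (auto simp: rot_def fun_eq_iff add_divide_distrib diff_divide_distrib)
  have fp: "(\<lambda>x. f (radial_proj d x)) \<in> borel_measurable (leb ?m)"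
    using measurable_comp[OF radial_proj_measurable f] by (simp add: o_def)
  have "(\<integral>x. f (?R x) \<partial>sph_measure d) = (\<integral>x. f (radial_proj d (?R x)) \<partial>?U)"
    using red[OF fR] by (simp add: comm)
  also have "\<dots> = (\<integral>x. f (radial_proj d x) \<partial>distr ?U (leb ?m) ?R)"
    by (rule integral_distr[OF RU(1) fp, symmetric])
  also have "\<dots> = (\<integral>x. f x \<partial>sph_measure d)" using red[OF f] by (simp add: distrU)
  finally show ?thesis .
qed

text \<open>\<open>Ck\<close> speaks of one coordinate at a time, whereas a rotation moves two.
  Total differentiability in the pair follows from both partial derivatives and the continuity of
  one of them, after which the curve is composed.\<close>

lemma Ck_has_derivative_curve:
  assumes f: "Ck m (Suc k) f" and x: "x \<in> Rn m" and ij: "i < m" "j < m" "i \<noteq> j"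
    and a: "(a has_real_derivative a') (at \<tau>)" and b: "(b has_real_derivative b') (at \<tau>)"
  defines "z \<equiv> x(i := a \<tau>, j := b \<tau>)"
  shows "((\<lambda>t. f (x(i := a t, j := b t))) has_real_derivative a' * pd i f z + b' * pd j f z) (at \<tau>)"
proof -
  define F where "F = (\<lambda>s t. f (x(i := s, j := t)))"
  have R: "x(i := s, j := t) \<in> Rn m" for s t using x ij by (simp add: Rn_upd)
  have "((\<lambda>(s, t). F s t) has_derivative
      (\<lambda>(ts, tt). blinfun_apply (blinfun_mult_right (pd i f z)) ts + blinfun_apply (blinfun_mult_right (pd j f z)) tt))
      (at (a \<tau>, b \<tau>) within UNIV \<times> UNIV)"
    unfolding z_def
  proof (rule has_derivative_partialsI)
    have "((\<lambda>s. f ((x(j := b \<tau>))(i := s))) has_real_derivative pd i f ((x(j := b \<tau>))(i := a \<tau>))) (at (a \<tau>))"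
      by (rule Ck_has_derivative[OF f Rn_upd[OF x ij(2)] ij(1)])
    then show "((\<lambda>s. F s (b \<tau>)) has_derivative
        blinfun_apply (blinfun_mult_right (pd i f (x(i := a \<tau>, j := b \<tau>))))) (at (a \<tau>) within UNIV)"
      using ij by (simp add: F_def has_field_derivative_def fun_upd_twist)
    show "((\<lambda>t. F s t) has_derivative blinfun_apply (blinfun_mult_right (pd j f (x(i := s, j := t))))) (at t within UNIV)" for s t
      using Ck_has_derivative[OF f Rn_upd[OF x ij(1)] ij(2), of s t]
      by (simp add: F_def has_field_derivative_def)
    have "continuous_on UNIV (\<lambda>p. pd j f (x(i := fst p, j := snd p)))"
    proof (rule continuous_on_compose2[OF Ck_continuous[OF Ck_pd[OF f ij(2)]]])
      show "continuous_on UNIV (\<lambda>p. x(i := fst p, j := snd p))"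
      proof (rule continuous_on_into_Rn)
        show "continuous_on UNIV (\<lambda>p. (x(i := fst p, j := snd p)) l)" for l
          by (cases "l = j"; cases "l = i") (auto intro!: continuous_intros)
      qed (rule R)
    qed (use R in auto)
    then have "continuous_on UNIV (\<lambda>p. blinfun_mult_right (pd j f (x(i := fst p, j := snd p))))"
      by (intro bounded_linear.continuous_on[OF bounded_linear_blinfun_mult_right])
    then show "continuous (at (a \<tau>, b \<tau>) within UNIV \<times> UNIV) (\<lambda>(s, t). blinfun_mult_right (pd j f (x(i := s, j := t))))"
      by (simp add: continuous_on_eq_continuous_within case_prod_unfold)
  qed auto
  then have F: "((\<lambda>(s, t). F s t) has_derivative (\<lambda>(ts, tt). pd i f z * ts + pd j f z * tt))
      (at (a \<tau>, b \<tau>) within UNIV)" by simp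
  have "((\<lambda>t. (a t, b t)) has_derivative (\<lambda>h. (a' * h, b' * h))) (at \<tau>)"
    using a b by (auto simp: has_field_derivative_def intro!: derivative_intros)
  from has_derivative_compose[OF this F]
  have "((\<lambda>t. F (a t) (b t)) has_derivative (\<lambda>h. pd i f z * (a' * h) + pd j f z * (b' * h))) (at \<tau>)"
    by simp
  moreover have "(\<lambda>h. pd i f z * (a' * h) + pd j f z * (b' * h)) = (*) (a' * pd i f z + b' * pd j f z)"
    by (simp add: fun_eq_iff algebra_simps)
  ultimately show ?thesis
    by (simp add: has_field_derivative_def F_def)
qed

section \<open>The divergence theorem on the sphere\<close>

lemma integrable_sph_bounded:
  assumes "f \<in> borel_measurable (sph_measure d)" "\<And>x. x \<in> Sph d \<Longrightarrow> \<bar>f x\<bar> \<le> (C :: real)"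
  shows "integrable (sph_measure d) f"
  using assms by (intro finite_measure.integrable_const_bound[OF finite_sph_measure, of _ C]) auto

lemma continuous_on_sph_measurable:
  "continuous_on (Rn (Suc d)) f \<Longrightarrow> (f :: _ \<Rightarrow> real) \<in> borel_measurable (sph_measure d)"
  by (intro measurable_sph continuous_on_Rn_measurable)

lemma integrable_sph_continuous:
  assumes "continuous_on (Rn (Suc d)) (f :: _ \<Rightarrow> real)" shows "integrable (sph_measure d) f"
proof -
  obtain C where "\<And>x. x \<in> Sph d \<Longrightarrow> \<bar>f x\<bar> \<le> C" using bounded_on_Sph[OF assms] by metis
  then show ?thesis using continuous_on_sph_measurable[OF assms] by (rule integrable_sph_bounded[rotated])
qed

lemma rot_Sph:
  assumes "c\<^sup>2 + s\<^sup>2 = 1" "i < Suc d" "j < Suc d" "i \<noteq> j" "x \<in> Sph d"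
  shows "rot i j c s x \<in> Sph d"
  using assms by (simp add: Sph_iff rot_Rn sum_rot_sq del: sum.lessThan_Suc)

text \<open>The integrand is the derivative at angle 0 of f along the rotation in the plane of
  \<open>i\<close> and \<open>j\<close>. By invariance the difference quotients have integral 0, and
  dominated convergence passes to the limit.\<close>

lemma integral_rotation_generator:
  assumes f: "Ck (Suc d) (Suc 0) f" and ij: "i < Suc d" "j < Suc d" "i \<noteq> j"
  shows "(\<integral>x. x i * pd j f x - x j * pd i f x \<partial>sph_measure d) = 0"
proof -
  define L where "L = (\<lambda>x. x i * pd j f x - x j * pd i f x)"
  have contL: "continuous_on (Rn (Suc d)) L"
    unfolding L_def using f ij
    by (intro continuous_intros continuous_on_coordinate Ck_continuous[of _ 0] Ck_pd)
  obtain C where C: "C \<ge> 0" "\<And>x. x \<in> Sph d \<Longrightarrow> \<bar>L x\<bar> \<le> C" using bounded_on_Sph[OF contL] by metis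
  \<comment> \<open>Angles in (0, 1] have positive cosine, so the invariance lemma with its
    condition \<open>c \<noteq> -1\<close> applies to each of them.\<close>
  define \<theta> where "\<theta> = (\<lambda>k::nat. inverse (real (Suc k)))"
  have \<theta>: "0 < \<theta> k" "\<theta> k \<le> 1" for k by (auto simp: \<theta>_def field_simps)
  have \<theta>0: "\<theta> \<longlonglongrightarrow> 0" unfolding \<theta>_def by (rule LIMSEQ_inverse_real_of_nat)
  define R where "R = (\<lambda>t. rot i j (cos t) (sin t))"
  define D where "D = (\<lambda>k x. (f (R (\<theta> k) x) - f x) / \<theta> k)"
  have RS: "R t x \<in> Sph d" if "x \<in> Sph d" for t x
    unfolding R_def using that ij by (intro rot_Sph) auto
  have R0: "R 0 x = x" for x by (auto simp: R_def rot_def fun_eq_iff)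
  have deriv: "((\<lambda>t. f (R t x)) has_real_derivative L (R t x)) (at t)" if "x \<in> Sph d" for t x
  proof -
    have a: "((\<lambda>t. cos t * x i - sin t * x j) has_real_derivative - (R t x j)) (at t)"
      using ij by (auto intro!: derivative_eq_intros simp: R_def rot_def)
    have b: "((\<lambda>t. sin t * x i + cos t * x j) has_real_derivative R t x i) (at t)"
      using ij by (auto intro!: derivative_eq_intros simp: R_def rot_def)
    have R: "x(i := cos t * x i - sin t * x j, j := sin t * x i + cos t * x j) = R t x" for t
      by (simp add: R_def rot_def)
    from Ck_has_derivative_curve[OF f Sph_Rn[OF that] ij a b]
    show ?thesis unfolding R by (simp add: L_def)
  qed
  have fm: "f \<in> borel_measurable (leb (Suc d))"
    by (rule continuous_on_Rn_measurable[OF Ck_continuous[OF f]])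
  have c1: "cos (\<theta> k) \<noteq> -1" for k
  proof -
    have "cos (\<theta> k) > 0" using \<theta>[of k] pi_gt3 by (intro cos_gt_zero) auto
    then show ?thesis by linarith
  qed
  have Rm: "R (\<theta> k) \<in> measurable (leb (Suc d)) (leb (Suc d))" for k
    unfolding R_def by (rule distr_leb_rot) (use c1 ij in auto)
  have fR: "(\<lambda>x. f (R (\<theta> k) x)) \<in> borel_measurable (leb (Suc d))" for k
    using measurable_comp[OF Rm fm] by (simp add: o_def)
  obtain B where B: "\<And>x. x \<in> Sph d \<Longrightarrow> \<bar>f x\<bar> \<le> B" using bounded_on_Sph[OF Ck_continuous[OF f]] by metis
  have "(\<integral>x. D k x \<partial>sph_measure d) = 0" for k
  proof -
    have "integrable (sph_measure d) f" "integrable (sph_measure d) (\<lambda>x. f (R (\<theta> k) x))"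
      by (auto intro!: integrable_sph_bounded[of _ _ B] measurable_sph fm fR B RS)
    moreover have "(\<integral>x. f (R (\<theta> k) x) \<partial>sph_measure d) = (\<integral>x. f x \<partial>sph_measure d)"
      unfolding R_def by (rule integral_sph_rot) (use ij c1 fm in auto)
    ultimately show ?thesis by (simp add: D_def)
  qed
  moreover have "(\<lambda>k. \<integral>x. D k x \<partial>sph_measure d) \<longlonglongrightarrow> (\<integral>x. L x \<partial>sph_measure d)"
  proof (rule integral_dominated_convergence[where w="\<lambda>_. C"])
    show "L \<in> borel_measurable (sph_measure d)" by (rule continuous_on_sph_measurable[OF contL])
    show "D k \<in> borel_measurable (sph_measure d)" for k
      unfolding D_def using fR[of k] fm by (intro measurable_sph borel_measurable_divide borel_measurable_diff) auto
    show "integrable (sph_measure d) (\<lambda>_. C)" by (rule finite_measure.integrable_const[OF finite_sph_measure])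
    show "AE x in sph_measure d. (\<lambda>k. D k x) \<longlonglongrightarrow> L x"
    proof (rule AE_I2)
      fix x assume "x \<in> space (sph_measure d)"
      then have x: "x \<in> Sph d" by simp
      have "((\<lambda>h. (f (R h x) - f x) / h) \<longlongrightarrow> L x) (at 0)"
        using deriv[OF x, of 0] by (simp add: DERIV_def R0)
      moreover have "filterlim \<theta> (at 0) sequentially"
        using \<theta>0 \<theta>(1) by (auto simp: filterlim_at dual_order.strict_implies_not_eq)
      ultimately show "(\<lambda>k. D k x) \<longlonglongrightarrow> L x"
        unfolding D_def by (rule filterlim_compose)
    qed
    show "AE x in sph_measure d. norm (D k x) \<le> C" for k
    proof (rule AE_I2)
      fix x assume "x \<in> space (sph_measure d)"
      then have x: "x \<in> Sph d" by simp
      \<comment> \<open>The orbit stays on the sphere, so the mean value theorem along it bounds the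
        quotient by the supremum of \<open>L\<close> there.\<close>
      obtain z where "f (R (\<theta> k) x) - f (R 0 x) = (\<theta> k - 0) * L (R z x)"
        using MVT2[OF \<theta>(1)[of k], of "\<lambda>t. f (R t x)" "\<lambda>t. L (R t x)"] deriv[OF x] by blast
      then have "D k x = L (R z x)" using \<theta>[of k] by (simp add: D_def R0)
      then show "norm (D k x) \<le> C" using C(2)[OF RS[OF x]] by simp
    qed
  qed
  ultimately show ?thesis by (simp add: L_def LIMSEQ_const_iff)
qed

lemma continuous_on_sph_div:
  assumes "sph_tangent_field d X" shows "continuous_on (Rn (Suc d)) (sph_div d X)"
proof -
  have "continuous_on (Rn (Suc d)) (pd i (\<lambda>x. X x j))" if "i < Suc d" "j < Suc d" for i j
    using assms that by (auto simp: sph_tangent_field_def intro!: smooth_continuous smooth_pd)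
  then show ?thesis
    unfolding sph_div_def
    by (intro continuous_intros continuous_on_coordinate) auto
qed

lemma pd_triple:
  assumes "Ck m (Suc k) u" "smooth m f" "x \<in> Rn m" "i < m"
  shows "pd i (\<lambda>x. u x * x l * f x) x =
    pd i u x * x l * f x + u x * (if i = l then 1 else 0) * f x + u x * x l * pd i f x"
proof -
  have 1: "Ck m (Suc k) (\<lambda>x. u x * x l)"
    by (intro Ck_mult assms smooth_Ck smooth_coordinate)
  have "pd i (\<lambda>x. u x * x l * f x) x = pd i (\<lambda>x. u x * x l) x * f x + u x * x l * pd i f x"
    by (rule pd_mult[OF 1 smooth_Ck[OF assms(2), of "Suc 0"] assms(3,4)])
  also have "pd i (\<lambda>x. u x * x l) x = pd i u x * x l + u x * (if i = l then 1 else 0)"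
    using pd_mult[OF assms(1) smooth_Ck[OF smooth_coordinate, of m "Suc 0" l] assms(3,4)]
    by (simp add: pd_coordinate)
  finally show ?thesis by (simp add: algebra_simps)
qed

text \<open>On the sphere \<open>sph_div d X = (\<Sum>i j. \<omega> i * L i j X\<^sub>j)\<close> with the rotation generators
  \<open>L i j f = \<omega> i * pd j f - \<omega> j * pd i f\<close>, all of which have mean zero.\<close>

lemma sphere_divergence:
  assumes u: "Ck (Suc d) (Suc 0) u" and X: "sph_tangent_field d X"
  shows "(\<integral>x. u x * sph_div d X x \<partial>sph_measure d)
    = - (\<integral>x. (\<Sum>j<Suc d. pd j u x * X x j) \<partial>sph_measure d)"
proof -
  let ?M = "sph_measure d"
  have smX: "smooth (Suc d) (\<lambda>x. X x j)" if "j < Suc d" for j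
    using X that by (simp add: sph_tangent_field_def)
  \<comment> \<open>Both \<open>u\<close> and the coordinate \<open>x i\<close> are placed under the
    derivative, so a vanishing mean contains the derivatives of \<open>u\<close> and of
    \<open>X\<close> together: this is the integration by parts.\<close>
  define f where "f = (\<lambda>i j x. u x * x i * X x j)"
  have fCk: "Ck (Suc d) (Suc 0) (f i j)" if "j < Suc d" for i j
    unfolding f_def using that by (intro Ck_mult u smooth_Ck smooth_coordinate smX)
  define L where "L = (\<lambda>i j x. x i * pd j (f i j) x - x j * pd i (f i j) x)"
  have contL: "continuous_on (Rn (Suc d)) (L i j)" if "i < Suc d" "j < Suc d" for i j
    unfolding L_def
    by (intro continuous_intros continuous_on_coordinate Ck_continuous[OF Ck_pd[OF fCk]] that)
  have L0: "(\<integral>x. L i j x \<partial>?M) = 0" if "i < Suc d" "j < Suc d" for i j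
  proof (cases "i = j")
    case False
    then show ?thesis unfolding L_def using that by (intro integral_rotation_generator fCk)
  qed (simp add: L_def)
  have sumL: "(\<Sum>i<Suc d. \<Sum>j<Suc d. L i j x) = (\<Sum>j<Suc d. pd j u x * X x j) + u x * sph_div d X x"
    if x: "x \<in> Sph d" for x
  proof -
    define A where "A = {..<Suc d}"
    have sq: "(\<Sum>i\<in>A. x i * x i) = 1"
      using x by (simp add: Sph_iff A_def power2_eq_square del: sum.lessThan_Suc)
    have tan: "(\<Sum>j\<in>A. x j * X x j) = 0"
      using X x by (simp add: sph_tangent_field_def A_def del: sum.lessThan_Suc)
    \<comment> \<open>After summation the terms containing \<open>x j * X x j\<close> and the
      diagonal one vanish by tangency. The sum of the squares \<open>x i * x i\<close> is 1, which
      leaves the pairing of the derivatives of \<open>u\<close> with \<open>X\<close>; the last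
      bracket becomes \<open>sph_div\<close> once its indices are swapped.\<close>
    have L: "L i j x = (pd j u x * X x j) * (x i * x i) - (pd i u x * x i) * (x j * X x j)
        + u x * (if i = j then x i * X x j else 0) - u x * (x j * X x j)
        + u x * ((x i * x i) * pd j (\<lambda>x. X x j) x - x i * x j * pd i (\<lambda>x. X x j) x)"
      if "i \<in> A" "j \<in> A" for i j
      using pd_triple[OF u smX[of j] Sph_Rn[OF x], of i i] pd_triple[OF u smX[of j] Sph_Rn[OF x], of j i] that
      by (auto simp: L_def f_def A_def algebra_simps)
    have "(\<Sum>i\<in>A. \<Sum>j\<in>A. L i j x) =
        (\<Sum>i\<in>A. \<Sum>j\<in>A. (pd j u x * X x j) * (x i * x i))
        - (\<Sum>i\<in>A. \<Sum>j\<in>A. (pd i u x * x i) * (x j * X x j))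
        + (\<Sum>i\<in>A. \<Sum>j\<in>A. u x * (if i = j then x i * X x j else 0))
        - (\<Sum>i\<in>A. \<Sum>j\<in>A. u x * (x j * X x j))
        + u x * ((\<Sum>i\<in>A. \<Sum>j\<in>A. (x i * x i) * pd j (\<lambda>x. X x j) x)
          - (\<Sum>i\<in>A. \<Sum>j\<in>A. x i * x j * pd i (\<lambda>x. X x j) x))"
      by (simp add: L sum.distrib sum_subtractf sum_distrib_left right_diff_distrib cong: sum.cong)
    also have "(\<Sum>i\<in>A. \<Sum>j\<in>A. (pd j u x * X x j) * (x i * x i)) = (\<Sum>j\<in>A. pd j u x * X x j)"
      by (subst sum.swap) (simp add: sum_distrib_left[symmetric] sq)
    also have "(\<Sum>i\<in>A. \<Sum>j\<in>A. (pd i u x * x i) * (x j * X x j)) = 0"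
      by (simp add: sum_distrib_left[symmetric] tan)
    also have "(\<Sum>i\<in>A. \<Sum>j\<in>A. u x * (if i = j then x i * X x j else 0)) = 0"
    proof -
      have "(\<Sum>j\<in>A. u x * (if i = j then x i * X x j else 0)) = u x * (x i * X x i)" if "i \<in> A" for i
      proof -
        have "(\<Sum>j\<in>A. u x * (if i = j then x i * X x j else 0)) = (\<Sum>j\<in>A. if i = j then u x * (x i * X x j) else 0)"
          by (intro sum.cong) auto
        then show ?thesis using that by (simp add: A_def del: sum.lessThan_Suc)
      qed
      then have "(\<Sum>i\<in>A. \<Sum>j\<in>A. u x * (if i = j then x i * X x j else 0)) = u x * (\<Sum>i\<in>A. x i * X x i)"
        by (simp add: sum_distrib_left)
      then show ?thesis by (simp add: tan)
    qed
    also have "(\<Sum>i\<in>A. \<Sum>j\<in>A. u x * (x j * X x j)) = 0"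
      by (simp add: sum_distrib_left[symmetric] tan)
    also have "(\<Sum>i\<in>A. \<Sum>j\<in>A. (x i * x i) * pd j (\<lambda>x. X x j) x) = (\<Sum>j\<in>A. pd j (\<lambda>x. X x j) x)"
      by (subst sum.swap) (simp add: sum_distrib_right[symmetric] sq)
    also have "(\<Sum>i\<in>A. \<Sum>j\<in>A. x i * x j * pd i (\<lambda>x. X x j) x) = (\<Sum>i\<in>A. \<Sum>j\<in>A. x i * x j * pd j (\<lambda>x. X x i) x)"
      by (subst sum.swap) (simp add: mult.commute)
    finally show ?thesis by (simp add: A_def sph_div_def del: sum.lessThan_Suc)
  qed
  have "(\<integral>x. (\<Sum>i<Suc d. \<Sum>j<Suc d. L i j x) \<partial>?M) = (\<Sum>i<Suc d. \<Sum>j<Suc d. \<integral>x. L i j x \<partial>?M)"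
    using contL by (subst Bochner_Integration.integral_sum)
      (auto intro!: Bochner_Integration.integral_sum sum.cong Bochner_Integration.integrable_sum
        integrable_sph_continuous continuous_on_sum simp del: sum.lessThan_Suc)
  also have "\<dots> = 0" using L0 by (simp del: sum.lessThan_Suc)
  finally have "(\<integral>x. (\<Sum>j<Suc d. pd j u x * X x j) + u x * sph_div d X x \<partial>?M) = 0"
    using sumL Bochner_Integration.integral_cong[of ?M ?M "\<lambda>x. \<Sum>i<Suc d. \<Sum>j<Suc d. L i j x"
        "\<lambda>x. (\<Sum>j<Suc d. pd j u x * X x j) + u x * sph_div d X x"]
    by (simp del: sum.lessThan_Suc)
  moreover have "integrable ?M (\<lambda>x. \<Sum>j<Suc d. pd j u x * X x j)" "integrable ?M (\<lambda>x. u x * sph_div d X x)"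
    by (intro integrable_sph_continuous continuous_intros Ck_continuous[OF u] continuous_on_sph_div[OF X]
        Ck_continuous[OF Ck_pd[OF u]] smooth_continuous[OF smX]; simp)+
  ultimately show ?thesis by (simp del: sum.lessThan_Suc)
qed

section \<open>Uniqueness of the weak gradient on the sphere\<close>

text \<open>These sets are stable under intersection, generate the sigma-algebra, and have
  indicators that are limits of products of smooth one-variable functions.\<close>

definition orthant :: "nat \<Rightarrow> (nat \<Rightarrow> real) \<Rightarrow> (nat \<Rightarrow> real) set" where
  "orthant m a = {x \<in> Rn m. \<forall>i<m. a i < x i}"

text \<open>A product of generated sigma-algebras is generated by cylinders once countably many
  generators cover each factor, as the rays from -k do. For the single block \<open>{..<m}\<close>
  the cylinders are exactly the orthants.\<close>

lemma sets_leb_eq_sigma: "sets (leb m) = sigma_sets (Rn m) (range (orthant m))"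
proof -
  let ?\<Omega> = "\<lambda>_::nat. UNIV :: real set" and ?E = "\<lambda>_::nat. range (\<lambda>a::real. {a<..})"
  have "sets (leb m) = sets (\<Pi>\<^sub>M i\<in>{..<m}. sigma (?\<Omega> i) (?E i))"
    unfolding leb_def
  proof (rule sets_PiM_cong[OF refl])
    show "sets lborel = sets (sigma UNIV (range (\<lambda>a::real. {a<..})))"
      by (simp only: sets_lborel borel_Ioi)
  qed
  also have "\<dots> = sets (sigma (\<Pi>\<^sub>E i\<in>{..<m}. ?\<Omega> i)
      {{f \<in> (\<Pi>\<^sub>E i\<in>{..<m}. ?\<Omega> i). \<forall>i\<in>j. f i \<in> A i} | A j. j \<in> {{..<m}} \<and> A \<in> Pi j ?E})"
  proof (rule sets_PiM_sigma)
    fix i assume "i \<in> {..<m}"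
    show "\<exists>S\<subseteq>?E i. countable S \<and> ?\<Omega> i = \<Union>S"
    proof (intro exI[of _ "range (\<lambda>k::nat. {- real k<..})"] conjI)
      show "UNIV = (\<Union>k::nat. {- real k<..})"
      proof (rule set_eqI)
        fix x :: real
        obtain k :: nat where "- x < real k" using reals_Archimedean2 by blast
        then show "x \<in> UNIV \<longleftrightarrow> x \<in> (\<Union>k::nat. {- real k<..})" by (auto intro!: exI[of _ k])
      qed
    qed auto
  qed auto
  also have "{{f \<in> (\<Pi>\<^sub>E i\<in>{..<m}. ?\<Omega> i). \<forall>i\<in>j. f i \<in> A i} | A j. j \<in> {{..<m}} \<and> A \<in> Pi j ?E} = range (orthant m)"
  proof safe
    fix A j assume A: "A \<in> Pi {..<m} ?E"
    then have "\<forall>i\<in>{..<m}. \<exists>b. A i = {b<..}" unfolding Pi_iff by blast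
    from bchoice[OF this] obtain b where b: "\<forall>i\<in>{..<m}. A i = {b i<..}" ..
    have "{f \<in> (\<Pi>\<^sub>E i\<in>{..<m}. ?\<Omega> i). \<forall>i\<in>{..<m}. f i \<in> A i} = orthant m b"
      using b by (simp add: orthant_def Rn_def Ball_def)
    then show "{f \<in> (\<Pi>\<^sub>E i\<in>{..<m}. ?\<Omega> i). \<forall>i\<in>{..<m}. f i \<in> A i} \<in> range (orthant m)"
      by simp
  next
    fix a
    show "\<exists>A j. orthant m a = {f \<in> (\<Pi>\<^sub>E i\<in>{..<m}. ?\<Omega> i). \<forall>i\<in>j. f i \<in> A i} \<and> j \<in> {{..<m}} \<and> A \<in> Pi j ?E"
    proof (intro exI conjI)
      show "orthant m a = {f \<in> (\<Pi>\<^sub>E i\<in>{..<m}. ?\<Omega> i). \<forall>i\<in>{..<m}. f i \<in> {a i<..}}"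
        by (simp add: orthant_def Rn_def Ball_def)
      show "(\<lambda>i. {a i<..}) \<in> Pi {..<m} ?E" by (rule Pi_I) simp
    qed simp
  qed
  also have "sets (sigma (\<Pi>\<^sub>E i\<in>{..<m}. ?\<Omega> i) (range (orthant m))) = sigma_sets (Rn m) (range (orthant m))"
    unfolding Rn_def[symmetric] by (rule sets_measure_of) (auto simp: orthant_def)
  finally show ?thesis .
qed

lemma sets_orthant [simp]: "orthant m a \<in> sets (leb m)"
  by (auto simp: sets_leb_eq_sigma)

text \<open>Dynkin's theorem with the orthants as generator. It serves twice: for integrals over
  subsets of the sphere, and for the translation of indicators in L1.\<close>

lemma leb_sets_induct [consumes 1, case_names orthant empty compl union]:
  assumes "A \<in> sets (leb m)"
    and "\<And>a. P (orthant m a)" and "P {}"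
    and "\<And>A. A \<in> sets (leb m) \<Longrightarrow> P A \<Longrightarrow> P (Rn m - A)"
    and "\<And>A. disjoint_family A \<Longrightarrow> range A \<subseteq> sets (leb m) \<Longrightarrow> (\<And>i. P (A i)) \<Longrightarrow> P (\<Union>i::nat. A i)"
  shows "P A"
proof -
  have int: "Int_stable (range (orthant m))"
  proof (rule Int_stableI)
    fix A B assume "A \<in> range (orthant m)" "B \<in> range (orthant m)"
    then obtain a b where "A = orthant m a" "B = orthant m b" by auto
    then have "A \<inter> B = orthant m (\<lambda>i. max (a i) (b i))" by (auto simp: orthant_def)
    then show "A \<inter> B \<in> range (orthant m)" by auto
  qed
  have sub: "range (orthant m) \<subseteq> Pow (Rn m)" by (auto simp: orthant_def)
  show ?thesis
    using assms(1) unfolding sets_leb_eq_sigma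
  proof (induction rule: sigma_sets_induct_disjoint[OF int sub, consumes 1, case_names basic empty compl union])
    case (basic A)
    then show ?case using assms(2) by auto
  next
    case empty
    show ?case by (rule assms(3))
  next
    case (compl A)
    show ?case by (rule assms(4)) (simp_all only: sets_leb_eq_sigma compl)
  next
    case (union A)
    show ?case by (rule assms(5)) (simp_all only: sets_leb_eq_sigma union)
  qed
qed

definition smooth_orthant :: "nat \<Rightarrow> (nat \<Rightarrow> real) \<Rightarrow> nat \<Rightarrow> (nat \<Rightarrow> real) \<Rightarrow> real" where
  "smooth_orthant m a k x = (\<Prod>i<m. flat 0 (real (Suc k) * (x i - a i)))"

lemma smooth_smooth_orthant: "smooth m (smooth_orthant m a k)"
  unfolding smooth_orthant_def
proof (rule smooth_prod)
  fix i
  have "smooth m (\<lambda>x. real (Suc k) ^ 0 * flat 0 (real (Suc k) * x i + (- real (Suc k) * a i)))"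
    by (rule smooth_deriv_seq[OF deriv_seq_affine[OF deriv_seq_flat]])
  then show "smooth m (\<lambda>x. flat 0 (real (Suc k) * (x i - a i)))" by (simp add: algebra_simps)
qed

lemma smooth_orthant_bounds: "0 \<le> smooth_orthant m a k x" "smooth_orthant m a k x \<le> 1"
  unfolding smooth_orthant_def by (auto intro!: prod_nonneg prod_le_1 simp: flat_bounds)

lemma smooth_orthant_tendsto:
  assumes "x \<in> Rn m" shows "(\<lambda>k. smooth_orthant m a k x) \<longlonglongrightarrow> indicator (orthant m a) x"
proof -
  have "(\<lambda>k. smooth_orthant m a k x) \<longlonglongrightarrow> (\<Prod>i<m. indicator {a i<..} (x i))"
    unfolding smooth_orthant_def by (intro tendsto_prod flat_tendsto_indicator)
  also have "(\<Prod>i<m. indicator {a i<..} (x i)) = (indicator (orthant m a) x :: real)"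
    using assms by (auto simp: orthant_def indicator_def prod_zero_iff)
  finally show ?thesis .
qed

text \<open>The fundamental lemma of the calculus of variations. Smooth functions approximate
  orthants, so \<open>H\<close> has integral 0 over traces of orthants and then, by Dynkin, over all
  traces of measurable sets. The sets where \<open>H\<close> and \<open>- H\<close> are positive
  finish the argument.\<close>

lemma AE_sph_zeroI:
  fixes H :: "(nat \<Rightarrow> real) \<Rightarrow> real"
  assumes H: "integrable (sph_measure d) H"
    and orth: "\<And>\<phi>. smooth (Suc d) \<phi> \<Longrightarrow> (\<integral>x. \<phi> x * H x \<partial>sph_measure d) = 0"
  shows "AE x in sph_measure d. H x = 0"
proof -
  let ?M = "sph_measure d" and ?m = "Suc d"
  have setsM: "A \<inter> Sph d \<in> sets ?M" if "A \<in> sets (leb ?m)" for A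
    using measurable_sets[OF distr_sph_full(1)[of d] that] by simp
  have zero: "(LINT x:A \<inter> Sph d|?M. H x) = 0" if "A \<in> sets (leb ?m)" for A
    using that
  proof (induction rule: leb_sets_induct)
    case (orthant a)
    have "(\<lambda>k. \<integral>x. smooth_orthant ?m a k x * H x \<partial>?M) \<longlonglongrightarrow> (\<integral>x. indicator (orthant ?m a \<inter> Sph d) x *\<^sub>R H x \<partial>?M)"
    proof (rule integral_dominated_convergence[where w="\<lambda>x. \<bar>H x\<bar>"])
      show "(\<lambda>x. indicator (orthant ?m a \<inter> Sph d) x *\<^sub>R H x) \<in> borel_measurable ?M"
        using H setsM[OF sets_orthant] by (intro borel_measurable_scaleR borel_measurable_indicator) auto
      show "(\<lambda>x. smooth_orthant ?m a k x * H x) \<in> borel_measurable ?M" for k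
        by (rule borel_measurable_times[OF continuous_on_sph_measurable[OF smooth_continuous[OF smooth_smooth_orthant]]
            borel_measurable_integrable[OF H]])
      show "integrable ?M (\<lambda>x. \<bar>H x\<bar>)" using H by simp
      show "AE x in ?M. (\<lambda>k. smooth_orthant ?m a k x * H x) \<longlonglongrightarrow> indicator (orthant ?m a \<inter> Sph d) x *\<^sub>R H x"
      proof (rule AE_I2)
        fix x assume "x \<in> space ?M"
        then have x: "x \<in> Sph d" by simp
        show "(\<lambda>k. smooth_orthant ?m a k x * H x) \<longlonglongrightarrow> indicator (orthant ?m a \<inter> Sph d) x *\<^sub>R H x"
          using tendsto_mult[OF smooth_orthant_tendsto[OF Sph_Rn[OF x]] tendsto_const[of "H x"], of a] x
          by (simp add: indicator_def)
      qed
      show "AE x in ?M. norm (smooth_orthant ?m a k x * H x) \<le> \<bar>H x\<bar>" for k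
        using smooth_orthant_bounds[of ?m a k] by (auto intro!: AE_I2 mult_left_le_one_le simp: abs_mult)
    qed
    moreover have "(\<integral>x. smooth_orthant ?m a k x * H x \<partial>?M) = 0" for k
      by (rule orth[OF smooth_smooth_orthant])
    ultimately show ?case by (simp add: set_lebesgue_integral_def LIMSEQ_const_iff)
  next
    case empty
    then show ?case by (simp add: set_lebesgue_integral_def)
  next
    case (compl A)
    have "(LINT x:(Rn ?m - A) \<inter> Sph d|?M. H x) = (\<integral>x. H x - indicator (A \<inter> Sph d) x *\<^sub>R H x \<partial>?M)"
      unfolding set_lebesgue_integral_def
      by (intro Bochner_Integration.integral_cong) (auto simp: indicator_def Sph_Rn)
    also have "\<dots> = (\<integral>x. H x \<partial>?M) - (\<integral>x. indicator (A \<inter> Sph d) x *\<^sub>R H x \<partial>?M)"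
      by (rule Bochner_Integration.integral_diff[OF H]) (rule integrable_mult_indicator[OF setsM[OF compl(1)] H])
    \<comment> \<open>The constant 1 is an admissible smooth function and gives the integral over
      the whole sphere, which the complement case needs.\<close>
    also have "(\<integral>x. H x \<partial>?M) = 0" using orth[of "\<lambda>_. 1"] by simp
    finally show ?case using compl(2) by (simp add: set_lebesgue_integral_def)
  next
    case (union A)
    have "(LINT x:(\<Union>i. A i \<inter> Sph d)|?M. H x) = (\<Sum>i. LINT x:A i \<inter> Sph d|?M. H x)"
    proof (rule lebesgue_integral_countable_add)
      show "A i \<inter> Sph d \<in> sets ?M" for i using union(2) by (intro setsM) auto
      then have "(\<Union>i. A i \<inter> Sph d) \<in> sets ?M" by (intro sets.countable_UN) blast
      then show "set_integrable ?M (\<Union>i. A i \<inter> Sph d) H"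
        unfolding set_integrable_def by (rule integrable_mult_indicator[OF _ H])
      show "(A i \<inter> Sph d) \<inter> (A j \<inter> Sph d) = {}" if "i \<noteq> j" for i j
        using union(1) that by (auto simp: disjoint_family_on_def)
    qed
    then show ?case using union(3) by simp
  qed
  have half: "AE x in ?M. G x \<le> 0" if G: "integrable ?M G"
    and z: "\<And>A. A \<in> sets (leb ?m) \<Longrightarrow> (LINT x:A \<inter> Sph d|?M. G x) = 0" for G :: "_ \<Rightarrow> real"
  proof -
    have "{x \<in> space ?M. G x > 0} \<in> sets ?M"
      using borel_measurable_integrable[OF G] by measurable
    \<comment> \<open>Measurable sets of the sphere are traces of ambient ones; this brings the set
      of positivity within reach of the hypothesis \<open>z\<close>.\<close>
    then obtain A where A: "A \<in> sets (leb ?m)" "{x \<in> Sph d. G x > 0} = A \<inter> Sph d"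
      unfolding sph_measure_eq sets_restrict_space using Sph_Rn by (auto simp: space_restrict_space)
    have mem: "x \<in> A \<longleftrightarrow> G x > 0" if "x \<in> Sph d" for x using A(2) that by auto
    have "(\<integral>x. max 0 (G x) \<partial>?M) = (LINT x:A \<inter> Sph d|?M. G x)"
      unfolding set_lebesgue_integral_def
      by (intro Bochner_Integration.integral_cong) (auto simp: indicator_def mem)
    with z[OF A(1)] have "(\<integral>x. max 0 (G x) \<partial>?M) = 0" by simp
    moreover have "integrable ?M (\<lambda>x. max 0 (G x))" using G by simp
    ultimately have "AE x in ?M. max 0 (G x) = 0"
      using integral_nonneg_eq_0_iff_AE[of ?M "\<lambda>x. max 0 (G x)"] by auto
    then show ?thesis by eventually_elim (simp add: max_def split: if_splits)
  qed
  have "AE x in ?M. H x \<le> 0" by (rule half[OF H zero])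
  moreover have "AE x in ?M. - H x \<le> 0"
    using half[of "\<lambda>x. - H x"] H zero by (simp add: set_lebesgue_integral_def)
  ultimately show ?thesis by eventually_elim simp
qed

lemma square_integrable_sph_integrable:
  "square_integrable (sph_measure d) f \<Longrightarrow> integrable (sph_measure d) f"
  unfolding square_integrable_def
  by (rule finite_measure.square_integrable_imp_integrable[OF finite_sph_measure]) auto

lemma integrable_sph_mult_bounded:
  assumes "integrable (sph_measure d) f" "continuous_on (Rn (Suc d)) \<phi>"
  shows "integrable (sph_measure d) (\<lambda>x. \<phi> x * f x :: real)"
proof -
  obtain C where C: "C \<ge> 0" "\<And>x. x \<in> Sph d \<Longrightarrow> \<bar>\<phi> x\<bar> \<le> C" using bounded_on_Sph[OF assms(2)] by metis
  show ?thesis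
  proof (rule Bochner_Integration.integrable_bound)
    show "integrable (sph_measure d) (\<lambda>x. C * f x)" using assms(1) by simp
    show "(\<lambda>x. \<phi> x * f x) \<in> borel_measurable (sph_measure d)"
      by (rule borel_measurable_times[OF continuous_on_sph_measurable[OF assms(2)]
            borel_measurable_integrable[OF assms(1)]])
    show "AE x in sph_measure d. norm (\<phi> x * f x) \<le> norm (C * f x)"
      using C by (auto intro!: AE_I2 mult_right_mono simp: abs_mult)
  qed
qed

text \<open>The tangential part of \<open>\<phi> e\<^sub>i\<close> tests the \<open>i\<close>-th component of a gradient.\<close>

lemma has_weak_sph_grad_unique:
  assumes G: "has_weak_sph_grad d u G" and G': "has_weak_sph_grad d u G'" and i: "i < Suc d"
  shows "AE x in sph_measure d. G x i = G' x i"
proof -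
  let ?M = "sph_measure d"
  have int: "integrable ?M (\<lambda>x. F x j)" if "has_weak_sph_grad d u F" "j < Suc d" for F j
    using that by (auto simp: has_weak_sph_grad_def intro: square_integrable_sph_integrable)
  have "AE x in ?M. G x i - G' x i = 0"
  proof (rule AE_sph_zeroI)
    show "integrable ?M (\<lambda>x. G x i - G' x i)"
      by (intro Bochner_Integration.integrable_diff int[OF G i] int[OF G' i])
  next
    fix \<phi> assume \<phi>: "smooth (Suc d) \<phi>"
    \<comment> \<open>The projection of the basis vector with index \<open>i\<close> onto the
      tangent space, times \<open>\<phi>\<close>. Its polynomial formula extends it smoothly to the
      ambient space.\<close>
    define X where "X = (\<lambda>x j. \<phi> x * ((if j = i then 1 else 0) + (-1) * (x i * x j)))"
    have smX: "smooth (Suc d) (\<lambda>x. X x j)" for j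
      unfolding X_def by (intro smooth_mult smooth_add \<phi> smooth_const smooth_coordinate)
    have X_sum: "(\<Sum>j<Suc d. F j * X x j) = \<phi> x * (F i - x i * (\<Sum>j<Suc d. x j * F j))" for F x
    proof -
      have "(\<Sum>j<Suc d. F j * X x j) = (\<Sum>j<Suc d. \<phi> x * ((if j = i then F j else 0) - x i * (x j * F j)))"
        by (intro sum.cong) (auto simp: X_def algebra_simps)
      also have "\<dots> = \<phi> x * ((\<Sum>j<Suc d. if j = i then F j else 0) - x i * (\<Sum>j<Suc d. x j * F j))"
        by (simp only: sum_distrib_left[symmetric] sum_subtractf)
      also have "(\<Sum>j<Suc d. if j = i then F j else 0) = F i"
        using i by (simp del: sum.lessThan_Suc)
      finally show ?thesis .
    qed
    have X: "sph_tangent_field d X"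
      unfolding sph_tangent_field_def
      using smX by (auto simp: X_sum Sph_iff power2_eq_square simp del: sum.lessThan_Suc)
    have test: "(\<integral>x. \<phi> x * F x i \<partial>?M) = - (\<integral>x. u x * sph_div d X x \<partial>?M)" if F: "has_weak_sph_grad d u F" for F
    proof -
      have "AE x in ?M. (\<Sum>j<Suc d. x j * F x j) = 0" using F by (simp add: has_weak_sph_grad_def)
      \<comment> \<open>A gradient is tangent, so the radial correction in \<open>X\<close>
        contributes nothing to the pairing and component \<open>i\<close> remains.\<close>
      then have "AE x in ?M. \<phi> x * F x i = (\<Sum>j<Suc d. F x j * X x j)"
        by eventually_elim (simp add: X_sum del: sum.lessThan_Suc)
      moreover have "(\<lambda>x. \<Sum>j<Suc d. F x j * X x j) \<in> borel_measurable ?M"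
        by (rule borel_measurable_sum)
          (auto intro: borel_measurable_times[OF borel_measurable_integrable[OF int[OF F]]
            continuous_on_sph_measurable[OF smooth_continuous[OF smX]]])
      moreover have "(\<lambda>x. \<phi> x * F x i) \<in> borel_measurable ?M"
        by (rule borel_measurable_integrable[OF integrable_sph_mult_bounded[OF int[OF F i] smooth_continuous[OF \<phi>]]])
      ultimately have "(\<integral>x. \<phi> x * F x i \<partial>?M) = (\<integral>x. (\<Sum>j<Suc d. F x j * X x j) \<partial>?M)"
        by (intro integral_cong_AE)
      then show ?thesis using F X by (simp add: has_weak_sph_grad_def del: sum.lessThan_Suc)
    qed
    have "(\<integral>x. \<phi> x * (G x i - G' x i) \<partial>?M) = (\<integral>x. \<phi> x * G x i \<partial>?M) - (\<integral>x. \<phi> x * G' x i \<partial>?M)"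
      unfolding right_diff_distrib
      by (rule Bochner_Integration.integral_diff[OF integrable_sph_mult_bounded[OF int[OF G i] smooth_continuous[OF \<phi>]]
          integrable_sph_mult_bounded[OF int[OF G' i] smooth_continuous[OF \<phi>]]])
    then show "(\<integral>x. \<phi> x * (G x i - G' x i) \<partial>?M) = 0" using test[OF G] test[OF G'] by simp
  qed
  then show ?thesis by eventually_elim simp
qed

section \<open>Marginals of the cone measure\<close>

lemma measurable_sum_sq_PiM:
  "(\<lambda>x. \<Sum>i\<in>J. (x i)\<^sup>2) \<in> borel_measurable (PiM J (\<lambda>_. lborel :: real measure))"
  by (intro borel_measurable_sum borel_measurable_power
      measurable_component_singleton[where M="\<lambda>_. lborel", simplified])

text \<open>The measure of a ball in \<open>\<real>\<^sup>k\<close>, \<open>k = card J\<close>, scales like the \<open>k\<close>-th power of its radius.\<close>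

lemma distr_sum_sq:
  fixes J :: "nat set"
  assumes J: "finite J" "J \<noteq> {}"
  obtains C :: real where
    "distr (PiM J (\<lambda>_. lborel)) borel (\<lambda>x. \<Sum>i\<in>J. (x i)\<^sup>2)
      = density lborel (\<lambda>t. ennreal (C * (max 0 t) powr (real (card J) / 2 - 1)))" "C \<ge> 0"
proof -
  let ?P = "PiM J (\<lambda>_. lborel :: real measure)" and ?q = "\<lambda>x::nat \<Rightarrow> real. \<Sum>i\<in>J. (x i)\<^sup>2"
  define k where "k = real (card J)"
  have k: "k > 0" unfolding k_def using J by (simp add: card_gt_0_iff)
  define V where "V b = emeasure ?P {x \<in> space ?P. ?q x \<le> b}" for b
  have sV: "{x \<in> space ?P. ?q x \<le> b} \<in> sets ?P" for b
    using measurable_sum_sq_PiM[of J] by measurable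
  have sub: "{x \<in> space ?P. ?q x \<le> b} \<subseteq> PiE J (\<lambda>_. {- sqrt b..sqrt b})" for b
  proof
    fix x assume x: "x \<in> {x \<in> space ?P. ?q x \<le> b}"
    have "\<bar>x i\<bar> \<le> sqrt b" if "i \<in> J" for i
    proof -
      have "(x i)\<^sup>2 \<le> ?q x" by (rule member_le_sum) (use that J in auto)
      also have "\<dots> \<le> b" using x by simp
      finally show ?thesis by (metis real_sqrt_abs real_sqrt_le_iff)
    qed
    then show "x \<in> PiE J (\<lambda>_. {- sqrt b..sqrt b})"
      using x by (auto simp: space_PiM PiE_iff abs_le_iff minus_le_iff)
  qed
  have le: "V b \<le> (\<Prod>i\<in>J. emeasure lborel {- sqrt b..sqrt b})" for b
  proof -
    have "V b \<le> emeasure ?P (PiE J (\<lambda>_. {- sqrt b..sqrt b}))"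
      unfolding V_def by (rule emeasure_mono[OF sub]) (use J in \<open>auto intro!: sets_PiM_I_finite\<close>)
    then show ?thesis using J by (simp add: lborel_prod.emeasure_PiM)
  qed
  have fin: "V b < \<infinity>" for b
  proof (rule le_less_trans[OF le])
    show "(\<Prod>i\<in>J. emeasure lborel {- sqrt b..sqrt b}) < \<infinity>"
      by (cases "- sqrt b \<le> sqrt b") (auto simp: power_less_top_ennreal J)
  qed
  have zero: "V b = 0" if "b \<le> 0" for b
  proof -
    \<comment> \<open>\<open>sqrt\<close> is negative at negative arguments, where the interval is
      therefore empty; at b = 0 it is a point.\<close>
    have "sqrt b \<le> 0" using that by simp
    have "{- sqrt b..sqrt b} \<subseteq> {0}"
    proof
      fix x assume "x \<in> {- sqrt b..sqrt b}"
      with \<open>sqrt b \<le> 0\<close> show "x \<in> {0}" unfolding atLeastAtMost_iff singleton_iff by linarith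
    qed
    then have "emeasure lborel {- sqrt b..sqrt b} \<le> emeasure lborel {0::real}"
      by (rule emeasure_mono) simp
    then have "emeasure lborel {- sqrt b..sqrt b} = 0" by simp
    then show ?thesis using le[of b] J by (simp add: zero_power card_gt_0_iff)
  qed
  define \<kappa> where "\<kappa> = enn2real (V 1)"
  have \<kappa>: "V 1 = ennreal \<kappa>" "\<kappa> \<ge> 0" using fin[of 1] by (auto simp: \<kappa>_def)
  have scale: "V b = ennreal (\<kappa> * b powr (k / 2))" if b: "b > 0" for b
  proof -
    have "V b = (\<integral>\<^sup>+x. indicator {x \<in> space ?P. ?q x \<le> b} x \<partial>?P)"
      using sV by (simp add: V_def)
    \<comment> \<open>The substitution of \<open>sqrt b * x\<close> for \<open>x\<close> turns the
      ball of squared radius b into the unit ball.\<close>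
    also have "\<dots> = ennreal (\<bar>sqrt b\<bar> ^ card J) * (\<integral>\<^sup>+x. indicator {x \<in> space ?P. ?q x \<le> b} (\<lambda>i\<in>J. 0 + sqrt b * x i) \<partial>?P)"
      by (rule nn_integral_PiM_affine) (use b J sV in auto)
    also have "(\<integral>\<^sup>+x. indicator {x \<in> space ?P. ?q x \<le> b} (\<lambda>i\<in>J. 0 + sqrt b * x i) \<partial>?P)
        = (\<integral>\<^sup>+x. indicator {x \<in> space ?P. ?q x \<le> 1} x \<partial>?P)"
      using b by (intro nn_integral_cong)
        (auto simp: indicator_def space_PiM power_mult_distrib sum_distrib_left[symmetric])
    also have "\<dots> = V 1" using sV by (simp add: V_def)
    also have "\<bar>sqrt b\<bar> ^ card J = b powr (k / 2)"
      using b by (simp add: k_def powr_half_sqrt[symmetric] powr_powr powr_realpow[symmetric] del: powr_half_sqrt)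
    finally show ?thesis using \<kappa> by (simp add: ennreal_mult mult.commute)
  qed
  \<comment> \<open>The coefficient obtained by differentiating kappa * b^(k/2). In the density,
    \<open>max 0 t\<close> together with 0 as the value of \<open>0 powr _\<close> removes the
    negative half line, whatever the sign of the exponent.\<close>
  define C where "C = \<kappa> * k / 2"
  have C: "C \<ge> 0" using \<kappa> k by (simp add: C_def)
  let ?D = "density lborel (\<lambda>t. ennreal (C * (max 0 t) powr (k / 2 - 1)))"
  have D: "emeasure ?D {..b} = V b" for b
  proof -
    have "emeasure ?D {..b} = (\<integral>\<^sup>+t. ennreal (C * (max 0 t) powr (k / 2 - 1)) * indicator {..b} t \<partial>lborel)"
      by (simp add: emeasure_density)
    also have "\<dots> = (\<integral>\<^sup>+t. indicator {0..b} t * ennreal (C * t powr (k / 2 - 1)) \<partial>lborel)"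
      by (intro nn_integral_cong) (auto simp: indicator_def max_def)
    also have "\<dots> = V b"
    proof (cases "b > 0")
      case True
      have "((\<lambda>t. C * t powr (k / 2 - 1)) has_integral C * (b powr (k / 2 - 1 + 1) / (k / 2 - 1 + 1))) {0..b}"
        using True k by (intro has_integral_mult_right has_integral_powr_from_0) auto
      then have "(\<integral>\<^sup>+t. indicator {0..b} t * ennreal (C * t powr (k / 2 - 1)) \<partial>lborel)
          = ennreal (C * (b powr (k / 2 - 1 + 1) / (k / 2 - 1 + 1)))"
        using C by (subst nn_integral_has_integral_lebesgue[of "{0..b}" "\<lambda>t. C * t powr (k / 2 - 1)", symmetric])
          (auto intro!: nn_integral_cong simp: indicator_def)
      also have "C * (b powr (k / 2 - 1 + 1) / (k / 2 - 1 + 1)) = \<kappa> * b powr (k / 2)"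
        using k by (simp add: C_def)
      finally show ?thesis using scale[OF True] by simp
    next
      case False
      then have t: "t \<notin> {0..b} \<or> t = 0" for t unfolding atLeastAtMost_iff by linarith
      then have "indicator {0..b} t * ennreal (C * t powr (k / 2 - 1)) = 0" for t
        using t[of t] by (elim disjE) auto
      then have "(\<lambda>t. indicator {0..b} t * ennreal (C * t powr (k / 2 - 1))) = (\<lambda>t. 0)"
        by (rule ext)
      then show ?thesis using zero[of b] False by simp
    qed
    finally show ?thesis .
  qed
  have "distr ?P borel ?q = ?D"
  proof (rule measure_eqI_generator_eq[where E="range (\<lambda>b::real. {..b})" and \<Omega>=UNIV and A="\<lambda>n. {..real n}"])
    show "Int_stable (range (\<lambda>b::real. {..b}))"
    proof (rule Int_stableI)
      fix A B assume "A \<in> range (\<lambda>b::real. {..b})" "B \<in> range (\<lambda>b::real. {..b})"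
      then obtain a b where "A = {..a}" "B = {..b}" by auto
      then have "A \<inter> B = {..min a b}" by auto
      then show "A \<inter> B \<in> range (\<lambda>b::real. {..b})" by auto
    qed
    fix X assume "X \<in> range (\<lambda>b::real. {..b})"
    then obtain b where X: "X = {..b}" by auto
    have "emeasure (distr ?P borel ?q) {..b} = V b"
      unfolding V_def by (subst emeasure_distr)
        (auto simp: measurable_sum_sq_PiM intro!: arg_cong2[where f=emeasure])
    then show "emeasure (distr ?P borel ?q) X = emeasure ?D X" by (simp add: X D)
  next
    show "sets (distr ?P borel ?q) = sigma_sets UNIV (range (\<lambda>b::real. {..b}))"
      by (simp add: borel_eq_atMost)
    show "sets ?D = sigma_sets UNIV (range (\<lambda>b::real. {..b}))"
      by (simp add: borel_eq_atMost)
    show "(\<Union>n. {..real n}) = UNIV" using real_arch_simple by auto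
    have "emeasure (distr ?P borel ?q) {..real n} = V (real n)" for n
      unfolding V_def by (subst emeasure_distr)
        (auto simp: measurable_sum_sq_PiM intro!: arg_cong2[where f=emeasure])
    then show "emeasure (distr ?P borel ?q) {..real n} \<noteq> \<infinity>" for n using fin[of "real n"] by simp
  qed auto
  then show ?thesis using that[of C] C by (simp add: k_def)
qed

text \<open>With a = (d - n - 1)/2, the unnormalised density of the first n coordinates of a uniform
  point of the sphere. It vanishes off the open unit ball, also for a = 0, as
  \<open>0 powr 0\<close> is 0.\<close>

definition profile :: "nat \<Rightarrow> real \<Rightarrow> (nat \<Rightarrow> real) \<Rightarrow> real" where
  "profile n a w = (max 0 (1 - (\<Sum>i<n. (w i)\<^sup>2))) powr a"

lemma profile_nonneg: "0 \<le> profile n a w"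
  by (simp add: profile_def)

lemma profile_measurable: "profile n a \<in> borel_measurable (leb n)"
  unfolding profile_def using measurable_sum_sq[of n] by measurable

lemma nn_integral_sph_full:
  assumes "f \<in> borel_measurable (leb (Suc d))"
  shows "(\<integral>\<^sup>+x. f x \<partial>sph_measure d)
    = (\<integral>\<^sup>+x. f (radial_proj d x) * indicator (uball (Suc d)) x \<partial>leb (Suc d)) / emeasure (leb (Suc d)) (uball (Suc d))"
proof -
  have "(\<integral>\<^sup>+x. f x \<partial>sph_measure d) = (\<integral>\<^sup>+x. f x \<partial>sph_full d)"
    unfolding distr_sph_full(2)[symmetric]
    by (rule nn_integral_distr[OF distr_sph_full(1), symmetric]) (use assms in simp)
  also have "\<dots> = (\<integral>\<^sup>+x. f (radial_proj d x) \<partial>uniform_measure (leb (Suc d)) (uball (Suc d)))"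
    unfolding sph_full_def using assms
    by (intro nn_integral_distr measurable_uniform_leb radial_proj_measurable) simp
  also have "\<dots> = (\<integral>\<^sup>+x. f (radial_proj d x) * indicator (uball (Suc d)) x \<partial>leb (Suc d)) / emeasure (leb (Suc d)) (uball (Suc d))"
    using measurable_comp[OF radial_proj_measurable assms] by (intro nn_integral_uniform_measure) (auto simp: o_def)
  finally show ?thesis .
qed

lemma max_0_mult_powr: "s \<ge> 0 \<Longrightarrow> (max 0 (s * b)) powr a = s powr a * (max 0 b) powr (a::real)"
  by (cases "b \<ge> 0") (auto simp: max_def powr_mult mult_nonneg_nonneg zero_le_mult_iff)

text \<open>In the coordinates \<open>t = |x|\<^sup>2\<close> and \<open>w = x' / |x|\<close> of the ball, where \<open>x'\<close> are the first \<open>n\<close>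
  coordinates of \<open>x\<close>, Lebesgue measure becomes a product.\<close>

lemma sph_marginal:
  assumes n: "n \<le> d"
  obtains c :: ennreal where
    "\<And>h. h \<in> borel_measurable (leb n) \<Longrightarrow>
      (\<integral>\<^sup>+x. h (restrict x {..<n}) \<partial>sph_measure d)
        = c * (\<integral>\<^sup>+w. h w * ennreal (profile n ((real d - real n - 1) / 2) w) \<partial>leb n)"
proof -
  define J where "J = {n..<Suc d}"
  let ?P = "PiM J (\<lambda>_. lborel :: real measure)" and ?q = "\<lambda>x::nat \<Rightarrow> real. \<Sum>i\<in>J. (x i)\<^sup>2"
  let ?r = "\<lambda>x::nat \<Rightarrow> real. \<Sum>i<n. (x i)\<^sup>2"
  define a where "a = (real d - real n - 1) / 2"
  have J: "finite J" "J \<noteq> {}" "real (card J) / 2 - 1 = a"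
    using n by (auto simp: J_def a_def of_nat_diff field_simps)
  obtain C where C: "C \<ge> 0"
    "distr ?P borel ?q = density lborel (\<lambda>t. ennreal (C * (max 0 t) powr a))"
    using distr_sum_sq[OF J(1,2)] J(3) by metis
  have IJ: "{..<n} \<union> J = {..<Suc d}" "{..<n} \<inter> J = {}" using n by (auto simp: J_def)
  \<comment> \<open>Everything that depends on the radius: the Jacobian of the substitution of
    \<open>sqrt s * w\<close> for x', and the power of s that splits off the density.\<close>
  define K where "K = (\<integral>\<^sup>+s. indicator {0<..1} s * ennreal (sqrt s ^ n) * ennreal (C * s powr a) \<partial>lborel)"
  define c where "c = K / emeasure (leb (Suc d)) (uball (Suc d))"
  interpret pair_sigma_finite "leb n" lborel
    by (simp add: pair_sigma_finite_def sigma_finite_leb lborel.sigma_finite_measure_axioms)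
  show ?thesis
  proof (rule that[of c])
    fix h :: "_ \<Rightarrow> ennreal" assume h[measurable]: "h \<in> borel_measurable (leb n)"
    have r[measurable]: "?r \<in> borel_measurable (leb n)" by (rule measurable_sum_sq)
    have q[measurable]: "?q \<in> borel_measurable ?P" by (rule measurable_sum_sq_PiM)
    have comp: "(\<lambda>x. x i) \<in> borel_measurable (leb n)" if "i < n" for i
      using that by (rule measurable_leb_component)
    define F where "F = (\<lambda>x. h (restrict (radial_proj d x) {..<n}) * indicator (uball (Suc d)) x)"
    have restr: "(\<lambda>x. restrict x {..<n}) \<in> measurable (leb (Suc d)) (leb n)"
      using n by (intro measurable_into_leb) (auto intro: measurable_leb_component)
    have hr: "(\<lambda>x. h (restrict x {..<n})) \<in> borel_measurable (leb (Suc d))"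
      using measurable_comp[OF restr h] by (simp add: o_def)
    have Fm: "F \<in> borel_measurable (leb (Suc d))"
      unfolding F_def using measurable_comp[OF radial_proj_measurable hr]
      by (intro borel_measurable_times_ennreal borel_measurable_indicator sets_uball) (simp add: o_def)
    \<comment> \<open>The integrand on the ball in the variables x' and s = |x|^2, in which the
      radial projection is a division by \<open>sqrt s\<close>.\<close>
    define g where "g = (\<lambda>(x, s). h (\<lambda>i\<in>{..<n}. x i / sqrt s) * indicator {..1} s)"
    have div: "(\<lambda>(x, s). \<lambda>i\<in>{..<n}. x i / sqrt s) \<in> measurable (leb n \<Otimes>\<^sub>M lborel) (leb n)"
      by (rule measurable_into_leb) (auto simp: case_prod_unfold intro!: borel_measurable_divide
          measurable_compose[OF measurable_fst comp])
    have gm[measurable]: "g \<in> borel_measurable (leb n \<Otimes>\<^sub>M lborel)"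
      unfolding g_def case_prod_unfold using measurable_comp[OF div h] by (simp add: o_def case_prod_unfold)
    have F_merge: "F (merge {..<n} J (x, y)) = g (x, ?r x + ?q y)"
      if x: "x \<in> space (leb n)" and y: "y \<in> space ?P" for x y
    proof -
      let ?z = "merge {..<n} J (x, y)"
      have z: "?z \<in> Rn (Suc d)"
        using n by (auto simp: Rn_def PiE_iff extensional_def merge_def J_def)
      have "(\<Sum>i<Suc d. (?z i)\<^sup>2) = (\<Sum>i<n. (?z i)\<^sup>2) + (\<Sum>i\<in>J. (?z i)\<^sup>2)"
        using IJ J(1) by (metis finite_lessThan sum.union_disjoint)
      also have "(\<Sum>i<n. (?z i)\<^sup>2) = ?r x" by (intro sum.cong) (auto simp: merge_def)
      also have "(\<Sum>i\<in>J. (?z i)\<^sup>2) = ?q y" using IJ(2) by (intro sum.cong) (auto simp: merge_def)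
      finally have s: "(\<Sum>i<Suc d. (?z i)\<^sup>2) = ?r x + ?q y" .
      have "restrict (radial_proj d ?z) {..<n} = (\<lambda>i\<in>{..<n}. x i / sqrt (?r x + ?q y))"
        using n s by (auto simp: radial_proj_def L2_set_def merge_def fun_eq_iff simp del: sum.lessThan_Suc)
      then show ?thesis
        using z s by (simp add: F_def g_def uball_def indicator_def del: sum.lessThan_Suc)
    qed
    have "(\<integral>\<^sup>+x. F x \<partial>leb (Suc d)) = (\<integral>\<^sup>+x. (\<integral>\<^sup>+y. F (merge {..<n} J (x, y)) \<partial>?P) \<partial>leb n)"
      using lborel_prod.product_nn_integral_fold[OF IJ(2) _ J(1), of F] Fm IJ(1) unfolding leb_def by simp
    also have "\<dots> = (\<integral>\<^sup>+x. (\<integral>\<^sup>+y. g (x, ?r x + ?q y) \<partial>?P) \<partial>leb n)"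
      by (intro nn_integral_cong F_merge)
    \<comment> \<open>The remaining coordinates enter only through their squared norm, whose law is
      known. The new variable s is the full squared norm, a translate of it by |x'|^2.\<close>
    also have "\<dots> = (\<integral>\<^sup>+x. (\<integral>\<^sup>+s. g (x, s) * ennreal (C * (max 0 (s - ?r x)) powr a) \<partial>lborel) \<partial>leb n)"
    proof (rule nn_integral_cong)
      fix x assume x: "x \<in> space (leb n)"
      have gx[measurable]: "(\<lambda>s. g (x, s)) \<in> borel_measurable borel"
        using measurable_compose[OF measurable_Pair1'[OF x] gm] by simp
      have "(\<integral>\<^sup>+y. g (x, ?r x + ?q y) \<partial>?P) = (\<integral>\<^sup>+t. g (x, ?r x + t) \<partial>distr ?P borel ?q)"
        by (subst nn_integral_distr) auto
      also have "\<dots> = (\<integral>\<^sup>+t. ennreal (C * (max 0 t) powr a) * g (x, ?r x + t) \<partial>lborel)"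
        unfolding C(2) by (subst nn_integral_density) auto
      also have "\<dots> = (\<integral>\<^sup>+s. g (x, s) * ennreal (C * (max 0 (s - ?r x)) powr a) \<partial>lborel)"
        using nn_integral_real_affine[of "\<lambda>s. g (x, s) * ennreal (C * (max 0 (s - ?r x)) powr a)" 1 "?r x"]
        by (simp add: mult.commute)
      finally show "(\<integral>\<^sup>+y. g (x, ?r x + ?q y) \<partial>?P) = \<dots>" .
    qed
    also have "\<dots> = (\<integral>\<^sup>+s. (\<integral>\<^sup>+x. g (x, s) * ennreal (C * (max 0 (s - ?r x)) powr a) \<partial>leb n) \<partial>lborel)"
      by (rule Fubini'[symmetric]) (simp add: case_prod_unfold)
    also have "\<dots> = (\<integral>\<^sup>+s. (indicator {0<..1} s * ennreal (sqrt s ^ n) * ennreal (C * s powr a))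
        * (\<integral>\<^sup>+w. h w * ennreal (profile n a w) \<partial>leb n) \<partial>lborel)"
    proof (rule nn_integral_cong)
      fix s :: real
      show "(\<integral>\<^sup>+x. g (x, s) * ennreal (C * (max 0 (s - ?r x)) powr a) \<partial>leb n) =
        (indicator {0<..1} s * ennreal (sqrt s ^ n) * ennreal (C * s powr a))
        * (\<integral>\<^sup>+w. h w * ennreal (profile n a w) \<partial>leb n)"
      proof (cases "0 < s \<and> s \<le> 1")
        \<comment> \<open>For s <= 0 the density vanishes because s - |x'|^2 is not positive; for s
          > 1 the point lies outside the ball.\<close>
        case False
        have "g (x, s) * ennreal (C * (max 0 (s - ?r x)) powr a) = 0" for x
        proof (cases "s \<le> 0")
          case True
          have "?r x \<ge> 0" by (simp add: sum_nonneg)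
          with True have "max 0 (s - ?r x) = 0" by linarith
          then show ?thesis by simp
        qed (use False in \<open>auto simp: g_def\<close>)
        then have "(\<lambda>x. g (x, s) * ennreal (C * (max 0 (s - ?r x)) powr a)) = (\<lambda>x. 0)" by (rule ext)
        with False show ?thesis by (simp only:) simp
      next
        case True
        have gs: "(\<lambda>x. g (x, s) * ennreal (C * (max 0 (s - ?r x)) powr a)) \<in> borel_measurable (leb n)"
          by measurable
        have "(\<integral>\<^sup>+x. g (x, s) * ennreal (C * (max 0 (s - ?r x)) powr a) \<partial>leb n) =
          ennreal (\<bar>sqrt s\<bar> ^ n) * (\<integral>\<^sup>+w. g (\<lambda>i\<in>{..<n}. 0 + sqrt s * w i, s)
            * ennreal (C * (max 0 (s - ?r (\<lambda>i\<in>{..<n}. 0 + sqrt s * w i))) powr a) \<partial>leb n)"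
          by (rule nn_integral_leb_affine) (use True gs in auto)
        also have "(\<integral>\<^sup>+w. g (\<lambda>i\<in>{..<n}. 0 + sqrt s * w i, s)
            * ennreal (C * (max 0 (s - ?r (\<lambda>i\<in>{..<n}. 0 + sqrt s * w i))) powr a) \<partial>leb n) =
          (\<integral>\<^sup>+w. ennreal (C * s powr a) * (h w * ennreal (profile n a w)) \<partial>leb n)"
        proof (rule nn_integral_cong)
          fix w assume w: "w \<in> space (leb n)"
          have "(\<lambda>i\<in>{..<n}. sqrt s * w i / sqrt s) = w"
            using True w by (auto simp: fun_eq_iff space_leb Rn_def PiE_iff extensional_def)
          then have g: "g (\<lambda>i\<in>{..<n}. 0 + sqrt s * w i, s) = h w"
            using True by (simp add: g_def cong: restrict_cong)
          \<comment> \<open>This homogeneity separates the variables: s factors out of the density,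
            and a function of w alone is left.\<close>
          have "s - ?r (\<lambda>i\<in>{..<n}. 0 + sqrt s * w i) = s * (1 - ?r w)"
            using True by (simp add: power_mult_distrib sum_distrib_left[symmetric] algebra_simps)
          then have "C * (max 0 (s - ?r (\<lambda>i\<in>{..<n}. 0 + sqrt s * w i))) powr a = (C * s powr a) * profile n a w"
            using True by (simp add: max_0_mult_powr profile_def)
          then have E: "ennreal (C * (max 0 (s - ?r (\<lambda>i\<in>{..<n}. 0 + sqrt s * w i))) powr a)
              = ennreal (C * s powr a) * ennreal (profile n a w)"
            using C(1) by (simp only: ennreal_mult profile_nonneg mult_nonneg_nonneg powr_ge_zero)
          then show "g (\<lambda>i\<in>{..<n}. 0 + sqrt s * w i, s)
            * ennreal (C * (max 0 (s - ?r (\<lambda>i\<in>{..<n}. 0 + sqrt s * w i))) powr a)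
            = ennreal (C * s powr a) * (h w * ennreal (profile n a w))"
            unfolding g E by (simp only: mult_ac)
        qed
        also have "\<dots> = ennreal (C * s powr a) * (\<integral>\<^sup>+w. h w * ennreal (profile n a w) \<partial>leb n)"
          by (intro nn_integral_cmult borel_measurable_times_ennreal h measurable_compose[OF profile_measurable measurable_ennreal])
        finally show ?thesis using True by (simp add: mult_ac)
      qed
    qed
    also have "\<dots> = K * (\<integral>\<^sup>+w. h w * ennreal (profile n a w) \<partial>leb n)"
      unfolding K_def by (rule nn_integral_multc) measurable
    finally have main: "(\<integral>\<^sup>+x. F x \<partial>leb (Suc d)) = K * (\<integral>\<^sup>+w. h w * ennreal (profile n a w) \<partial>leb n)" .
    show "(\<integral>\<^sup>+x. h (restrict x {..<n}) \<partial>sph_measure d)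
        = c * (\<integral>\<^sup>+w. h w * ennreal (profile n ((real d - real n - 1) / 2) w) \<partial>leb n)"
      unfolding nn_integral_sph_full[OF hr] F_def[symmetric] main c_def a_def[symmetric] divide_ennreal_def
      by (simp only: mult_ac)
  qed
qed

section \<open>The law of the rescaled coordinates\<close>

definition scaled_proj :: "nat \<Rightarrow> nat \<Rightarrow> (nat \<Rightarrow> real) \<Rightarrow> nat \<Rightarrow> real" where
  "scaled_proj n d \<omega> = (\<lambda>i\<in>{..<n}. sqrt (real d) * \<omega> i)"

lemma sph_lift_eq: "sph_lift n v d \<omega> = v (scaled_proj n d \<omega>)"
  by (simp add: sph_lift_def scaled_proj_def)

lemma scaled_proj_Rn [simp]: "scaled_proj n d \<omega> \<in> Rn n"
  by (simp add: scaled_proj_def)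

lemma scaled_proj_measurable:
  assumes "n \<le> d" shows "scaled_proj n d \<in> measurable (sph_measure d) (leb n)"
proof (rule measurable_sph, rule measurable_into_leb)
  show "(\<lambda>x. scaled_proj n d x i) \<in> borel_measurable (leb (Suc d))" if "i < n" for i
    using that assms by (auto simp: scaled_proj_def intro!: borel_measurable_times measurable_leb_component)
qed simp

text \<open>This is \<open>profile\<close> at the point y / sqrt d, still without its normalising
  constant.\<close>

definition sph_weight :: "nat \<Rightarrow> nat \<Rightarrow> (nat \<Rightarrow> real) \<Rightarrow> real" where
  "sph_weight n d y = (max 0 (1 - (\<Sum>i<n. (y i)\<^sup>2) / real d)) powr ((real d - real n - 1) / 2)"

text \<open>The upper bound rests on the exponent being nonnegative, which is the origin of the
  condition \<open>Suc n \<le> d\<close> from here on.\<close>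

lemma sph_weight_bounds: "0 \<le> sph_weight n d y" "Suc n \<le> d \<Longrightarrow> sph_weight n d y \<le> 1"
  by (auto simp: sph_weight_def sum_nonneg intro!: powr_le1)

lemma sph_weight_measurable [measurable]: "sph_weight n d \<in> borel_measurable (leb n)"
  unfolding sph_weight_def using measurable_sum_sq[of n] by measurable

text \<open>The dilation by sqrt d changes Lebesgue measure by a constant, which merges with the
  unknown one of \<open>sph_marginal\<close>. Their product is recovered from the total mass 1 of
  the sphere.\<close>

lemma distr_scaled_proj:
  assumes nd: "Suc n \<le> d"
  shows "integrable (leb n) (sph_weight n d)" "(\<integral>y. sph_weight n d y \<partial>leb n) > 0"
    and "distr (sph_measure d) (leb n) (scaled_proj n d)
      = density (leb n) (\<lambda>y. ennreal (sph_weight n d y / (\<integral>y. sph_weight n d y \<partial>leb n)))"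
proof -
  let ?s = "sqrt (real d)" and ?a = "(real d - real n - 1) / 2"
  have n: "n \<le> d" and d: "real d > 0" using nd by auto
  obtain c where c: "\<And>h. h \<in> borel_measurable (leb n) \<Longrightarrow>
      (\<integral>\<^sup>+x. h (restrict x {..<n}) \<partial>sph_measure d) = c * (\<integral>\<^sup>+w. h w * ennreal (profile n ?a w) \<partial>leb n)"
    by (rule sph_marginal[OF n]) (rule that)
  define c' where "c' = c * inverse (ennreal (?s ^ n))"
  have law: "(\<integral>\<^sup>+x. h (scaled_proj n d x) \<partial>sph_measure d) = c' * (\<integral>\<^sup>+y. h y * ennreal (sph_weight n d y) \<partial>leb n)"
    if h: "h \<in> borel_measurable (leb n)" for h
  proof -
    let ?A = "\<lambda>w. \<lambda>i\<in>{..<n}. 0 + ?s * w i"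
    have hA: "(\<lambda>w. h (?A w)) \<in> borel_measurable (leb n)"
      using measurable_comp[OF measurable_leb_affine[of "\<lambda>_. 0" ?s n] h] by (simp add: o_def)
    have "scaled_proj n d x = ?A (restrict x {..<n})" for x
      by (auto simp: scaled_proj_def)
    then have "(\<integral>\<^sup>+x. h (scaled_proj n d x) \<partial>sph_measure d) = c * (\<integral>\<^sup>+w. h (?A w) * ennreal (profile n ?a w) \<partial>leb n)"
      using c[OF hA] by simp
    also have "(\<lambda>w. h (?A w) * ennreal (profile n ?a w)) = (\<lambda>w. h (?A w) * ennreal (sph_weight n d (?A w)))"
      using d by (simp add: profile_def sph_weight_def power_mult_distrib sum_distrib_left[symmetric])
    also have "(\<integral>\<^sup>+w. h (?A w) * ennreal (sph_weight n d (?A w)) \<partial>leb n)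
        = inverse (ennreal (?s ^ n)) * (\<integral>\<^sup>+y. h y * ennreal (sph_weight n d y) \<partial>leb n)"
    proof -
      have "(\<integral>\<^sup>+y. h y * ennreal (sph_weight n d y) \<partial>leb n)
          = ennreal (\<bar>?s\<bar> ^ n) * (\<integral>\<^sup>+w. h (?A w) * ennreal (sph_weight n d (?A w)) \<partial>leb n)"
        using d h by (intro nn_integral_leb_affine) auto
      moreover have "inverse (ennreal (?s ^ n)) * ennreal (?s ^ n) = 1"
      proof -
        have "?s ^ n > 0" by (intro zero_less_power) (use d in simp)
        then have "ennreal (?s ^ n) / ennreal (?s ^ n) = 1" by (intro ennreal_divide_self) (simp_all only: ennreal_eq_0_iff not_le ennreal_less_top)
        then show ?thesis by (simp only: divide_ennreal_def mult.commute)
      qed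
      ultimately show ?thesis by (simp only: mult.assoc[symmetric] abs_of_nonneg real_sqrt_ge_zero of_nat_0_le_iff mult_1)
    qed
    finally show ?thesis by (simp add: c'_def mult.assoc)
  qed
  define Z where "Z = (\<integral>\<^sup>+y. ennreal (sph_weight n d y) \<partial>leb n)"
  \<comment> \<open>The case h = 1 of \<open>law\<close>. In \<open>ennreal\<close> it also excludes
    Z = 0 and Z = top, since either value forces the product to be 0 or top.\<close>
  have "c' * Z = 1"
    using law[of "\<lambda>_. 1"] by (simp add: Z_def emeasure_sph_measure)
  have Z0: "Z \<noteq> 0"
  proof
    assume "Z = 0"
    with \<open>c' * Z = 1\<close> show False by simp
  qed
  have Zt: "Z \<noteq> top"
  proof
    assume "Z = top"
    with \<open>c' * Z = 1\<close> show False by (cases "c' = 0") (simp_all add: ennreal_mult_top)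
  qed
  have "Z * inverse Z = 1"
    using Z0 Zt by (simp add: divide_ennreal_def[symmetric] ennreal_divide_self top.not_eq_extremum)
  then have c': "c' = inverse Z"
    using \<open>c' * Z = 1\<close> by (metis mult.assoc mult.commute mult_1)
  show int: "integrable (leb n) (sph_weight n d)"
    using Zt by (intro integrableI_nonneg) (auto simp: sph_weight_bounds Z_def top.not_eq_extremum)
  have ZI: "Z = ennreal (\<integral>y. sph_weight n d y \<partial>leb n)"
    unfolding Z_def by (rule nn_integral_eq_integral[OF int]) (simp add: sph_weight_bounds)
  show pos: "(\<integral>y. sph_weight n d y \<partial>leb n) > 0"
  proof (rule ccontr)
    assume "\<not> (\<integral>y. sph_weight n d y \<partial>leb n) > 0"
    then have "Z = 0" unfolding ZI by (intro ennreal_neg) linarith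
    with Z0 show False ..
  qed
  show "distr (sph_measure d) (leb n) (scaled_proj n d)
      = density (leb n) (\<lambda>y. ennreal (sph_weight n d y / (\<integral>y. sph_weight n d y \<partial>leb n)))"
  proof (rule measure_eqI)
    fix A assume "A \<in> sets (distr (sph_measure d) (leb n) (scaled_proj n d))"
    then have A[measurable]: "A \<in> sets (leb n)" by simp
    have "emeasure (distr (sph_measure d) (leb n) (scaled_proj n d)) A
        = (\<integral>\<^sup>+x. indicator A x \<partial>distr (sph_measure d) (leb n) (scaled_proj n d))" by simp
    also have "\<dots> = (\<integral>\<^sup>+x. indicator A (scaled_proj n d x) \<partial>sph_measure d)"
      by (rule nn_integral_distr[OF scaled_proj_measurable[OF n]]) simp
    also have "\<dots> = c' * (\<integral>\<^sup>+y. indicator A y * ennreal (sph_weight n d y) \<partial>leb n)"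
      by (rule law) simp
    also have "\<dots> = (\<integral>\<^sup>+y. c' * (indicator A y * ennreal (sph_weight n d y)) \<partial>leb n)"
      by (rule nn_integral_cmult[symmetric]) measurable
    also have "\<dots> = (\<integral>\<^sup>+y. ennreal (sph_weight n d y / (\<integral>y. sph_weight n d y \<partial>leb n)) * indicator A y \<partial>leb n)"
      using pos by (intro nn_integral_cong)
        (simp add: c' ZI inverse_ennreal divide_inverse ennreal_mult sph_weight_bounds mult_ac)
    also have "\<dots> = emeasure (density (leb n) (\<lambda>y. ennreal (sph_weight n d y / (\<integral>y. sph_weight n d y \<partial>leb n)))) A"
      by (rule emeasure_density[symmetric]) measurable
    finally show "emeasure (distr (sph_measure d) (leb n) (scaled_proj n d)) A
      = emeasure (density (leb n) (\<lambda>y. ennreal (sph_weight n d y / (\<integral>y. sph_weight n d y \<partial>leb n)))) A" .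
  qed simp
qed

lemma integral_scaled_proj:
  fixes f :: "(nat \<Rightarrow> real) \<Rightarrow> real"
  assumes nd: "Suc n \<le> d" and f[measurable]: "f \<in> borel_measurable (leb n)"
  shows "(\<integral>x. f (scaled_proj n d x) \<partial>sph_measure d)
    = (\<integral>y. sph_weight n d y * f y \<partial>leb n) / (\<integral>y. sph_weight n d y \<partial>leb n)"
proof -
  let ?Z = "\<integral>y. sph_weight n d y \<partial>leb n"
  have "n \<le> d" using nd by simp
  have "(\<integral>x. f (scaled_proj n d x) \<partial>sph_measure d) = (\<integral>y. (sph_weight n d y / ?Z) *\<^sub>R f y \<partial>leb n)"
    using distr_scaled_proj[OF nd]
    by (subst integral_distr[OF scaled_proj_measurable[OF \<open>n \<le> d\<close>] f, symmetric])
      (simp add: integral_density sph_weight_bounds divide_nonneg_pos)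
  then show ?thesis by simp
qed

text \<open>The density of the law is at most 1/Z, so L1 estimates on R^n carry over to the sphere.
  This is how continuity of translations becomes usable there.\<close>

lemma nn_integral_scaled_proj_le:
  assumes nd: "Suc n \<le> d" and f[measurable]: "f \<in> borel_measurable (leb n)"
  shows "(\<integral>\<^sup>+x. f (scaled_proj n d x) \<partial>sph_measure d)
    \<le> ennreal (1 / (\<integral>y. sph_weight n d y \<partial>leb n)) * (\<integral>\<^sup>+y. f y \<partial>leb n)"
proof -
  let ?Z = "\<integral>y. sph_weight n d y \<partial>leb n"
  have "n \<le> d" using nd by simp
  have "(\<integral>\<^sup>+x. f (scaled_proj n d x) \<partial>sph_measure d)
      = (\<integral>\<^sup>+y. ennreal (sph_weight n d y / ?Z) * f y \<partial>leb n)"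
    using distr_scaled_proj(3)[OF nd]
    by (subst nn_integral_distr[OF scaled_proj_measurable[OF \<open>n \<le> d\<close>], symmetric])
      (auto simp: nn_integral_density)
  also have "\<dots> \<le> (\<integral>\<^sup>+y. ennreal (1 / ?Z) * f y \<partial>leb n)"
    using distr_scaled_proj(2)[OF nd] sph_weight_bounds(2)[OF nd]
    by (intro nn_integral_mono mult_right_mono ennreal_leI divide_right_mono) auto
  also have "\<dots> = ennreal (1 / ?Z) * (\<integral>\<^sup>+y. f y \<partial>leb n)"
    by (rule nn_integral_cmult) measurable
  finally show ?thesis .
qed

lemma integrable_scaled_proj:
  fixes f :: "(nat \<Rightarrow> real) \<Rightarrow> real"
  assumes nd: "Suc n \<le> d" and f: "integrable (leb n) f"
  shows "integrable (sph_measure d) (\<lambda>x. f (scaled_proj n d x))"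
proof (rule integrableI_bounded)
  have n: "n \<le> d" using nd by simp
  have fm: "f \<in> borel_measurable (leb n)" using f by simp
  show "(\<lambda>x. f (scaled_proj n d x)) \<in> borel_measurable (sph_measure d)"
    using measurable_comp[OF scaled_proj_measurable[OF n] fm] by (simp add: o_def)
  have "(\<integral>\<^sup>+x. ennreal (norm (f (scaled_proj n d x))) \<partial>sph_measure d)
    \<le> ennreal (1 / (\<integral>y. sph_weight n d y \<partial>leb n)) * (\<integral>\<^sup>+y. ennreal (norm (f y)) \<partial>leb n)"
    using fm by (intro nn_integral_scaled_proj_le[OF nd]) measurable
  also have "\<dots> < \<infinity>" using f by (auto simp: integrable_iff_bounded ennreal_mult_less_top)
  finally show "(\<integral>\<^sup>+x. ennreal (norm (f (scaled_proj n d x))) \<partial>sph_measure d) < \<infinity>" .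
qed

section \<open>Continuity of translations in \<open>L\<^sup>1\<close>\<close>

text \<open>The factor 1 presents the translation as an affine map, so the change of variables for
  \<open>leb\<close> applies directly.\<close>

definition shift :: "nat \<Rightarrow> (nat \<Rightarrow> real) \<Rightarrow> (nat \<Rightarrow> real) \<Rightarrow> nat \<Rightarrow> real" where
  "shift n h x = (\<lambda>i\<in>{..<n}. h i + 1 * x i)"

lemma shift_measurable: "shift n h \<in> measurable (leb n) (leb n)"
  unfolding shift_def[abs_def] by (rule measurable_leb_affine)

lemma measurable_shift_comp: "f \<in> measurable (leb n) M \<Longrightarrow> (\<lambda>x. f (shift n h x)) \<in> measurable (leb n) M"
  using measurable_comp[OF shift_measurable] by (simp add: o_def)

lemma distr_shift: "distr (leb n) (leb n) (shift n h) = leb n"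
  unfolding shift_def[abs_def] by (rule distr_leb_affine) simp

lemma shift_Rn [simp]: "shift n h x \<in> Rn n"
  by (simp add: shift_def)

lemma integrable_shift:
  fixes f :: "(nat \<Rightarrow> real) \<Rightarrow> real"
  assumes "integrable (leb n) f" shows "integrable (leb n) (\<lambda>x. f (shift n h x))"
  using assms by (intro integrable_distr[OF shift_measurable]) (simp add: distr_shift)

lemma integral_shift:
  fixes f :: "(nat \<Rightarrow> real) \<Rightarrow> real"
  assumes "f \<in> borel_measurable (leb n)"
  shows "(\<integral>x. f (shift n h x) \<partial>leb n) = (\<integral>x. f x \<partial>leb n)"
  using integral_distr[OF shift_measurable assms, of h] by (simp add: distr_shift)

text \<open>A sequential form, suited to dominated convergence along \<open>H\<close>;
  \<open>L1_translation_continuous\<close> turns it into a bound uniform over all small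
  shifts.\<close>

definition shift_continuous :: "nat \<Rightarrow> ((nat \<Rightarrow> real) \<Rightarrow> real) \<Rightarrow> bool" where
  "shift_continuous n f \<longleftrightarrow> (\<forall>H. (\<forall>i<n. (\<lambda>k. H k i) \<longlonglongrightarrow> 0) \<longrightarrow>
    (\<lambda>k. \<integral>x. \<bar>f (shift n (H k) x) - f x\<bar> \<partial>leb n) \<longlonglongrightarrow> 0)"

lemma shift_continuous_lincomb:
  assumes f: "integrable (leb n) f" "shift_continuous n f"
    and g: "integrable (leb n) g" "shift_continuous n g"
  shows "shift_continuous n (\<lambda>x. a * f x + b * g x)"
  unfolding shift_continuous_def
proof (intro allI impI)
  fix H :: "nat \<Rightarrow> nat \<Rightarrow> real" assume H: "\<forall>i<n. (\<lambda>k. H k i) \<longlonglongrightarrow> 0"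
  let ?I = "\<lambda>f k. \<integral>x. \<bar>f (shift n (H k) x) - f x\<bar> \<partial>leb n"
  have "(\<lambda>k. \<bar>a\<bar> * ?I f k + \<bar>b\<bar> * ?I g k) \<longlonglongrightarrow> \<bar>a\<bar> * 0 + \<bar>b\<bar> * 0"
    using f(2) g(2) H unfolding shift_continuous_def by (intro tendsto_intros) auto
  then have lim: "(\<lambda>k. \<bar>a\<bar> * ?I f k + \<bar>b\<bar> * ?I g k) \<longlonglongrightarrow> 0" by simp
  have int: "integrable (leb n) (\<lambda>x. \<bar>F (shift n (H k) x) - F x\<bar>)" if "integrable (leb n) F"
    for F :: "_ \<Rightarrow> real" and k
    using integrable_shift[OF that] that by (intro integrable_abs Bochner_Integration.integrable_diff)
  show "(\<lambda>k. ?I (\<lambda>x. a * f x + b * g x) k) \<longlonglongrightarrow> 0"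
  proof (rule tendsto_sandwich[OF _ _ tendsto_const lim])
    show "\<forall>\<^sub>F k in sequentially. 0 \<le> ?I (\<lambda>x. a * f x + b * g x) k" by simp
    have "?I (\<lambda>x. a * f x + b * g x) k \<le> \<bar>a\<bar> * ?I f k + \<bar>b\<bar> * ?I g k" for k
    proof -
      have "?I (\<lambda>x. a * f x + b * g x) k \<le>
          (\<integral>x. \<bar>a\<bar> * \<bar>f (shift n (H k) x) - f x\<bar> + \<bar>b\<bar> * \<bar>g (shift n (H k) x) - g x\<bar> \<partial>leb n)"
      proof (rule integral_mono)
        show "integrable (leb n) (\<lambda>x. \<bar>a * f (shift n (H k) x) + b * g (shift n (H k) x) - (a * f x + b * g x)\<bar>)"
          by (rule int) (use f(1) g(1) in simp)
        show "integrable (leb n) (\<lambda>x. \<bar>a\<bar> * \<bar>f (shift n (H k) x) - f x\<bar> + \<bar>b\<bar> * \<bar>g (shift n (H k) x) - g x\<bar>)"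
          by (intro Bochner_Integration.integrable_add integrable_mult_right int f(1) g(1))
        fix x
        have "a * f (shift n (H k) x) + b * g (shift n (H k) x) - (a * f x + b * g x)
          = a * (f (shift n (H k) x) - f x) + b * (g (shift n (H k) x) - g x)" by (simp add: algebra_simps)
        then show "\<bar>a * f (shift n (H k) x) + b * g (shift n (H k) x) - (a * f x + b * g x)\<bar>
          \<le> \<bar>a\<bar> * \<bar>f (shift n (H k) x) - f x\<bar> + \<bar>b\<bar> * \<bar>g (shift n (H k) x) - g x\<bar>"
          using abs_triangle_ineq[of "a * (f (shift n (H k) x) - f x)" "b * (g (shift n (H k) x) - g x)"]
          by (simp add: abs_mult)
      qed
      also have "\<dots> = \<bar>a\<bar> * ?I f k + \<bar>b\<bar> * ?I g k"
        using int[OF f(1)] int[OF g(1)] by simp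
      finally show ?thesis .
    qed
    then show "\<forall>\<^sub>F k in sequentially. ?I (\<lambda>x. a * f x + b * g x) k \<le> \<bar>a\<bar> * ?I f k + \<bar>b\<bar> * ?I g k" by simp
  qed
qed

text \<open>The common majorant makes \<open>s j\<close> converge to \<open>f\<close> in L1, and a
  translation preserves the L1 error, so one good \<open>j\<close> serves all shifts at
  once.\<close>

lemma shift_continuous_limit:
  assumes s: "\<And>j. integrable (leb n) (s j)" "\<And>j. shift_continuous n (s j)"
    and lim: "\<And>x. x \<in> Rn n \<Longrightarrow> (\<lambda>j. s j x) \<longlonglongrightarrow> f x"
    and w: "integrable (leb n) w" "\<And>j x. x \<in> Rn n \<Longrightarrow> \<bar>s j x\<bar> \<le> w x"
    and f: "integrable (leb n) f"
  shows "shift_continuous n f"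
  unfolding shift_continuous_def
proof (intro allI impI)
  fix H :: "nat \<Rightarrow> nat \<Rightarrow> real" assume H: "\<forall>i<n. (\<lambda>k. H k i) \<longlonglongrightarrow> 0"
  let ?I = "\<lambda>f k. \<integral>x. \<bar>f (shift n (H k) x) - f x\<bar> \<partial>leb n"
  have "(\<lambda>j. \<integral>x. \<bar>f x - s j x\<bar> \<partial>leb n) \<longlonglongrightarrow> (\<integral>x. 0 \<partial>leb n)"
  proof (rule integral_dominated_convergence[where w="\<lambda>x. \<bar>f x\<bar> + w x"])
    show "(\<lambda>x. \<bar>f x - s j x\<bar>) \<in> borel_measurable (leb n)" for j
      using borel_measurable_integrable[OF f] borel_measurable_integrable[OF s(1)[of j]] by measurable
    show "integrable (leb n) (\<lambda>x. \<bar>f x\<bar> + w x)" using f w(1) by simp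
    have "(\<lambda>j. \<bar>f x - s j x\<bar>) \<longlonglongrightarrow> \<bar>f x - f x\<bar>" if "x \<in> Rn n" for x
      by (intro tendsto_intros lim that)
    then show "AE x in leb n. (\<lambda>j. \<bar>f x - s j x\<bar>) \<longlonglongrightarrow> 0" by (auto simp: space_leb)
    show "AE x in leb n. norm \<bar>f x - s j x\<bar> \<le> \<bar>f x\<bar> + w x" for j
    proof (rule AE_I2)
      fix x assume "x \<in> space (leb n)"
      then show "norm \<bar>f x - s j x\<bar> \<le> \<bar>f x\<bar> + w x" using w(2)[of x j] by (simp add: space_leb)
    qed
  qed simp
  then have L1: "(\<lambda>j. \<integral>x. \<bar>f x - s j x\<bar> \<partial>leb n) \<longlonglongrightarrow> 0" by simp
  show "?I f \<longlonglongrightarrow> 0"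
  proof (rule LIMSEQ_I)
    fix e :: real assume e: "e > 0"
    obtain j where j: "norm ((\<integral>x. \<bar>f x - s j x\<bar> \<partial>leb n) - 0) < e / 3"
      using LIMSEQ_D[OF L1, of "e / 3"] e by auto
    have "?I (s j) \<longlonglongrightarrow> 0" using s(2) H by (auto simp: shift_continuous_def)
    then obtain N where N: "\<And>k. k \<ge> N \<Longrightarrow> norm (?I (s j) k - 0) < e / 3"
      using LIMSEQ_D[of "?I (s j)" 0 "e / 3"] e by auto
    \<comment> \<open>The errors at the shifted point and at \<open>x\<close> have the same
      integral: hence the factor 2 and the thirds of \<open>e\<close>.\<close>
    have bound: "?I f k \<le> 2 * (\<integral>x. \<bar>f x - s j x\<bar> \<partial>leb n) + ?I (s j) k" for k
    proof -
      let ?r = "\<lambda>x. \<bar>f x - s j x\<bar>"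
      have r: "integrable (leb n) ?r" using f s(1)[of j] by simp
      have rs: "integrable (leb n) (\<lambda>x. ?r (shift n (H k) x))" by (rule integrable_shift[OF r])
      have si: "integrable (leb n) (\<lambda>x. \<bar>s j (shift n (H k) x) - s j x\<bar>)"
        using integrable_shift[OF s(1)[of j]] s(1)[of j] by simp
      have "?I f k \<le> (\<integral>x. ?r (shift n (H k) x) + ?r x + \<bar>s j (shift n (H k) x) - s j x\<bar> \<partial>leb n)"
      proof (rule integral_mono)
        show "integrable (leb n) (\<lambda>x. \<bar>f (shift n (H k) x) - f x\<bar>)"
          by (intro integrable_abs Bochner_Integration.integrable_diff integrable_shift f)
        show "integrable (leb n) (\<lambda>x. ?r (shift n (H k) x) + ?r x + \<bar>s j (shift n (H k) x) - s j x\<bar>)"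
          by (intro Bochner_Integration.integrable_add r rs si)
      qed linarith
      also have "\<dots> = (\<integral>x. ?r (shift n (H k) x) \<partial>leb n) + (\<integral>x. ?r x \<partial>leb n) + ?I (s j) k"
        using r rs si by simp
      also have "(\<integral>x. ?r (shift n (H k) x) \<partial>leb n) = (\<integral>x. ?r x \<partial>leb n)"
        by (rule integral_shift[OF borel_measurable_integrable[OF r]])
      finally show ?thesis by simp
    qed
    have "norm (?I f k - 0) < e" if "k \<ge> N" for k
    proof -
      have "?I (s j) k < e / 3" using N[OF that] by simp
      moreover have "(\<integral>x. \<bar>f x - s j x\<bar> \<partial>leb n) < e / 3" using j by simp
      ultimately have "?I f k < e" using bound[of k] by linarith
      then show ?thesis by simp
    qed
    then show "\<exists>N. \<forall>k\<ge>N. norm (?I f k - 0) < e" by blast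
  qed
qed

section \<open>Continuity of translations: indicators in a cube, then integrable functions\<close>

definition cube :: "nat \<Rightarrow> real \<Rightarrow> (nat \<Rightarrow> real) set" where
  "cube n R = PiE {..<n} (\<lambda>_. {- R<..<R})"

lemma cube_sets [simp]: "cube n R \<in> sets (leb n)"
  unfolding cube_def by (rule sets_leb_PiE) simp

lemma mem_cube: "x \<in> Rn n \<Longrightarrow> x \<in> cube n R \<longleftrightarrow> (\<forall>i<n. \<bar>x i\<bar> < R)"
  by (simp add: cube_def Rn_def PiE_def Pi_iff abs_less_iff Ball_def minus_less_iff conj_commute)

lemma emeasure_cube: "emeasure (leb n) (cube n R) < \<infinity>"
proof -
  have "emeasure lborel {- R<..<R} < \<infinity>" by (cases "- R \<le> R") auto
  then show ?thesis unfolding cube_def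
    by (subst emeasure_leb_PiE) (auto simp: power_less_top_ennreal)
qed

lemma integrable_indicator_cube:
  "A \<in> sets (leb n) \<Longrightarrow> integrable (leb n) (indicator (A \<inter> cube n R) :: _ \<Rightarrow> real)"
  using emeasure_cube[of n R] emeasure_mono[of "A \<inter> cube n R" "cube n R" "leb n"]
  by (intro integrable_real_indicator) (auto intro: le_less_trans)

lemma AE_leb_component_neq: "i < n \<Longrightarrow> AE x in leb n. x i \<noteq> a"
proof -
  assume i: "i < n"
  have "{x \<in> space (leb n). \<not> x i \<noteq> a} = PiE {..<n} (\<lambda>j. if j = i then {a} else UNIV)"
    using i by (intro set_eqI) (auto simp: space_leb Rn_def PiE_def Pi_def)
  moreover have "emeasure (leb n) (PiE {..<n} (\<lambda>j. if j = i then {a} else UNIV)) = 0"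
    using i by (subst emeasure_leb_PiE) (auto intro!: prod_zero)
  moreover have "PiE {..<n} (\<lambda>j. if j = i then {a} else UNIV) \<in> sets (leb n)"
    by (rule sets_leb_PiE) auto
  ultimately show ?thesis by (intro AE_I[where N="PiE {..<n} (\<lambda>j. if j = i then {a} else UNIV)"]) auto
qed

text \<open>Membership in an open box changes only across the null hyperplanes where some
  \<open>x i\<close> equals \<open>a i\<close>, \<open>R\<close> or \<open>- R\<close>. At any other
  point small shifts leave it unchanged, so the integrand is eventually 0.\<close>

lemma shift_continuous_orthant: "shift_continuous n (indicator (orthant n a \<inter> cube n R))"
  unfolding shift_continuous_def
proof (intro allI impI)
  fix H :: "nat \<Rightarrow> nat \<Rightarrow> real" assume H: "\<forall>i<n. (\<lambda>k. H k i) \<longlonglongrightarrow> 0"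
  let ?B = "orthant n a \<inter> cube n R"
  have B: "x \<in> ?B \<longleftrightarrow> (\<forall>i<n. a i < x i \<and> - R < x i \<and> x i < R)" if "x \<in> Rn n" for x
    using that by (auto simp: orthant_def mem_cube abs_less_iff)
  \<comment> \<open>Once all shifts are below 1, both sets lie in the cube of half side R + 1, an
    integrable majorant. This is why the sequence is started at an offset \<open>N\<close>.\<close>
  have "\<forall>\<^sub>F k in sequentially. \<forall>i\<in>{..<n}. \<bar>H k i\<bar> < 1"
  proof (rule eventually_ball_finite)
    show "\<forall>i\<in>{..<n}. \<forall>\<^sub>F k in sequentially. \<bar>H k i\<bar> < 1"
    proof
      fix i assume "i \<in> {..<n}"
      then have "(\<lambda>k. \<bar>H k i\<bar>) \<longlonglongrightarrow> \<bar>0\<bar>" using H by (intro tendsto_rabs) auto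
      then show "\<forall>\<^sub>F k in sequentially. \<bar>H k i\<bar> < 1" by (intro order_tendstoD(2)) auto
    qed
  qed simp
  then obtain N where N: "\<And>k i. k \<ge> N \<Longrightarrow> i < n \<Longrightarrow> \<bar>H k i\<bar> < 1"
    by (auto simp: eventually_sequentially)
  have "(\<lambda>k. \<integral>x. \<bar>indicator ?B (shift n (H (k + N)) x) - indicator ?B x :: real\<bar> \<partial>leb n) \<longlonglongrightarrow> (\<integral>x. 0 \<partial>leb n)"
  proof (rule integral_dominated_convergence[where w="indicator (Rn n \<inter> cube n (R + 1))"])
    have "(\<lambda>x. indicator ?B (shift n (H (k + N)) x) :: real) \<in> borel_measurable (leb n)" for k
      by (intro measurable_shift_comp borel_measurable_indicator sets.Int sets_orthant cube_sets)
    then show "(\<lambda>x. \<bar>indicator ?B (shift n (H (k + N)) x) - indicator ?B x :: real\<bar>) \<in> borel_measurable (leb n)" for k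
      by (intro borel_measurable_abs borel_measurable_diff borel_measurable_indicator) auto
    show "integrable (leb n) (indicator (Rn n \<inter> cube n (R + 1)) :: _ \<Rightarrow> real)"
      by (rule integrable_indicator_cube) (metis sets.top space_leb)
    have "AE x in leb n. \<forall>i\<in>{..<n}. x i \<noteq> a i \<and> x i \<noteq> - R \<and> x i \<noteq> R"
      by (intro AE_finite_allI AE_conjI AE_leb_component_neq) auto
    then show "AE x in leb n. (\<lambda>k. \<bar>indicator ?B (shift n (H (k + N)) x) - indicator ?B x :: real\<bar>) \<longlonglongrightarrow> 0"
    proof (rule AE_mp, intro AE_I2 impI)
      fix x assume x: "x \<in> space (leb n)" and ne: "\<forall>i\<in>{..<n}. x i \<noteq> a i \<and> x i \<noteq> - R \<and> x i \<noteq> R"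
      have xR: "x \<in> Rn n" using x by (simp add: space_leb)
      have ev: "\<forall>\<^sub>F k in sequentially. (H (k + N) i + x i < c \<longleftrightarrow> x i < c) \<and> (c < H (k + N) i + x i \<longleftrightarrow> c < x i)"
        if ine: "i < n" "x i \<noteq> c" for i c
      proof -
        have l: "(\<lambda>k. H (k + N) i + x i) \<longlonglongrightarrow> x i"
          using tendsto_add[OF LIMSEQ_ignore_initial_segment[of "\<lambda>k. H k i" 0 N] tendsto_const[of "x i"]] H that
          by simp
        consider "x i < c" | "c < x i" using ine(2) by linarith
        then show ?thesis
        proof cases
          case 1
          show ?thesis using order_tendstoD(2)[OF l 1] by eventually_elim (use 1 in auto)
        next
          case 2
          show ?thesis using order_tendstoD(1)[OF l 2] by eventually_elim (use 2 in auto)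
        qed
      qed
      have "\<forall>\<^sub>F k in sequentially. \<forall>i\<in>{..<n}. (a i < H (k + N) i + x i \<longleftrightarrow> a i < x i) \<and>
        (- R < H (k + N) i + x i \<longleftrightarrow> - R < x i) \<and> (H (k + N) i + x i < R \<longleftrightarrow> x i < R)"
      proof (rule eventually_ball_finite, simp, intro ballI)
        fix i assume "i \<in> {..<n}"
        then have i: "i < n" "x i \<noteq> a i" "x i \<noteq> - R" "x i \<noteq> R" using ne by auto
        show "\<forall>\<^sub>F k in sequentially. (a i < H (k + N) i + x i \<longleftrightarrow> a i < x i) \<and>
          (- R < H (k + N) i + x i \<longleftrightarrow> - R < x i) \<and> (H (k + N) i + x i < R \<longleftrightarrow> x i < R)"
          using ev[OF i(1,2)] ev[OF i(1,3)] ev[OF i(1,4)] by eventually_elim blast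
      qed
      then have "\<forall>\<^sub>F k in sequentially. \<bar>indicator ?B (shift n (H (k + N)) x) - indicator ?B x :: real\<bar> = 0"
      proof eventually_elim
        case (elim k)
        have "shift n (H (k + N)) x \<in> ?B \<longleftrightarrow> x \<in> ?B"
          unfolding B[OF xR] B[OF shift_Rn] using elim by (auto simp: shift_def)
        then show ?case by (simp add: indicator_def)
      qed
      then show "(\<lambda>k. \<bar>indicator ?B (shift n (H (k + N)) x) - indicator ?B x :: real\<bar>) \<longlonglongrightarrow> 0"
        by (rule tendsto_eventually)
    qed
    show "AE x in leb n. norm \<bar>indicator ?B (shift n (H (k + N)) x) - indicator ?B x :: real\<bar>
        \<le> indicator (Rn n \<inter> cube n (R + 1)) x" for k
    proof (rule AE_I2)
      fix x assume "x \<in> space (leb n)"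
      then have x: "x \<in> Rn n" by (simp add: space_leb)
      have "x \<in> cube n (R + 1)" if "x \<in> ?B \<or> shift n (H (k + N)) x \<in> ?B"
        unfolding mem_cube[OF x]
      proof (intro allI impI)
        fix i assume i: "i < n"
        have "\<bar>H (k + N) i\<bar> < 1" using N[of "k + N" i] i by simp
        with that i show "\<bar>x i\<bar> < R + 1"
          unfolding B[OF x] B[OF shift_Rn] by (auto simp: shift_def abs_less_iff)
      qed
      then show "norm \<bar>indicator ?B (shift n (H (k + N)) x) - indicator ?B x :: real\<bar>
        \<le> indicator (Rn n \<inter> cube n (R + 1)) x"
        using x by (auto simp: indicator_def)
    qed
  qed simp
  then show "(\<lambda>k. \<integral>x. \<bar>indicator ?B (shift n (H k) x) - indicator ?B x :: real\<bar> \<partial>leb n) \<longlonglongrightarrow> 0"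
    using LIMSEQ_offset[of "\<lambda>k. \<integral>x. \<bar>indicator ?B (shift n (H k) x) - indicator ?B x :: real\<bar> \<partial>leb n" N 0] by simp
qed

lemma shift_continuous_indicator:
  assumes "A \<in> sets (leb n)" shows "shift_continuous n (indicator (A \<inter> cube n R))"
  using assms
proof (induction rule: leb_sets_induct)
  case (orthant a)
  show ?case by (rule shift_continuous_orthant)
next
  case empty
  show ?case by (simp add: shift_continuous_def)
next
  case (compl A)
  have sub: "cube n R \<subseteq> Rn n" by (auto simp: cube_def Rn_def PiE_iff)
  \<comment> \<open>The orthant with all bounds - R contains the cube, so its case supplies the
    indicator of the cube itself, from which that of \<open>A\<close> is subtracted.\<close>
  have "shift_continuous n (\<lambda>x. 1 * indicator (orthant n (\<lambda>_. - R) \<inter> cube n R) x + (-1) * indicator (A \<inter> cube n R) x)"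
    by (intro shift_continuous_lincomb integrable_indicator_cube compl sets_orthant shift_continuous_orthant)
  also have "(\<lambda>x. 1 * indicator (orthant n (\<lambda>_. - R) \<inter> cube n R) x + (-1) * indicator (A \<inter> cube n R) x :: real)
      = indicator ((Rn n - A) \<inter> cube n R)"
  proof
    fix x
    have "x \<in> orthant n (\<lambda>_. - R)" if "x \<in> cube n R"
    proof -
      have "x \<in> Rn n" using that sub by blast
      moreover have "\<forall>i<n. - R < x i" using that by (simp add: cube_def PiE_iff)
      ultimately show ?thesis by (simp add: orthant_def)
    qed
    then show "1 * indicator (orthant n (\<lambda>_. - R) \<inter> cube n R) x + (-1) * indicator (A \<inter> cube n R) x
      = (indicator ((Rn n - A) \<inter> cube n R) x :: real)"
      using sub by (auto simp: indicator_def)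
  qed
  finally show ?case .
next
  case (union A)
  have A: "A i \<in> sets (leb n)" for i using union(2) by auto
  have part: "integrable (leb n) (\<lambda>x. \<Sum>i<j. indicator (A i \<inter> cube n R) x :: real)
      \<and> shift_continuous n (\<lambda>x. \<Sum>i<j. indicator (A i \<inter> cube n R) x)" for j
  proof (induction j)
    case 0
    show ?case by (simp add: shift_continuous_def)
  next
    case (Suc j)
    have "shift_continuous n (\<lambda>x. 1 * (\<Sum>i<j. indicator (A i \<inter> cube n R) x) + 1 * indicator (A j \<inter> cube n R) x)"
      using Suc by (intro shift_continuous_lincomb integrable_indicator_cube A union) auto
    moreover have "integrable (leb n) (indicator (A j \<inter> cube n R) :: _ \<Rightarrow> real)"
      by (rule integrable_indicator_cube[OF A])
    ultimately show ?case using Suc by simp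
  qed
  have disj: "disjoint_family (\<lambda>i. A i \<inter> cube n R)"
    using union(1) by (auto simp: disjoint_family_on_def)
  show ?case
  proof (rule shift_continuous_limit[where s="\<lambda>j x. \<Sum>i<j. indicator (A i \<inter> cube n R) x"
        and w="indicator ((\<Union>i. A i) \<inter> cube n R)"])
    fix x
    have "(\<lambda>i. indicator (A i \<inter> cube n R) x :: real) sums indicator (\<Union>i. A i \<inter> cube n R) x"
      by (rule indicator_sums) (use disj in \<open>auto simp: disjoint_family_on_def\<close>)
    then show "(\<lambda>j. \<Sum>i<j. indicator (A i \<inter> cube n R) x) \<longlonglongrightarrow> (indicator ((\<Union>i. A i) \<inter> cube n R) x :: real)"
      by (simp add: sums_def)
  next
    fix j x
    have sums: "(\<lambda>i. indicator (A i \<inter> cube n R) x :: real) sums indicator (\<Union>i. A i \<inter> cube n R) x"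
      by (rule indicator_sums) (use disj in \<open>auto simp: disjoint_family_on_def\<close>)
    then have "(\<Sum>i<j. indicator (A i \<inter> cube n R) x) \<le> (indicator (\<Union>i. A i \<inter> cube n R) x :: real)"
      using sum_le_suminf[of "\<lambda>i. indicator (A i \<inter> cube n R) x :: real" "{..<j}"]
      by (auto simp: sums_iff)
    then show "\<bar>\<Sum>i<j. indicator (A i \<inter> cube n R) x\<bar> \<le> (indicator ((\<Union>i. A i) \<inter> cube n R) x :: real)"
      by (simp add: sum_nonneg)
  qed (use part A in \<open>auto intro!: integrable_indicator_cube\<close>)
qed

text \<open>Indicators are controlled only inside a cube, so the induction over integrable functions
  is run on the truncation of f. The cubes of half side j then exhaust R^n, with |f| as
  majorant.\<close>

lemma integrable_shift_continuous:
  assumes "integrable (leb n) f" shows "shift_continuous n f"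
proof -
  have cube_part: "shift_continuous n (\<lambda>x. f x * indicator (cube n R) x)" for R
  proof (rule integrable_induct[OF assms, where P="\<lambda>f. shift_continuous n (\<lambda>x. f x * indicator (cube n R) x)"])
    fix A and c :: real assume base: "A \<in> sets (leb n)"
    have "shift_continuous n (\<lambda>x. c * indicator (A \<inter> cube n R) x + 0 * indicator (A \<inter> cube n R) x)"
      by (intro shift_continuous_lincomb integrable_indicator_cube shift_continuous_indicator base)
    then show "shift_continuous n (\<lambda>x. indicator A x *\<^sub>R c * indicator (cube n R) x)"
      by (simp add: indicator_inter_arith mult_ac)
  next
    fix f g :: "(nat \<Rightarrow> real) \<Rightarrow> real"
    assume add: "integrable (leb n) f" "shift_continuous n (\<lambda>x. f x * indicator (cube n R) x)"
      "integrable (leb n) g" "shift_continuous n (\<lambda>x. g x * indicator (cube n R) x)"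
    have "shift_continuous n (\<lambda>x. 1 * (f x * indicator (cube n R) x) + 1 * (g x * indicator (cube n R) x))"
      by (intro shift_continuous_lincomb integrable_real_mult_indicator cube_sets add)
    then show "shift_continuous n (\<lambda>x. (f x + g x) * indicator (cube n R) x)" by (simp add: algebra_simps)
  next
    fix f :: "(nat \<Rightarrow> real) \<Rightarrow> real" and s
    assume lim: "\<And>j. integrable (leb n) (s j)" "\<And>j. shift_continuous n (\<lambda>x. s j x * indicator (cube n R) x)"
      "\<And>x. x \<in> space (leb n) \<Longrightarrow> (\<lambda>j. s j x) \<longlonglongrightarrow> f x"
      "\<And>j x. x \<in> space (leb n) \<Longrightarrow> norm (s j x) \<le> 2 * norm (f x)" "integrable (leb n) f"
    show "shift_continuous n (\<lambda>x. f x * indicator (cube n R) x)"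
    proof (rule shift_continuous_limit[where s="\<lambda>j x. s j x * indicator (cube n R) x" and w="\<lambda>x. 2 * \<bar>f x\<bar>"])
      show "\<bar>s j x * indicator (cube n R) x\<bar> \<le> 2 * \<bar>f x\<bar>" if "x \<in> Rn n" for j x
        using lim(4)[of x j] that by (simp add: indicator_def space_leb)
      show "(\<lambda>j. s j x * indicator (cube n R) x) \<longlonglongrightarrow> f x * indicator (cube n R) x" if "x \<in> Rn n" for x
        using lim(3)[of x] that by (intro tendsto_intros) (simp add: space_leb)
    qed (simp_all add: lim integrable_real_mult_indicator)
  qed
  show ?thesis
  proof (rule shift_continuous_limit[where s="\<lambda>j x. f x * indicator (cube n (real j)) x" and w="\<lambda>x. \<bar>f x\<bar>"])
    fix x assume x: "x \<in> Rn n"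
    obtain J where J: "(\<Sum>i<n. \<bar>x i\<bar>) < real J" using reals_Archimedean2 by blast
    have "x \<in> cube n (real j)" if "j \<ge> J" for j
      unfolding mem_cube[OF x]
    proof (intro allI impI)
      fix i assume "i < n"
      then have "\<bar>x i\<bar> \<le> (\<Sum>i<n. \<bar>x i\<bar>)" by (intro member_le_sum) auto
      with J that show "\<bar>x i\<bar> < real j" by linarith
    qed
    then have "f x * indicator (cube n (real j)) x = f x" if "j \<ge> J" for j
      using that by simp
    then have "\<forall>\<^sub>F j in sequentially. f x * indicator (cube n (real j)) x = f x"
      unfolding eventually_sequentially by blast
    then show "(\<lambda>j. f x * indicator (cube n (real j)) x) \<longlonglongrightarrow> f x" by (rule tendsto_eventually)
  next
    show "integrable (leb n) (\<lambda>x. f x * indicator (cube n (real j)) x)" for j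
      by (rule integrable_real_mult_indicator[OF cube_sets assms])
    show "shift_continuous n (\<lambda>x. f x * indicator (cube n (real j)) x)" for j
      by (rule cube_part)
  qed (auto simp: assms indicator_def)
qed

text \<open>If every delta = 1/(k + 1) failed, the offending shifts would form a sequence tending to
  0 with L1 distances bounded below.\<close>

lemma L1_translation_continuous:
  fixes f :: "(nat \<Rightarrow> real) \<Rightarrow> real"
  assumes f: "integrable (leb n) f" and e: "e > 0"
  shows "\<exists>\<delta>>0. \<forall>h. (\<forall>i<n. \<bar>h i\<bar> \<le> \<delta>) \<longrightarrow> (\<integral>x. \<bar>f (shift n h x) - f x\<bar> \<partial>leb n) < e"
proof (rule ccontr)
  assume "\<not> ?thesis"
  then have "\<exists>h. (\<forall>i<n. \<bar>h i\<bar> \<le> \<delta>) \<and> \<not> (\<integral>x. \<bar>f (shift n h x) - f x\<bar> \<partial>leb n) < e"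
    if "\<delta> > 0" for \<delta>
    using that by blast
  then have "\<forall>k. \<exists>h. (\<forall>i<n. \<bar>h i\<bar> \<le> inverse (real (Suc k))) \<and> \<not> (\<integral>x. \<bar>f (shift n h x) - f x\<bar> \<partial>leb n) < e"
    by simp
  from choice[OF this] obtain H where H: "\<forall>k. (\<forall>i<n. \<bar>H k i\<bar> \<le> inverse (real (Suc k))) \<and>
    \<not> (\<integral>x. \<bar>f (shift n (H k) x) - f x\<bar> \<partial>leb n) < e" ..
  then have small: "\<bar>H k i\<bar> \<le> inverse (real (Suc k))" if "i < n" for i k
    using that by blast
  have large: "e \<le> (\<integral>x. \<bar>f (shift n (H k) x) - f x\<bar> \<partial>leb n)" for k
  proof -
    have "\<not> (\<integral>x. \<bar>f (shift n (H k) x) - f x\<bar> \<partial>leb n) < e" using H by blast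
    then show ?thesis by linarith
  qed
  have "(\<lambda>k. H k i) \<longlonglongrightarrow> 0" if "i < n" for i
    using small[OF that] by (intro tendsto_rabs_zero_cancel[OF tendsto_sandwich[OF _ _ tendsto_const LIMSEQ_inverse_real_of_nat]]) auto
  then have "(\<lambda>k. \<integral>x. \<bar>f (shift n (H k) x) - f x\<bar> \<partial>leb n) \<longlonglongrightarrow> 0"
    using integrable_shift_continuous[OF f] by (auto simp: shift_continuous_def)
  from LIMSEQ_le_const[OF this] large have "e \<le> 0" by auto
  with e show False by simp
qed

section \<open>Mollification\<close>

text \<open>Positive exactly for |t| < epsilon: each factor vanishes beyond one of the two
  ends.\<close>

definition bump :: "real \<Rightarrow> real \<Rightarrow> real" where
  "bump \<epsilon> t = flat 0 (\<epsilon> - t) * flat 0 (\<epsilon> + t)"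

definition bump_deriv :: "real \<Rightarrow> real \<Rightarrow> real" where
  "bump_deriv \<epsilon> t = flat 0 (\<epsilon> - t) * flat 1 (\<epsilon> + t) - flat 1 (\<epsilon> - t) * flat 0 (\<epsilon> + t)"

lemma flat_DERIV: "(flat k has_real_derivative flat (Suc k) t) (at t)"
  using deriv_seq_flat by (simp add: deriv_seq_def)

lemma flat_continuous: "continuous_on S (flat k)"
  using flat_DERIV by (meson DERIV_isCont continuous_at_imp_continuous_on)

lemma flat_nonpos: "t \<le> 0 \<Longrightarrow> flat k t = 0"
  by (simp add: flat_def)

lemma has_derivative_bump: "(bump \<epsilon> has_real_derivative bump_deriv \<epsilon> t) (at t)"
proof -
  have D: "(flat 0 has_real_derivative flat 1 t) (at t)" for t
    using flat_DERIV[of 0 t] by simp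
  have 1: "((\<lambda>t. flat 0 (\<epsilon> - t)) has_real_derivative flat 1 (\<epsilon> - t) * (-1)) (at t)"
    by (rule DERIV_chain2[OF D]) (auto intro!: derivative_eq_intros)
  have 2: "((\<lambda>t. flat 0 (\<epsilon> + t)) has_real_derivative flat 1 (\<epsilon> + t) * 1) (at t)"
    by (rule DERIV_chain2[OF D]) (auto intro!: derivative_eq_intros)
  show ?thesis
    unfolding bump_def[abs_def] bump_deriv_def using DERIV_mult'[OF 1 2] by (simp add: algebra_simps)
qed

lemma bump_zero: "\<epsilon> \<le> \<bar>t\<bar> \<Longrightarrow> bump \<epsilon> t = 0" "\<epsilon> \<le> \<bar>t\<bar> \<Longrightarrow> bump_deriv \<epsilon> t = 0"
  by (cases "t \<ge> 0"; simp add: bump_def bump_deriv_def flat_nonpos)+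

lemma bump_minus: "bump \<epsilon> (- t) = bump \<epsilon> t" "bump_deriv \<epsilon> (- t) = - bump_deriv \<epsilon> t"
  by (simp_all add: bump_def bump_deriv_def)

lemma bump_bounds: "0 \<le> bump \<epsilon> t" "bump \<epsilon> t \<le> 1"
  by (auto simp: bump_def flat_bounds intro!: mult_le_one)

lemma bump_pos: "\<bar>t\<bar> < \<epsilon> \<Longrightarrow> 0 < bump \<epsilon> t"
  by (auto simp: bump_def flat_0 abs_less_iff)

lemma continuous_on_bump: "continuous_on S (bump \<epsilon>)" "continuous_on S (bump_deriv \<epsilon>)"
proof -
  have *: "continuous_on S (\<lambda>t. flat k (\<epsilon> - t))" "continuous_on S (\<lambda>t. flat k (\<epsilon> + t))" for k
    by (auto intro!: continuous_on_compose2[OF flat_continuous[of UNIV k]] continuous_intros)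
  show "continuous_on S (bump \<epsilon>)" "continuous_on S (bump_deriv \<epsilon>)"
    unfolding bump_def[abs_def] bump_deriv_def[abs_def] by (intro continuous_intros *)+
qed

lemma bump_deriv_bounded: obtains C where "C \<ge> 0" "\<And>t. \<bar>bump_deriv \<epsilon> t\<bar> \<le> C"
proof -
  have "compact (bump_deriv \<epsilon> ` {- \<epsilon>..\<epsilon>})"
    by (intro compact_continuous_image continuous_on_bump) simp
  then have "bounded (bump_deriv \<epsilon> ` {- \<epsilon>..\<epsilon>})" by (rule compact_imp_bounded)
  then obtain C where C: "\<forall>y\<in>bump_deriv \<epsilon> ` {- \<epsilon>..\<epsilon>}. norm y \<le> C" by (auto simp: bounded_iff)
  have "\<bar>bump_deriv \<epsilon> t\<bar> \<le> max C 0" for t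
  proof (cases "\<epsilon> \<le> \<bar>t\<bar>")
    case True
    then show ?thesis by (simp add: bump_zero)
  next
    case False
    then have "t \<in> {- \<epsilon>..\<epsilon>}" unfolding atLeastAtMost_iff by linarith
    with C show ?thesis by (force simp: le_max_iff_disj)
  qed
  then show ?thesis by (intro that[of "max C 0"]) auto
qed

text \<open>A mollifier in product form, so that smoothness in the sense of \<open>Ck\<close> comes
  from one-variable functions. It depends on y - z only and is not normalised;
  \<open>mollify\<close> divides by its mass.\<close>

definition kern :: "nat \<Rightarrow> real \<Rightarrow> (nat \<Rightarrow> real) \<Rightarrow> (nat \<Rightarrow> real) \<Rightarrow> real" where
  "kern n \<epsilon> y z = (\<Prod>i<n. bump \<epsilon> (y i - z i))"

definition dkern :: "nat \<Rightarrow> real \<Rightarrow> nat \<Rightarrow> (nat \<Rightarrow> real) \<Rightarrow> (nat \<Rightarrow> real) \<Rightarrow> real" where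
  "dkern n \<epsilon> j y z = bump_deriv \<epsilon> (y j - z j) * (\<Prod>i\<in>{..<n} - {j}. bump \<epsilon> (y i - z i))"

lemma kern_commute: "kern n \<epsilon> y z = kern n \<epsilon> z y"
  unfolding kern_def by (metis bump_minus(1) minus_diff_eq)

lemma dkern_commute: "dkern n \<epsilon> j y z = - dkern n \<epsilon> j z y"
proof -
  have "bump_deriv \<epsilon> (y j - z j) = - bump_deriv \<epsilon> (z j - y j)"
    using bump_minus(2)[of \<epsilon> "z j - y j"] by simp
  moreover have "bump \<epsilon> (y i - z i) = bump \<epsilon> (z i - y i)" for i
    using bump_minus(1)[of \<epsilon> "z i - y i"] by simp
  ultimately show ?thesis by (simp add: dkern_def)
qed

lemma kern_bounds: "0 \<le> kern n \<epsilon> y z" "kern n \<epsilon> y z \<le> 1"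
  unfolding kern_def by (auto intro!: prod_nonneg prod_le_1 simp: bump_bounds)

lemma dkern_bounded: obtains C where "C \<ge> 0" "\<And>j y z. \<bar>dkern n \<epsilon> j y z\<bar> \<le> C"
proof -
  obtain C where C: "C \<ge> 0" "\<And>t. \<bar>bump_deriv \<epsilon> t\<bar> \<le> C" using bump_deriv_bounded by metis
  have "\<bar>dkern n \<epsilon> j y z\<bar> \<le> C * 1" for j y z
    unfolding dkern_def abs_mult
  proof (rule mult_mono[OF C(2) _ C(1)])
    show "\<bar>\<Prod>i\<in>{..<n} - {j}. bump \<epsilon> (y i - z i)\<bar> \<le> 1"
      unfolding abs_prod by (rule prod_le_1) (auto simp: bump_bounds)
  qed simp
  with C that[of C] show ?thesis by simp
qed

lemma kern_zero: "i < n \<Longrightarrow> \<epsilon> \<le> \<bar>y i - z i\<bar> \<Longrightarrow> kern n \<epsilon> y z = 0"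
  unfolding kern_def by (rule prod_zero) (auto intro: bump_zero)

lemma dkern_zero: "i < n \<Longrightarrow> \<epsilon> \<le> \<bar>y i - z i\<bar> \<Longrightarrow> dkern n \<epsilon> j y z = 0"
  unfolding dkern_def 
proof (cases "i = j")
  case False
  assume "i < n" "\<epsilon> \<le> \<bar>y i - z i\<bar>"
  with False have "(\<Prod>i\<in>{..<n} - {j}. bump \<epsilon> (y i - z i)) = 0"
    by (intro prod_zero) (auto intro!: bexI[of _ i] bump_zero)
  then show "bump_deriv \<epsilon> (y j - z j) * (\<Prod>i\<in>{..<n} - {j}. bump \<epsilon> (y i - z i)) = 0" by simp
qed (simp add: bump_zero)

text \<open>The dimension \<open>m\<close> and the scale \<open>c\<close> are free because two cases
  occur: R^n with c = 1, and the ambient space of the sphere with c = sqrt d, where only the first n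
  coordinates enter.\<close>

lemma smooth_kern_affine: "smooth m (\<lambda>x. kern n \<epsilon> (\<lambda>i\<in>{..<n}. c * x i) z)"
proof -
  have "smooth m (\<lambda>x. flat 0 (a * x i + b))" for a b i
    using smooth_deriv_seq[OF deriv_seq_affine[OF deriv_seq_flat, of a b], of m i] by simp
  then have "smooth m (\<lambda>x. \<Prod>i<n. flat 0 ((- c) * x i + (\<epsilon> + z i)) * flat 0 (c * x i + (\<epsilon> - z i)))"
    by (intro smooth_prod smooth_mult)
  also have "(\<lambda>x. \<Prod>i<n. flat 0 ((- c) * x i + (\<epsilon> + z i)) * flat 0 (c * x i + (\<epsilon> - z i)))
      = (\<lambda>x. kern n \<epsilon> (\<lambda>i\<in>{..<n}. c * x i) z)"
    by (intro ext) (simp add: kern_def bump_def algebra_simps)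
  finally show ?thesis .
qed

lemma smooth_kern: "smooth n (\<lambda>y. kern n \<epsilon> y z)"
  using smooth_kern_affine[of n n \<epsilon> 1 z] by (simp add: kern_def)

lemma has_derivative_kern:
  assumes "j < n"
  shows "((\<lambda>t. kern n \<epsilon> (y(j := t)) z) has_real_derivative dkern n \<epsilon> j (y(j := t)) z) (at t)"
proof -
  have eq: "kern n \<epsilon> (y(j := t)) z = bump \<epsilon> (t - z j) * (\<Prod>i\<in>{..<n} - {j}. bump \<epsilon> (y i - z i))" for t
    unfolding kern_def using assms by (subst prod.remove[of _ j]) auto
  have "((\<lambda>t. bump \<epsilon> (t - z j)) has_real_derivative bump_deriv \<epsilon> (t - z j) * 1) (at t)"
    by (rule DERIV_chain2[OF has_derivative_bump]) (auto intro!: derivative_eq_intros)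
  from DERIV_cmult_right[OF this, of "\<Prod>i\<in>{..<n} - {j}. bump \<epsilon> (y i - z i)"]
  show ?thesis unfolding eq by (simp add: dkern_def)
qed

lemma pd_kern: "j < n \<Longrightarrow> pd j (\<lambda>y. kern n \<epsilon> y z) y = dkern n \<epsilon> j y z"
  using has_derivative_kern[of j n \<epsilon> y z "y j"] by (intro pd_eqI) simp

lemma pd_kern_lift:
  assumes "j < Suc d"
  shows "pd j (\<lambda>x. kern n \<epsilon> (scaled_proj n d x) z) x
    = (if j < n then sqrt (real d) * dkern n \<epsilon> j (scaled_proj n d x) z else 0)"
proof (cases "j < n")
  case True
  have upd: "scaled_proj n d (x(j := t)) = (scaled_proj n d x)(j := sqrt (real d) * t)" for t
    using True by (auto simp: scaled_proj_def fun_eq_iff)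
  have "((\<lambda>t. kern n \<epsilon> ((scaled_proj n d x)(j := sqrt (real d) * t)) z) has_real_derivative
      dkern n \<epsilon> j ((scaled_proj n d x)(j := sqrt (real d) * x j)) z * sqrt (real d)) (at (x j))"
    by (rule DERIV_chain2[OF has_derivative_kern[OF True]]) (auto intro!: derivative_eq_intros)
  moreover have "(scaled_proj n d x)(j := sqrt (real d) * x j) = scaled_proj n d x"
    using True by (auto simp: scaled_proj_def fun_eq_iff)
  ultimately show ?thesis
    using True by (intro pd_eqI) (simp only: upd if_True mult.commute)
next
  case False
  have "scaled_proj n d (x(j := t)) = scaled_proj n d x" for t
    using False by (auto simp: scaled_proj_def fun_eq_iff)
  with False show ?thesis by (simp add: pd_def)
qed

lemma test_function_kern: "test_function n (kern n \<epsilon> y)"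
  unfolding test_function_def
proof (intro conjI exI ballI)
  show "smooth n (kern n \<epsilon> y)"
    using smooth_kern[of n \<epsilon> y] unfolding kern_commute[of n \<epsilon> _ y] .
  \<comment> \<open>The kernel vanishes once some |z i| exceeds |y i| + |epsilon|; the sum bounds
    all |y i| simultaneously.\<close>
  define A where "A = \<bar>\<epsilon>\<bar> + (\<Sum>i<n. \<bar>y i\<bar>)"
  show "compact (PiE {..<n} (\<lambda>_. {-A..A}))" by (rule compact_box)
  fix z assume z: "z \<in> Rn n - PiE {..<n} (\<lambda>_. {-A..A})"
  then have "\<not> (\<forall>i<n. \<bar>z i\<bar> \<le> A)"
    by (auto simp: Rn_def PiE_def Pi_def abs_le_iff minus_le_iff)
  then obtain i where i: "i < n" "A < \<bar>z i\<bar>" by auto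
  have "\<bar>y i\<bar> \<le> (\<Sum>i<n. \<bar>y i\<bar>)" by (rule member_le_sum) (use i in auto)
  with i have "\<epsilon> \<le> \<bar>y i - z i\<bar>" unfolding A_def by linarith
  then show "kern n \<epsilon> y z = 0" using i(1) by (intro kern_zero)
qed

text \<open>As the kernel depends on y - z, a derivative in y is minus the one in z. This sign
  cancels the sign in the definition of the weak gradient, so the derivative of a mollification
  falls on \<open>g\<close>.\<close>

lemma weak_grad_kern:
  assumes "has_weak_grad n v g" "j < n"
  shows "(\<integral>z. v z * dkern n \<epsilon> j y z \<partial>leb n) = (\<integral>z. g z j * kern n \<epsilon> y z \<partial>leb n)"
proof -
  have pd: "pd j (kern n \<epsilon> y) z = - dkern n \<epsilon> j y z" for z
  proof -
    have "pd j (kern n \<epsilon> y) z = pd j (\<lambda>z. kern n \<epsilon> z y) z"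
      by (rule arg_cong[where f="\<lambda>f. pd j f z"]) (simp add: fun_eq_iff kern_commute)
    then show ?thesis using pd_kern[OF assms(2), of \<epsilon> y z] dkern_commute[of n \<epsilon> j y z] by simp
  qed
  have "(\<integral>z. v z * pd j (kern n \<epsilon> y) z \<partial>leb n) = - (\<integral>z. g z j * kern n \<epsilon> y z \<partial>leb n)"
    using assms test_function_kern[of n \<epsilon> y] unfolding has_weak_grad_def by blast
  then show ?thesis by (simp add: pd)
qed

lemma sphere_divergence_kern:
  assumes n: "n \<le> d" and X: "sph_tangent_field d X"
  shows "(\<integral>\<omega>. kern n \<epsilon> (scaled_proj n d \<omega>) z * sph_div d X \<omega> \<partial>sph_measure d)
    = - (\<integral>\<omega>. (\<Sum>j<n. sqrt (real d) * dkern n \<epsilon> j (scaled_proj n d \<omega>) z * X \<omega> j) \<partial>sph_measure d)"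
proof -
  have "smooth (Suc d) (\<lambda>x. kern n \<epsilon> (scaled_proj n d x) z)"
    unfolding scaled_proj_def by (rule smooth_kern_affine)
  then have "(\<integral>\<omega>. kern n \<epsilon> (scaled_proj n d \<omega>) z * sph_div d X \<omega> \<partial>sph_measure d)
    = - (\<integral>\<omega>. (\<Sum>j<Suc d. pd j (\<lambda>x. kern n \<epsilon> (scaled_proj n d x) z) \<omega> * X \<omega> j) \<partial>sph_measure d)"
    by (intro sphere_divergence smooth_Ck X)
  also have "(\<lambda>\<omega>. \<Sum>j<Suc d. pd j (\<lambda>x. kern n \<epsilon> (scaled_proj n d x) z) \<omega> * X \<omega> j)
      = (\<lambda>\<omega>. \<Sum>j<n. sqrt (real d) * dkern n \<epsilon> j (scaled_proj n d \<omega>) z * X \<omega> j)"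
  proof
    fix \<omega>
    show "(\<Sum>j<Suc d. pd j (\<lambda>x. kern n \<epsilon> (scaled_proj n d x) z) \<omega> * X \<omega> j)
      = (\<Sum>j<n. sqrt (real d) * dkern n \<epsilon> j (scaled_proj n d \<omega>) z * X \<omega> j)"
      using n by (intro sum.mono_neutral_cong_right) (auto simp: pd_kern_lift)
  qed
  finally show ?thesis .
qed

lemma measurable_kern_pair:
  assumes n: "n \<le> d"
  shows "(\<lambda>p. kern n \<epsilon> (scaled_proj n d (fst p)) (snd p)) \<in> borel_measurable (sph_measure d \<Otimes>\<^sub>M leb n)"
    and "j < n \<Longrightarrow> (\<lambda>p. dkern n \<epsilon> j (scaled_proj n d (fst p)) (snd p)) \<in> borel_measurable (sph_measure d \<Otimes>\<^sub>M leb n)"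
proof -
  let ?P = "sph_measure d \<Otimes>\<^sub>M leb n"
  have diff: "(\<lambda>p. scaled_proj n d (fst p) i - snd p i) \<in> borel_measurable ?P" if "i < n" for i
  proof (rule borel_measurable_diff)
    show "(\<lambda>p. scaled_proj n d (fst p) i) \<in> borel_measurable ?P"
      by (rule measurable_compose[OF measurable_compose[OF measurable_fst scaled_proj_measurable[OF n]]
            measurable_leb_component[OF that]])
    show "(\<lambda>p. snd p i) \<in> borel_measurable ?P"
      by (rule measurable_compose[OF measurable_snd measurable_leb_component[OF that]])
  qed
  have b: "(\<lambda>p. bump \<epsilon> (scaled_proj n d (fst p) i - snd p i)) \<in> borel_measurable ?P" if "i < n" for i
    by (rule measurable_compose[OF diff[OF that] borel_measurable_continuous_onI[OF continuous_on_bump(1)]])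
  have b': "(\<lambda>p. bump_deriv \<epsilon> (scaled_proj n d (fst p) i - snd p i)) \<in> borel_measurable ?P" if "i < n" for i
    by (rule measurable_compose[OF diff[OF that] borel_measurable_continuous_onI[OF continuous_on_bump(2)]])
  show "(\<lambda>p. kern n \<epsilon> (scaled_proj n d (fst p)) (snd p)) \<in> borel_measurable ?P"
    unfolding kern_def by (intro borel_measurable_prod b) simp
  show "(\<lambda>p. dkern n \<epsilon> j (scaled_proj n d (fst p)) (snd p)) \<in> borel_measurable ?P" if "j < n"
    unfolding dkern_def using that by (intro borel_measurable_times borel_measurable_prod b b') auto
qed

lemma pair_sigma_finite_sph: "pair_sigma_finite (sph_measure d) (leb n)"
  by (simp add: pair_sigma_finite_def sigma_finite_leb finite_measure.axioms(1)[OF finite_sph_measure])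

text \<open>A bounded kernel and the finite measure of the sphere reduce joint integrability to that
  of \<open>f\<close> on R^n, which is the reason for truncating L2 functions beforehand.\<close>

lemma integrable_pair_sph:
  fixes f :: "(nat \<Rightarrow> real) \<Rightarrow> real"
  assumes f: "integrable (leb n) f"
    and k: "k \<in> borel_measurable (sph_measure d \<Otimes>\<^sub>M leb n)"
    and C: "\<And>\<omega> z. \<omega> \<in> Sph d \<Longrightarrow> \<bar>k (\<omega>, z)\<bar> \<le> C"
  shows "integrable (sph_measure d \<Otimes>\<^sub>M leb n) (\<lambda>p. f (snd p) * k p)"
proof -
  interpret pair_sigma_finite "sph_measure d" "leb n" by (rule pair_sigma_finite_sph)
  let ?P = "sph_measure d \<Otimes>\<^sub>M leb n"
  have fm: "(\<lambda>p. f (snd p)) \<in> borel_measurable ?P"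
    by (rule measurable_compose[OF measurable_snd borel_measurable_integrable[OF f]])
  have "integrable ?P (\<lambda>p. f (snd p))"
  proof (rule Fubini_integrable[OF fm])
    show "integrable (sph_measure d) (\<lambda>x. \<integral>y. norm (f (snd (x, y))) \<partial>leb n)"
      by (simp add: finite_measure.integrable_const[OF finite_sph_measure])
    show "AE x in sph_measure d. integrable (leb n) (\<lambda>y. f (snd (x, y)))" using f by simp
  qed
  then have "integrable ?P (\<lambda>p. C * f (snd p))" by simp
  then show ?thesis
  proof (rule Bochner_Integration.integrable_bound)
    show "(\<lambda>p. f (snd p) * k p) \<in> borel_measurable ?P" using fm k by (rule borel_measurable_times)
    show "AE p in ?P. norm (f (snd p) * k p) \<le> norm (C * f (snd p))"
    proof (rule AE_I2)
      fix p assume "p \<in> space ?P"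
      then have "\<bar>k p\<bar> \<le> C" using C[of "fst p" "snd p"] by (auto simp: space_pair_measure)
      then have "\<bar>f (snd p)\<bar> * \<bar>k p\<bar> \<le> \<bar>f (snd p)\<bar> * \<bar>C\<bar>" by (intro mult_left_mono) auto
      then show "norm (f (snd p) * k p) \<le> norm (C * f (snd p))" by (simp add: abs_mult mult.commute)
    qed
  qed
qed

lemma Fubini_sph:
  fixes f :: "(nat \<Rightarrow> real) \<Rightarrow> real"
  assumes f: "integrable (leb n) f"
    and k: "(\<lambda>p. k (fst p) (snd p)) \<in> borel_measurable (sph_measure d \<Otimes>\<^sub>M leb n)"
    and C: "\<And>\<omega> z. \<omega> \<in> Sph d \<Longrightarrow> \<bar>k \<omega> z\<bar> \<le> C"
  shows "integrable (sph_measure d) (\<lambda>\<omega>. \<integral>z. f z * k \<omega> z \<partial>leb n)"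
    and "(\<integral>\<omega>. (\<integral>z. f z * k \<omega> z \<partial>leb n) \<partial>sph_measure d) = (\<integral>z. f z * (\<integral>\<omega>. k \<omega> z \<partial>sph_measure d) \<partial>leb n)"
proof -
  interpret pair_sigma_finite "sph_measure d" "leb n" by (rule pair_sigma_finite_sph)
  have int: "integrable (sph_measure d \<Otimes>\<^sub>M leb n) (\<lambda>(\<omega>, z). f z * k \<omega> z)"
    using integrable_pair_sph[OF f k, of C] C by (simp add: case_prod_unfold)
  show "integrable (sph_measure d) (\<lambda>\<omega>. \<integral>z. f z * k \<omega> z \<partial>leb n)"
    using integrable_fst[OF int] by simp
  show "(\<integral>\<omega>. (\<integral>z. f z * k \<omega> z \<partial>leb n) \<partial>sph_measure d) = (\<integral>z. f z * (\<integral>\<omega>. k \<omega> z \<partial>sph_measure d) \<partial>leb n)"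
    using Fubini_integral[OF int] by simp
qed

section \<open>Mollified functions and their L1 distance to the original\<close>

definition kern_mass :: "nat \<Rightarrow> real \<Rightarrow> real" where
  "kern_mass n \<epsilon> = (\<integral>h. kern n \<epsilon> (\<lambda>_. 0) h \<partial>leb n)"

lemma kern_measurable: "kern n \<epsilon> y \<in> borel_measurable (leb n)"
  using test_function_kern[of n \<epsilon> y]
  by (auto simp: test_function_def intro: continuous_on_Rn_measurable smooth_continuous)

lemma kern_0_support: "h \<in> Rn n \<Longrightarrow> h \<notin> cube n \<epsilon> \<Longrightarrow> kern n \<epsilon> (\<lambda>_. 0) h = 0"
  using kern_zero[of _ n \<epsilon> "\<lambda>_. 0" h] by (auto simp: mem_cube not_less)

text \<open>A kernel of mass 0 would vanish almost everywhere, yet it is positive on a cube of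
  measure (2 epsilon)^n.\<close>

lemma kern_mass:
  assumes "\<epsilon> > 0"
  shows "integrable (leb n) (kern n \<epsilon> (\<lambda>_. 0))" "kern_mass n \<epsilon> > 0"
proof -
  have "integrable (leb n) (indicator (cube n \<epsilon> \<inter> cube n \<epsilon>) :: _ \<Rightarrow> real)"
    by (rule integrable_indicator_cube) simp
  then show int: "integrable (leb n) (kern n \<epsilon> (\<lambda>_. 0))"
  proof (rule Bochner_Integration.integrable_bound[OF _ kern_measurable])
    show "AE h in leb n. norm (kern n \<epsilon> (\<lambda>_. 0) h) \<le> norm (indicator (cube n \<epsilon> \<inter> cube n \<epsilon>) h :: real)"
      using kern_bounds[of n \<epsilon> "\<lambda>_. 0"] kern_0_support[of _ n \<epsilon>]
      by (intro AE_I2) (auto simp: space_leb indicator_def)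
  qed
  have "kern_mass n \<epsilon> \<noteq> 0"
  proof
    assume "kern_mass n \<epsilon> = 0"
    then have "AE h in leb n. kern n \<epsilon> (\<lambda>_. 0) h = 0"
      using integral_nonneg_eq_0_iff_AE[OF int] kern_bounds(1) by (simp add: kern_mass_def)
    then have "AE h in leb n. h \<notin> cube n \<epsilon>"
    proof (rule AE_mp, intro AE_I2 impI)
      fix h assume h: "h \<in> space (leb n)" "kern n \<epsilon> (\<lambda>_. 0) h = 0"
      show "h \<notin> cube n \<epsilon>"
      proof
        assume "h \<in> cube n \<epsilon>"
        then have "0 < bump \<epsilon> (0 - h i)" if "i < n" for i
          using h(1) that by (intro bump_pos) (simp add: mem_cube space_leb)
        then have "kern n \<epsilon> (\<lambda>_. 0) h > 0" unfolding kern_def by (intro prod_pos) auto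
        with h(2) show False by simp
      qed
    qed
    moreover have eq: "{h \<in> space (leb n). \<not> h \<notin> cube n \<epsilon>} = cube n \<epsilon>"
      using sets.sets_into_space[OF cube_sets] by blast
    ultimately have "emeasure (leb n) (cube n \<epsilon>) = 0"
      using AE_iff_measurable[where P="\<lambda>h. h \<notin> cube n \<epsilon>", OF cube_sets eq] by (simp only:)
    moreover have "emeasure (leb n) (cube n \<epsilon>) = (\<Prod>i<n. ennreal (2 * \<epsilon>))"
      unfolding cube_def using assms by (subst emeasure_leb_PiE) auto
    ultimately show False using assms by simp
  qed
  moreover have "kern_mass n \<epsilon> \<ge> 0" unfolding kern_mass_def by (intro integral_nonneg_AE) (simp add: kern_bounds)
  ultimately show "kern_mass n \<epsilon> > 0" by simp
qed

definition mollify :: "nat \<Rightarrow> real \<Rightarrow> ((nat \<Rightarrow> real) \<Rightarrow> real) \<Rightarrow> (nat \<Rightarrow> real) \<Rightarrow> real" where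
  "mollify n \<epsilon> f y = (\<integral>z. f z * kern n \<epsilon> y z \<partial>leb n) / kern_mass n \<epsilon>"

lemma shift_commute: "x \<in> Rn n \<Longrightarrow> shift n x y = shift n y x"
  by (simp add: shift_def add.commute)

text \<open>The difference is a mean of \<open>f (y + h) - f y\<close> over h, to which the triangle
  inequality applies. Extended nonnegative integrals are used so that Tonelli can afterwards
  exchange h with the point of the sphere.\<close>

lemma mollify_diff:
  assumes f: "integrable (leb n) f" and e: "\<epsilon> > 0" and y: "y \<in> Rn n"
  shows "ennreal \<bar>mollify n \<epsilon> f y - f y\<bar>
    \<le> (\<integral>\<^sup>+h. ennreal (kern n \<epsilon> (\<lambda>_. 0) h) * ennreal \<bar>f (shift n h y) - f y\<bar> \<partial>leb n) / ennreal (kern_mass n \<epsilon>)"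
proof -
  let ?\<rho> = "kern n \<epsilon> (\<lambda>_. 0)"
  have m: "kern_mass n \<epsilon> > 0" and \<rho>: "integrable (leb n) ?\<rho>" using kern_mass[OF e] by auto
  have fm: "f \<in> borel_measurable (leb n)" using f by simp
  have fs: "integrable (leb n) (\<lambda>h. f (shift n y h))" by (rule integrable_shift[OF f])
  have int: "integrable (leb n) (\<lambda>h. f (shift n y h) * ?\<rho> h)"
  proof (rule Bochner_Integration.integrable_bound[OF fs])
    show "(\<lambda>h. f (shift n y h) * ?\<rho> h) \<in> borel_measurable (leb n)"
      by (intro borel_measurable_times measurable_shift_comp fm kern_measurable)
    show "AE h in leb n. norm (f (shift n y h) * ?\<rho> h) \<le> norm (f (shift n y h))"
      using kern_bounds[of n \<epsilon> "\<lambda>_. 0"] by (auto simp: abs_mult mult_left_le)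
  qed
  have "(\<integral>z. f z * kern n \<epsilon> y z \<partial>leb n) = (\<integral>h. f (shift n y h) * kern n \<epsilon> y (shift n y h) \<partial>leb n)"
    by (rule integral_shift[symmetric]) (intro borel_measurable_times fm kern_measurable)
  also have "\<dots> = (\<integral>h. f (shift n y h) * ?\<rho> h \<partial>leb n)"
  proof -
    have "kern n \<epsilon> y (shift n y h) = ?\<rho> h" for h
      unfolding kern_def shift_def by (intro prod.cong) auto
    then show ?thesis by simp
  qed
  finally have "mollify n \<epsilon> f y - f y = (\<integral>h. f (shift n y h) * ?\<rho> h - f y * ?\<rho> h \<partial>leb n) / kern_mass n \<epsilon>"
    using m int \<rho> by (simp add: mollify_def kern_mass_def[symmetric] field_simps)
  then have "\<bar>mollify n \<epsilon> f y - f y\<bar> = \<bar>\<integral>h. f (shift n y h) * ?\<rho> h - f y * ?\<rho> h \<partial>leb n\<bar> / kern_mass n \<epsilon>"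
    using m by (simp add: abs_divide)
  then have "ennreal \<bar>mollify n \<epsilon> f y - f y\<bar> = ennreal \<bar>\<integral>h. f (shift n y h) * ?\<rho> h - f y * ?\<rho> h \<partial>leb n\<bar> / ennreal (kern_mass n \<epsilon>)"
    using m by (simp add: divide_ennreal)
  also have "\<dots> \<le> (\<integral>\<^sup>+h. ennreal \<bar>f (shift n y h) * ?\<rho> h - f y * ?\<rho> h\<bar> \<partial>leb n) / ennreal (kern_mass n \<epsilon>)"
    using integral_norm_bound_ennreal[of "leb n" "\<lambda>h. f (shift n y h) * ?\<rho> h - f y * ?\<rho> h"] int \<rho>
    by (intro divide_right_mono_ennreal) simp
  also have "(\<lambda>h. ennreal \<bar>f (shift n y h) * ?\<rho> h - f y * ?\<rho> h\<bar>)
      = (\<lambda>h. ennreal (?\<rho> h) * ennreal \<bar>f (shift n h y) - f y\<bar>)"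
  proof
    fix h
    have "\<bar>f (shift n y h) * ?\<rho> h - f y * ?\<rho> h\<bar> = ?\<rho> h * \<bar>f (shift n h y) - f y\<bar>"
      using kern_bounds(1)[of n \<epsilon> "\<lambda>_. 0" h]
      by (simp add: shift_commute[OF y] left_diff_distrib[symmetric] abs_mult mult.commute)
    then show "ennreal \<bar>f (shift n y h) * ?\<rho> h - f y * ?\<rho> h\<bar> = ennreal (?\<rho> h) * ennreal \<bar>f (shift n h y) - f y\<bar>"
      by (simp add: ennreal_mult kern_bounds)
  qed
  finally show ?thesis .
qed

text \<open>By Tonelli the distance is a mean over h of L1 distances on the sphere between f and its
  translates. Only h in the support of the kernel count, and each distance moves to R^n at the price
  1/Z.\<close>

lemma mollify_approx:
  assumes nd: "Suc n \<le> d" and f: "integrable (leb n) f"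
    and e: "\<epsilon> > 0" and b: "b \<ge> 0"
    and small: "\<And>h. (\<forall>i<n. \<bar>h i\<bar> \<le> \<epsilon>) \<Longrightarrow> (\<integral>x. \<bar>f (shift n h x) - f x\<bar> \<partial>leb n) \<le> b"
  shows "(\<integral>\<^sup>+\<omega>. ennreal \<bar>mollify n \<epsilon> f (scaled_proj n d \<omega>) - f (scaled_proj n d \<omega>)\<bar> \<partial>sph_measure d)
    \<le> ennreal (b / (\<integral>y. sph_weight n d y \<partial>leb n))"
proof -
  interpret pair_sigma_finite "sph_measure d" "leb n" by (rule pair_sigma_finite_sph)
  let ?\<rho> = "kern n \<epsilon> (\<lambda>_. 0)" and ?Y = "scaled_proj n d" and ?m = "kern_mass n \<epsilon>"
  let ?Z = "\<integral>y. sph_weight n d y \<partial>leb n"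
  have n: "n \<le> d" using nd by simp
  have m: "?m > 0" and \<rho>: "integrable (leb n) ?\<rho>" using kern_mass[OF e] by auto
  have Z: "?Z > 0" by (rule distr_scaled_proj(2)[OF nd])
  have fm: "f \<in> borel_measurable (leb n)" using f by simp
  let ?D = "\<lambda>h \<omega>. ennreal \<bar>f (shift n h (?Y \<omega>)) - f (?Y \<omega>)\<bar>"
  have comp: "(\<lambda>p. ?Y (fst p)) \<in> measurable (sph_measure d \<Otimes>\<^sub>M leb n) (leb n)"
    by (rule measurable_compose[OF measurable_fst scaled_proj_measurable[OF n]])
  have sh: "(\<lambda>p. shift n (snd p) (?Y (fst p))) \<in> measurable (sph_measure d \<Otimes>\<^sub>M leb n) (leb n)"
  proof (rule measurable_into_leb)
    fix i assume i: "i < n"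
    have "(\<lambda>p. snd p i + 1 * ?Y (fst p) i) \<in> borel_measurable (sph_measure d \<Otimes>\<^sub>M leb n)"
      using measurable_compose[OF measurable_snd measurable_leb_component[OF i]]
        measurable_compose[OF comp measurable_leb_component[OF i]]
      by (intro borel_measurable_add borel_measurable_times) auto
    then show "(\<lambda>p. shift n (snd p) (?Y (fst p)) i) \<in> borel_measurable (sph_measure d \<Otimes>\<^sub>M leb n)"
      using i by (simp add: shift_def)
  qed simp
  have Dm: "(\<lambda>p. ?D (snd p) (fst p)) \<in> borel_measurable (sph_measure d \<Otimes>\<^sub>M leb n)"
    using measurable_compose[OF comp fm] measurable_compose[OF sh fm] by measurable
  have \<rho>m: "(\<lambda>p. ennreal (?\<rho> (snd p))) \<in> borel_measurable (sph_measure d \<Otimes>\<^sub>M leb n)"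
    using measurable_compose[OF measurable_snd kern_measurable] by measurable
  have PDm: "(\<lambda>(\<omega>, h). ennreal (?\<rho> h) * ?D h \<omega>) \<in> borel_measurable (sph_measure d \<Otimes>\<^sub>M leb n)"
    using borel_measurable_times_ennreal[OF \<rho>m Dm] by (simp add: case_prod_unfold)
  have "(\<integral>\<^sup>+\<omega>. (\<integral>\<^sup>+h. ennreal (?\<rho> h) * ?D h \<omega> \<partial>leb n) \<partial>sph_measure d)
      = (\<integral>\<^sup>+h. (\<integral>\<^sup>+\<omega>. ennreal (?\<rho> h) * ?D h \<omega> \<partial>sph_measure d) \<partial>leb n)"
    by (rule Fubini'[OF PDm, symmetric])
  also have "\<dots> \<le> (\<integral>\<^sup>+h. ennreal (?\<rho> h) * ennreal (b / ?Z) \<partial>leb n)"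
  proof (rule nn_integral_mono)
    fix h assume "h \<in> space (leb n)"
    then have h: "h \<in> Rn n" by (simp add: space_leb)
    have fsm: "(\<lambda>y. f (shift n h y)) \<in> borel_measurable (leb n)" by (rule measurable_shift_comp[OF fm])
    have Dh: "(\<lambda>y. ennreal \<bar>f (shift n h y) - f y\<bar>) \<in> borel_measurable (leb n)"
      using fsm fm by measurable
    have "(\<integral>\<^sup>+\<omega>. ennreal (?\<rho> h) * ?D h \<omega> \<partial>sph_measure d) = ennreal (?\<rho> h) * (\<integral>\<^sup>+\<omega>. ?D h \<omega> \<partial>sph_measure d)"
      by (rule nn_integral_cmult[OF measurable_compose[OF scaled_proj_measurable[OF n] Dh]])
    also have "\<dots> \<le> ennreal (?\<rho> h) * ennreal (b / ?Z)"
    proof (cases "h \<in> cube n \<epsilon>")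
      case False
      then show ?thesis using kern_0_support[OF h] by simp
    next
      case True
      then have hs: "\<forall>i<n. \<bar>h i\<bar> \<le> \<epsilon>" using h by (auto simp: mem_cube less_imp_le)
      have int: "integrable (leb n) (\<lambda>y. \<bar>f (shift n h y) - f y\<bar>)"
        by (intro integrable_abs Bochner_Integration.integrable_diff integrable_shift f)
      have "(\<integral>\<^sup>+\<omega>. ?D h \<omega> \<partial>sph_measure d) \<le> ennreal (1 / ?Z) * (\<integral>\<^sup>+y. ennreal \<bar>f (shift n h y) - f y\<bar> \<partial>leb n)"
        by (rule nn_integral_scaled_proj_le[OF nd Dh])
      also have "(\<integral>\<^sup>+y. ennreal \<bar>f (shift n h y) - f y\<bar> \<partial>leb n) = ennreal (\<integral>y. \<bar>f (shift n h y) - f y\<bar> \<partial>leb n)"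
        by (rule nn_integral_eq_integral[OF int]) simp
      also have "ennreal (1 / ?Z) * \<dots> \<le> ennreal (1 / ?Z) * ennreal b"
        by (intro mult_left_mono ennreal_leI small hs) simp
      also have "\<dots> = ennreal (b / ?Z)"
        using Z b by (simp add: ennreal_mult[symmetric])
      finally show ?thesis by (intro mult_left_mono) simp_all
    qed
    finally show "(\<integral>\<^sup>+\<omega>. ennreal (?\<rho> h) * ?D h \<omega> \<partial>sph_measure d) \<le> ennreal (?\<rho> h) * ennreal (b / ?Z)" .
  qed
  also have "\<dots> = ennreal ?m * ennreal (b / ?Z)"
  proof -
    have "(\<integral>\<^sup>+h. ennreal (?\<rho> h) \<partial>leb n) = ennreal ?m"
      unfolding kern_mass_def by (rule nn_integral_eq_integral[OF \<rho>]) (simp add: kern_bounds)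
    then show ?thesis
      using measurable_compose[OF kern_measurable measurable_ennreal] by (simp add: nn_integral_multc)
  qed
  finally have "(\<integral>\<^sup>+\<omega>. (\<integral>\<^sup>+h. ennreal (?\<rho> h) * ?D h \<omega> \<partial>leb n) \<partial>sph_measure d) / ennreal ?m
      \<le> ennreal ?m * ennreal (b / ?Z) / ennreal ?m"
    by (rule divide_right_mono_ennreal)
  also have "\<dots> = ennreal (b / ?Z)"
    unfolding mult.commute[of "ennreal ?m"]
    by (rule mult_divide_eq_ennreal) (use m in \<open>simp_all add: ennreal_eq_0_iff not_le\<close>)
  finally have bound: "(\<integral>\<^sup>+\<omega>. (\<integral>\<^sup>+h. ennreal (?\<rho> h) * ?D h \<omega> \<partial>leb n) \<partial>sph_measure d) / ennreal ?m
      \<le> ennreal (b / ?Z)" .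
  have "(\<integral>\<^sup>+\<omega>. ennreal \<bar>mollify n \<epsilon> f (?Y \<omega>) - f (?Y \<omega>)\<bar> \<partial>sph_measure d)
      \<le> (\<integral>\<^sup>+\<omega>. (\<integral>\<^sup>+h. ennreal (?\<rho> h) * ?D h \<omega> \<partial>leb n) / ennreal ?m \<partial>sph_measure d)"
    by (intro nn_integral_mono mollify_diff[OF f e]) simp
  also have "\<dots> = (\<integral>\<^sup>+\<omega>. (\<integral>\<^sup>+h. ennreal (?\<rho> h) * ?D h \<omega> \<partial>leb n) \<partial>sph_measure d) / ennreal ?m"
    using M2.borel_measurable_nn_integral[OF PDm]
    by (intro nn_integral_divide) simp
  also note bound
  finally show ?thesis .
qed

lemma integrable_mollify:
  assumes nd: "Suc n \<le> d" and f: "integrable (leb n) f"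
  shows "integrable (sph_measure d) (\<lambda>\<omega>. mollify n \<epsilon> f (scaled_proj n d \<omega>))"
proof -
  have "n \<le> d" using nd by simp
  then have "integrable (sph_measure d) (\<lambda>\<omega>. \<integral>z. f z * kern n \<epsilon> (scaled_proj n d \<omega>) z \<partial>leb n)"
    by (intro Fubini_sph(1)[OF f measurable_kern_pair(1), of _ _ 1]) (simp_all add: kern_bounds)
  then show ?thesis by (simp add: mollify_def)
qed

lemma mollify_tendsto:
  assumes nd: "Suc n \<le> d" and f: "integrable (leb n) f"
    and F: "continuous_on (Rn (Suc d)) F"
  shows "(\<lambda>k. \<integral>\<omega>. F \<omega> * mollify n (inverse (real (Suc k))) f (scaled_proj n d \<omega>) \<partial>sph_measure d)
    \<longlonglongrightarrow> (\<integral>\<omega>. F \<omega> * f (scaled_proj n d \<omega>) \<partial>sph_measure d)"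
proof (rule LIMSEQ_I)
  fix r :: real assume r: "r > 0"
  let ?M = "sph_measure d" and ?Y = "scaled_proj n d" and ?Z = "\<integral>y. sph_weight n d y \<partial>leb n"
  obtain B where B: "B \<ge> 0" "\<And>x. x \<in> Sph d \<Longrightarrow> \<bar>F x\<bar> \<le> B" using bounded_on_Sph[OF F] by metis
  have Z: "?Z > 0" by (rule distr_scaled_proj(2)[OF nd])
  \<comment> \<open>Then B (b / Z) = r B / (2 (B + 1)) < r; the summand 1 covers the case B =
    0.\<close>
  define b where "b = r * ?Z / (2 * (B + 1))"
  have b: "b > 0" using r Z B by (simp add: b_def)
  obtain \<delta> where \<delta>: "\<delta> > 0" "\<And>h. \<forall>i<n. \<bar>h i\<bar> \<le> \<delta> \<Longrightarrow> (\<integral>x. \<bar>f (shift n h x) - f x\<bar> \<partial>leb n) < b"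
    using L1_translation_continuous[OF f b] by blast
  obtain K where K: "inverse (real (Suc K)) < \<delta>" using reals_Archimedean[OF \<delta>(1)] by blast
  have "norm ((\<integral>\<omega>. F \<omega> * mollify n (inverse (real (Suc k))) f (?Y \<omega>) \<partial>?M) - (\<integral>\<omega>. F \<omega> * f (?Y \<omega>) \<partial>?M)) < r"
    if k: "k \<ge> K" for k
  proof -
    define \<epsilon> where "\<epsilon> = inverse (real (Suc k))"
    have e: "\<epsilon> > 0" "\<epsilon> \<le> \<delta>"
    proof -
      have "\<epsilon> \<le> inverse (real (Suc K))" using k by (simp add: \<epsilon>_def)
      with K show "\<epsilon> \<le> \<delta>" by linarith
    qed (simp add: \<epsilon>_def)
    let ?d = "\<lambda>\<omega>. mollify n \<epsilon> f (?Y \<omega>) - f (?Y \<omega>)"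
    have im: "integrable ?M (\<lambda>\<omega>. mollify n \<epsilon> f (?Y \<omega>))" by (rule integrable_mollify[OF nd f])
    have iY: "integrable ?M (\<lambda>\<omega>. f (?Y \<omega>))" by (rule integrable_scaled_proj[OF nd f])
    have id: "integrable ?M ?d" using im iY by simp
    have "(\<integral>\<^sup>+\<omega>. ennreal \<bar>?d \<omega>\<bar> \<partial>?M) \<le> ennreal (b / ?Z)"
    proof (rule mollify_approx[OF nd f e(1)])
      fix h assume "\<forall>i<n. \<bar>h i\<bar> \<le> \<epsilon>"
      then have "\<forall>i<n. \<bar>h i\<bar> \<le> \<delta>" using e(2) by (meson order_trans)
      from \<delta>(2)[OF this] show "(\<integral>x. \<bar>f (shift n h x) - f x\<bar> \<partial>leb n) \<le> b" by simp
    qed (use b in simp)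
    moreover have "(\<integral>\<^sup>+\<omega>. ennreal \<bar>?d \<omega>\<bar> \<partial>?M) = ennreal (\<integral>\<omega>. \<bar>?d \<omega>\<bar> \<partial>?M)"
      by (rule nn_integral_eq_integral) (use id in auto)
    ultimately have L1: "(\<integral>\<omega>. \<bar>?d \<omega>\<bar> \<partial>?M) \<le> b / ?Z"
      using b Z by (simp add: ennreal_le_iff)
    have "(\<integral>\<omega>. F \<omega> * mollify n \<epsilon> f (?Y \<omega>) \<partial>?M) - (\<integral>\<omega>. F \<omega> * f (?Y \<omega>) \<partial>?M) = (\<integral>\<omega>. F \<omega> * ?d \<omega> \<partial>?M)"
      using integrable_sph_mult_bounded[OF im F] integrable_sph_mult_bounded[OF iY F]
      by (simp add: right_diff_distrib)
    also have "norm \<dots> \<le> (\<integral>\<omega>. B * \<bar>?d \<omega>\<bar> \<partial>?M)"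
    proof (rule order_trans[OF integral_norm_bound integral_mono])
      show "integrable ?M (\<lambda>\<omega>. norm (F \<omega> * ?d \<omega>))"
        by (intro integrable_norm integrable_sph_mult_bounded[OF id F])
      show "integrable ?M (\<lambda>\<omega>. B * \<bar>?d \<omega>\<bar>)" using id by simp
      show "norm (F \<omega> * ?d \<omega>) \<le> B * \<bar>?d \<omega>\<bar>" if "\<omega> \<in> space ?M" for \<omega>
        using B(2)[of \<omega>] that by (simp add: abs_mult mult_right_mono)
    qed
    also have "\<dots> = B * (\<integral>\<omega>. \<bar>?d \<omega>\<bar> \<partial>?M)" by simp
    also have "\<dots> \<le> B * (b / ?Z)" by (rule mult_left_mono[OF L1 B(1)])
    also have "\<dots> = r * (B / (2 * (B + 1)))" using Z by (simp add: b_def)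
    also have "\<dots> < r * 1"
      using r B(1) by (intro mult_strict_left_mono) (auto simp: divide_less_eq)
    finally show ?thesis by (simp add: \<epsilon>_def)
  qed
  then show "\<exists>K. \<forall>k\<ge>K. norm ((\<integral>\<omega>. F \<omega> * mollify n (inverse (real (Suc k))) f (?Y \<omega>) \<partial>?M) - (\<integral>\<omega>. F \<omega> * f (?Y \<omega>) \<partial>?M)) < r"
    by blast
qed

section \<open>The weak gradient of the lift\<close>

lemma square_integrable_add:
  assumes "square_integrable M f" "square_integrable M g"
  shows "square_integrable M (\<lambda>x. f x + g x)"
  unfolding square_integrable_def
proof
  have fm: "f \<in> borel_measurable M" and gm: "g \<in> borel_measurable M"
    and int: "integrable M (\<lambda>x. 2 * (f x)\<^sup>2 + 2 * (g x)\<^sup>2)"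
    using assms by (auto simp: square_integrable_def)
  show "(\<lambda>x. f x + g x) \<in> borel_measurable M" using fm gm by simp
  show "integrable M (\<lambda>x. (f x + g x)\<^sup>2)"
  proof (rule Bochner_Integration.integrable_bound[OF int])
    show "(\<lambda>x. (f x + g x)\<^sup>2) \<in> borel_measurable M" using fm gm by simp
    have "(f x + g x)\<^sup>2 \<le> 2 * (f x)\<^sup>2 + 2 * (g x)\<^sup>2" for x
      using zero_le_power2[of "f x - g x"] by (simp add: power2_eq_square algebra_simps)
    then show "AE x in M. norm ((f x + g x)\<^sup>2) \<le> norm (2 * (f x)\<^sup>2 + 2 * (g x)\<^sup>2)"
      by (auto simp: abs_of_nonneg)
  qed
qed

lemma square_integrable_zero: "square_integrable M (\<lambda>x. 0)"
  by (simp add: square_integrable_def)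

lemma square_integrable_cmult: "square_integrable M f \<Longrightarrow> square_integrable M (\<lambda>x. c * f x)"
  by (auto simp: square_integrable_def power_mult_distrib)

lemma square_integrable_sum:
  "(\<And>i. i \<in> I \<Longrightarrow> square_integrable M (f i)) \<Longrightarrow> square_integrable M (\<lambda>x. \<Sum>i\<in>I. f i x)"
  by (induction I rule: infinite_finite_induct) (auto intro: square_integrable_add square_integrable_zero)

lemma square_integrable_coordinate_mult:
  assumes f: "square_integrable (sph_measure d) f" and i: "i < Suc d"
  shows "square_integrable (sph_measure d) (\<lambda>\<omega>. \<omega> i * f \<omega>)"
  unfolding square_integrable_def
proof
  have fm: "f \<in> borel_measurable (sph_measure d)" and int: "integrable (sph_measure d) (\<lambda>\<omega>. (f \<omega>)\<^sup>2)"
    using f by (auto simp: square_integrable_def)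
  show m: "(\<lambda>\<omega>. \<omega> i * f \<omega>) \<in> borel_measurable (sph_measure d)"
    by (intro borel_measurable_times fm continuous_on_sph_measurable continuous_on_coordinate)
  show "integrable (sph_measure d) (\<lambda>\<omega>. (\<omega> i * f \<omega>)\<^sup>2)"
  proof (rule Bochner_Integration.integrable_bound[OF int])
    show "(\<lambda>\<omega>. (\<omega> i * f \<omega>)\<^sup>2) \<in> borel_measurable (sph_measure d)" using m by simp
    show "AE \<omega> in sph_measure d. norm ((\<omega> i * f \<omega>)\<^sup>2) \<le> norm ((f \<omega>)\<^sup>2)"
    proof (rule AE_I2)
      fix \<omega> assume "\<omega> \<in> space (sph_measure d)"
      then have "(\<omega> i)\<^sup>2 \<le> 1" using Sph_coordinate_le[OF _ i] by (simp add: abs_square_le_1)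
      then show "norm ((\<omega> i * f \<omega>)\<^sup>2) \<le> norm ((f \<omega>)\<^sup>2)"
        by (simp add: power_mult_distrib mult_left_le_one_le)
    qed
  qed
qed

lemma square_integrable_scaled_proj:
  assumes nd: "Suc n \<le> d" and f: "square_integrable (leb n) f"
  shows "square_integrable (sph_measure d) (\<lambda>\<omega>. f (scaled_proj n d \<omega>))"
  using f nd integrable_scaled_proj[OF nd, of "\<lambda>y. (f y)\<^sup>2"]
    measurable_compose[OF scaled_proj_measurable, of n d f borel]
  by (simp add: square_integrable_def)

lemma square_integrable_integrable_cube:
  assumes "square_integrable (leb n) f"
  shows "integrable (leb n) (\<lambda>z. f z * indicator (cube n R) z)"
proof -
  have fm: "f \<in> borel_measurable (leb n)" and f2: "integrable (leb n) (\<lambda>z. (f z)\<^sup>2)"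
    using assms by (auto simp: square_integrable_def)
  have "integrable (leb n) (\<lambda>z. (f z)\<^sup>2 + indicator (cube n R \<inter> cube n R) z)"
    by (intro Bochner_Integration.integrable_add f2 integrable_indicator_cube cube_sets)
  then show ?thesis
  proof (rule Bochner_Integration.integrable_bound)
    show "(\<lambda>z. f z * indicator (cube n R) z) \<in> borel_measurable (leb n)"
      by (intro borel_measurable_times fm borel_measurable_indicator cube_sets)
    have "\<bar>x\<bar> \<le> x\<^sup>2 + 1" for x :: real
      using zero_le_power2[of "\<bar>x\<bar> - 1"] by (simp add: power2_eq_square algebra_simps) 
    then show "AE z in leb n. norm (f z * indicator (cube n R) z) \<le> norm ((f z)\<^sup>2 + indicator (cube n R \<inter> cube n R) z :: real)"
      by (intro AE_I2) (auto simp: indicator_def)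
  qed
qed

text \<open>L2 functions are made integrable without being changed where it matters: the image of
  the sphere has coordinates at most sqrt d in absolute value, and the kernels reach at most
  distance 1 in each coordinate.\<close>

definition cutoff :: "nat \<Rightarrow> nat \<Rightarrow> ((nat \<Rightarrow> real) \<Rightarrow> real) \<Rightarrow> (nat \<Rightarrow> real) \<Rightarrow> real" where
  "cutoff n d f z = f z * indicator (cube n (sqrt (real d) + 2)) z"

lemma integrable_cutoff: "square_integrable (leb n) f \<Longrightarrow> integrable (leb n) (cutoff n d f)"
  unfolding cutoff_def[abs_def] by (rule square_integrable_integrable_cube)

text \<open>The orthogonal projection onto the tangent space of the ambient gradient that the chain
  rule would give, whose first n components are \<open>sqrt (real d)\<close> times
  \<open>g\<close>.\<close>

definition lift_grad ::
  "nat \<Rightarrow> nat \<Rightarrow> ((nat \<Rightarrow> real) \<Rightarrow> nat \<Rightarrow> real) \<Rightarrow> (nat \<Rightarrow> real) \<Rightarrow> nat \<Rightarrow> real" where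
  "lift_grad n d g \<omega> j = sqrt (real d) * ((if j < n then g (scaled_proj n d \<omega>) j else 0)
     - \<omega> j * (\<Sum>i<n. \<omega> i * g (scaled_proj n d \<omega>) i))"

context
  fixes n d :: nat and \<omega> :: "nat \<Rightarrow> real" and g :: "(nat \<Rightarrow> real) \<Rightarrow> nat \<Rightarrow> real"
  assumes nd: "n \<le> d" and \<omega>: "\<omega> \<in> Sph d"
begin

lemma sum_lift_index: "(\<Sum>j<Suc d. X j * (if j < n then a j else 0)) = (\<Sum>j<n. X j * (a j :: real))"
  using nd by (intro sum.mono_neutral_cong_right) auto

lemma sum_Sph_sq: "(\<Sum>j<Suc d. \<omega> j * \<omega> j) = 1"
  using \<omega> by (simp add: Sph_iff power2_eq_square del: sum.lessThan_Suc)

text \<open>One formula for three uses: a tangent X loses the second term, X = omega yields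
  tangency, and X equal to the field itself starts the computation of its length.\<close>

lemma lift_grad_sum:
  "(\<Sum>j<Suc d. lift_grad n d g \<omega> j * X j) = sqrt (real d) * ((\<Sum>j<n. X j * g (scaled_proj n d \<omega>) j)
    - (\<Sum>j<Suc d. \<omega> j * X j) * (\<Sum>i<n. \<omega> i * g (scaled_proj n d \<omega>) i))"
proof -
  let ?a = "\<lambda>i. g (scaled_proj n d \<omega>) i" and ?s = "\<Sum>i<n. \<omega> i * g (scaled_proj n d \<omega>) i"
  have "(\<Sum>j<Suc d. lift_grad n d g \<omega> j * X j)
      = (\<Sum>j<Suc d. sqrt (real d) * (X j * (if j < n then ?a j else 0) - (\<omega> j * X j) * ?s))"
    by (intro sum.cong) (simp_all add: lift_grad_def algebra_simps)
  also have "\<dots> = sqrt (real d) * ((\<Sum>j<Suc d. X j * (if j < n then ?a j else 0)) - (\<Sum>j<Suc d. \<omega> j * X j) * ?s)"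
    by (simp only: sum_distrib_left[symmetric] sum_subtractf sum_distrib_right[symmetric])
  finally show ?thesis unfolding sum_lift_index .
qed

lemma lift_grad_tangent: "(\<Sum>j<Suc d. \<omega> j * lift_grad n d g \<omega> j) = 0"
  using lift_grad_sum[of \<omega>] sum_Sph_sq by (simp add: mult.commute del: sum.lessThan_Suc)

lemma lift_grad_norm:
  "(\<Sum>j<Suc d. (lift_grad n d g \<omega> j)\<^sup>2)
    = real d * ((\<Sum>i<n. (g (scaled_proj n d \<omega>) i)\<^sup>2) - (\<Sum>i<n. \<omega> i * g (scaled_proj n d \<omega>) i)\<^sup>2)"
proof -
  let ?a = "\<lambda>i. g (scaled_proj n d \<omega>) i" and ?s = "\<Sum>i<n. \<omega> i * g (scaled_proj n d \<omega>) i"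
  have "(\<Sum>j<Suc d. (lift_grad n d g \<omega> j)\<^sup>2) = sqrt (real d) * (\<Sum>j<n. lift_grad n d g \<omega> j * ?a j)"
    using lift_grad_sum[of "lift_grad n d g \<omega>"] lift_grad_tangent
    by (simp add: power2_eq_square del: sum.lessThan_Suc)
  also have "(\<Sum>j<n. lift_grad n d g \<omega> j * ?a j) = (\<Sum>j<n. sqrt (real d) * ((?a j)\<^sup>2 - \<omega> j * ?a j * ?s))"
    by (intro sum.cong) (simp_all add: lift_grad_def power2_eq_square algebra_simps)
  also have "\<dots> = sqrt (real d) * ((\<Sum>j<n. (?a j)\<^sup>2) - ?s * ?s)"
    by (simp only: sum_distrib_left[symmetric] sum_subtractf sum_distrib_right[symmetric])
  finally show ?thesis by (simp add: power2_eq_square)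
qed

end

lemma scaled_proj_cube:
  assumes "n \<le> d" "\<omega> \<in> Sph d" "i < n"
  shows "\<bar>scaled_proj n d \<omega> i\<bar> \<le> sqrt (real d)"
  using Sph_coordinate_le[OF assms(2), of i] assms
  by (simp add: scaled_proj_def abs_mult mult_left_le)

text \<open>Fubini freezes z and the divergence theorem moves the derivative from \<open>X\<close>
  to the kernel; Fubini then freezes the point of the sphere, and the weak gradient of
  \<open>v\<close> absorbs the derivative in z.\<close>

lemma mollified_weak_grad:
  assumes nd: "Suc n \<le> d" and v: "square_integrable (leb n) v" and g: "has_weak_grad n v g"
    and X: "sph_tangent_field d X" and e: "\<epsilon> > 0" "\<epsilon> \<le> 1"
  shows "(\<integral>\<omega>. sph_div d X \<omega> * mollify n \<epsilon> (cutoff n d v) (scaled_proj n d \<omega>) \<partial>sph_measure d)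
    = - (\<Sum>j<n. sqrt (real d) *
        (\<integral>\<omega>. X \<omega> j * mollify n \<epsilon> (cutoff n d (\<lambda>z. g z j)) (scaled_proj n d \<omega>) \<partial>sph_measure d))"
proof -
  let ?M = "sph_measure d" and ?Y = "scaled_proj n d" and ?m = "kern_mass n \<epsilon>"
  have n: "n \<le> d" using nd by simp
  have cv: "integrable (leb n) (cutoff n d v)" by (rule integrable_cutoff[OF v])
  have smX: "smooth (Suc d) (\<lambda>x. X x j)" if "j < n" for j
    using X that nd by (simp add: sph_tangent_field_def)
  obtain B where B: "B \<ge> 0" "\<And>x. x \<in> Sph d \<Longrightarrow> \<bar>sph_div d X x\<bar> \<le> B"
    using bounded_on_Sph[OF continuous_on_sph_div[OF X]] by metis
  obtain C where C: "C \<ge> 0" "\<And>j y z. \<bar>dkern n \<epsilon> j y z\<bar> \<le> C" using dkern_bounded by metis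
  have out: "\<exists>i<n. \<epsilon> \<le> \<bar>?Y \<omega> i - z i\<bar>" if out: "\<omega> \<in> Sph d" "z \<in> Rn n" "z \<notin> cube n (sqrt (real d) + 2)" for \<omega> z
  proof -
    obtain i where i: "i < n" "sqrt (real d) + 2 \<le> \<bar>z i\<bar>"
      using out(3) mem_cube[OF out(2)] by (auto simp: not_less)
    with scaled_proj_cube[OF n out(1) i(1)] e have "\<epsilon> \<le> \<bar>?Y \<omega> i - z i\<bar>" by linarith
    with i show ?thesis by blast
  qed
  \<comment> \<open>A point z outside the cube differs from the image of the sphere by at least 2 in
    some coordinate, so kernel and derivative vanish there.\<close>
  have ck: "cutoff n d f z * kern n \<epsilon> (?Y \<omega>) z = f z * kern n \<epsilon> (?Y \<omega>) z"
    "cutoff n d f z * dkern n \<epsilon> j (?Y \<omega>) z = f z * dkern n \<epsilon> j (?Y \<omega>) z"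
    if "\<omega> \<in> Sph d" "z \<in> Rn n" for f \<omega> z j
    using out[OF that] kern_zero[of _ n \<epsilon> "?Y \<omega>" z] dkern_zero[of _ n \<epsilon> "?Y \<omega>" z j]
    by (cases "z \<in> cube n (sqrt (real d) + 2)"; force simp: cutoff_def)+
  have divm: "(\<lambda>p. sph_div d X (fst p)) \<in> borel_measurable (?M \<Otimes>\<^sub>M leb n)"
    by (rule measurable_compose[OF measurable_fst continuous_on_sph_measurable[OF continuous_on_sph_div[OF X]]])
  have Xm: "(\<lambda>p. X (fst p) j) \<in> borel_measurable (?M \<Otimes>\<^sub>M leb n)" if "j < n" for j
    by (rule measurable_compose[OF measurable_fst continuous_on_sph_measurable[OF smooth_continuous[OF smX[OF that]]]])
  have pull: "(\<integral>z. h z * (k z * s) \<partial>leb n) = s * (\<integral>z. h z * k z \<partial>leb n)" for h k :: "_ \<Rightarrow> real" and s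
    by (subst integral_mult_right_zero[symmetric]) (simp only: mult_ac)
  have "(\<integral>\<omega>. sph_div d X \<omega> * (\<integral>z. cutoff n d v z * kern n \<epsilon> (?Y \<omega>) z \<partial>leb n) \<partial>?M)
      = (\<integral>\<omega>. (\<integral>z. cutoff n d v z * (kern n \<epsilon> (?Y \<omega>) z * sph_div d X \<omega>) \<partial>leb n) \<partial>?M)"
    by (simp only: pull)
  also have "\<dots> = (\<integral>z. cutoff n d v z * (\<integral>\<omega>. kern n \<epsilon> (?Y \<omega>) z * sph_div d X \<omega> \<partial>?M) \<partial>leb n)"
  proof (rule Fubini_sph(2)[OF cv, where k="\<lambda>\<omega> z. kern n \<epsilon> (?Y \<omega>) z * sph_div d X \<omega>"])
    show "(\<lambda>p. kern n \<epsilon> (?Y (fst p)) (snd p) * sph_div d X (fst p)) \<in> borel_measurable (?M \<Otimes>\<^sub>M leb n)"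
      by (intro borel_measurable_times measurable_kern_pair(1)[OF n] divm)
    show "\<bar>kern n \<epsilon> (?Y \<omega>) z * sph_div d X \<omega>\<bar> \<le> 1 * B" if "\<omega> \<in> Sph d" for \<omega> z
      unfolding abs_mult using kern_bounds[of n \<epsilon> "?Y \<omega>" z] B that by (intro mult_mono) auto
  qed
  also have "\<dots> = (\<integral>z. (\<Sum>j<n. - sqrt (real d) * (cutoff n d v z * (\<integral>\<omega>. dkern n \<epsilon> j (?Y \<omega>) z * X \<omega> j \<partial>?M))) \<partial>leb n)"
  proof (rule Bochner_Integration.integral_cong[OF refl])
    fix z assume z: "z \<in> space (leb n)"
    have int: "integrable ?M (\<lambda>\<omega>. sqrt (real d) * dkern n \<epsilon> j (?Y \<omega>) z * X \<omega> j)" if j: "j < n" for j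
    proof -
      have "(\<lambda>\<omega>. dkern n \<epsilon> j (?Y \<omega>) z) \<in> borel_measurable ?M"
        using measurable_compose[OF measurable_Pair2'[OF z] measurable_kern_pair(2)[OF n j]] by simp
      then have "integrable ?M (\<lambda>\<omega>. dkern n \<epsilon> j (?Y \<omega>) z)"
        by (rule integrable_sph_bounded) (rule C(2))
      from integrable_sph_mult_bounded[OF this smooth_continuous[OF smX[OF j]]]
      have "integrable ?M (\<lambda>\<omega>. sqrt (real d) * (X \<omega> j * dkern n \<epsilon> j (?Y \<omega>) z))" by simp
      then show ?thesis by (simp add: mult_ac)
    qed
    have "(\<integral>\<omega>. kern n \<epsilon> (?Y \<omega>) z * sph_div d X \<omega> \<partial>?M)
        = - (\<Sum>j<n. \<integral>\<omega>. sqrt (real d) * dkern n \<epsilon> j (?Y \<omega>) z * X \<omega> j \<partial>?M)"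
      unfolding sphere_divergence_kern[OF n X] using int by (subst Bochner_Integration.integral_sum) auto
    also have "\<dots> = - (\<Sum>j<n. sqrt (real d) * (\<integral>\<omega>. dkern n \<epsilon> j (?Y \<omega>) z * X \<omega> j \<partial>?M))"
      by (simp add: mult.assoc)
    finally show "cutoff n d v z * (\<integral>\<omega>. kern n \<epsilon> (?Y \<omega>) z * sph_div d X \<omega> \<partial>?M)
        = (\<Sum>j<n. - sqrt (real d) * (cutoff n d v z * (\<integral>\<omega>. dkern n \<epsilon> j (?Y \<omega>) z * X \<omega> j \<partial>?M)))"
      by (simp add: sum_distrib_left sum_negf mult_ac)
  qed
  also have "\<dots> = (\<Sum>j<n. - sqrt (real d) * (\<integral>z. cutoff n d v z * (\<integral>\<omega>. dkern n \<epsilon> j (?Y \<omega>) z * X \<omega> j \<partial>?M) \<partial>leb n))"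
  proof -
    interpret pair_sigma_finite ?M "leb n" by (rule pair_sigma_finite_sph)
    have "integrable (leb n) (\<lambda>z. cutoff n d v z * (\<integral>\<omega>. dkern n \<epsilon> j (?Y \<omega>) z * X \<omega> j \<partial>?M))" if j: "j < n" for j
    proof -
      obtain D where D: "D \<ge> 0" "\<And>x. x \<in> Sph d \<Longrightarrow> \<bar>X x j\<bar> \<le> D"
        using bounded_on_Sph[OF smooth_continuous[OF smX[OF j]]] by metis
      have "integrable (?M \<Otimes>\<^sub>M leb n) (\<lambda>p. cutoff n d v (snd p) * (dkern n \<epsilon> j (?Y (fst p)) (snd p) * X (fst p) j))"
      proof (rule integrable_pair_sph[OF cv])
        show "(\<lambda>p. dkern n \<epsilon> j (?Y (fst p)) (snd p) * X (fst p) j) \<in> borel_measurable (?M \<Otimes>\<^sub>M leb n)"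
          by (intro borel_measurable_times measurable_kern_pair(2)[OF n j] Xm[OF j])
        show "\<bar>dkern n \<epsilon> j (?Y (fst (\<omega>, z))) (snd (\<omega>, z)) * X (fst (\<omega>, z)) j\<bar> \<le> C * D" if "\<omega> \<in> Sph d" for \<omega> z
          unfolding abs_mult using C D that by (intro mult_mono) auto
      qed
      then have "integrable (?M \<Otimes>\<^sub>M leb n) (\<lambda>(\<omega>, z). cutoff n d v z * (dkern n \<epsilon> j (?Y \<omega>) z * X \<omega> j))"
        by (simp add: case_prod_unfold)
      from integrable_snd[OF this] show ?thesis by simp
    qed
    then show ?thesis by (subst Bochner_Integration.integral_sum) auto
  qed
  also have "\<dots> = (\<Sum>j<n. - sqrt (real d) * (\<integral>\<omega>. X \<omega> j * (\<integral>z. cutoff n d (\<lambda>z. g z j) z * kern n \<epsilon> (?Y \<omega>) z \<partial>leb n) \<partial>?M))"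
  proof (rule sum.cong[OF refl])
    fix j assume "j \<in> {..<n}"
    then have j: "j < n" by simp
    obtain D where D: "D \<ge> 0" "\<And>x. x \<in> Sph d \<Longrightarrow> \<bar>X x j\<bar> \<le> D"
      using bounded_on_Sph[OF smooth_continuous[OF smX[OF j]]] by metis
    have "(\<integral>z. cutoff n d v z * (\<integral>\<omega>. dkern n \<epsilon> j (?Y \<omega>) z * X \<omega> j \<partial>?M) \<partial>leb n)
        = (\<integral>\<omega>. (\<integral>z. cutoff n d v z * (dkern n \<epsilon> j (?Y \<omega>) z * X \<omega> j) \<partial>leb n) \<partial>?M)"
    proof (rule Fubini_sph(2)[OF cv, where k="\<lambda>\<omega> z. dkern n \<epsilon> j (?Y \<omega>) z * X \<omega> j", symmetric])
      show "(\<lambda>p. dkern n \<epsilon> j (?Y (fst p)) (snd p) * X (fst p) j) \<in> borel_measurable (?M \<Otimes>\<^sub>M leb n)"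
        by (intro borel_measurable_times measurable_kern_pair(2)[OF n j] Xm[OF j])
      show "\<bar>dkern n \<epsilon> j (?Y \<omega>) z * X \<omega> j\<bar> \<le> C * D" if "\<omega> \<in> Sph d" for \<omega> z
        unfolding abs_mult using C D that by (intro mult_mono) auto
    qed
    also have "\<dots> = (\<integral>\<omega>. X \<omega> j * (\<integral>z. cutoff n d (\<lambda>z. g z j) z * kern n \<epsilon> (?Y \<omega>) z \<partial>leb n) \<partial>?M)"
    proof (rule Bochner_Integration.integral_cong[OF refl])
      fix \<omega> assume "\<omega> \<in> space ?M"
      then have \<omega>: "\<omega> \<in> Sph d" by simp
      have "(\<integral>z. cutoff n d v z * (dkern n \<epsilon> j (?Y \<omega>) z * X \<omega> j) \<partial>leb n) = X \<omega> j * (\<integral>z. cutoff n d v z * dkern n \<epsilon> j (?Y \<omega>) z \<partial>leb n)"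
        by (simp only: pull)
      \<comment> \<open>The cutoff is dropped before the weak gradient is used and restored
        afterwards: truncation may create jumps, so the truncated \<open>g\<close> need not be the
        gradient of the truncated \<open>v\<close>.\<close>
      also have "(\<integral>z. cutoff n d v z * dkern n \<epsilon> j (?Y \<omega>) z \<partial>leb n) = (\<integral>z. v z * dkern n \<epsilon> j (?Y \<omega>) z \<partial>leb n)"
        by (intro Bochner_Integration.integral_cong ck(2)[OF \<omega>]) (auto simp: space_leb)
      also have "\<dots> = (\<integral>z. g z j * kern n \<epsilon> (?Y \<omega>) z \<partial>leb n)"
        by (rule weak_grad_kern[OF g j])
      also have "\<dots> = (\<integral>z. cutoff n d (\<lambda>z. g z j) z * kern n \<epsilon> (?Y \<omega>) z \<partial>leb n)"
        by (intro Bochner_Integration.integral_cong ck(1)[OF \<omega>, symmetric]) (auto simp: space_leb)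
      finally show "(\<integral>z. cutoff n d v z * (dkern n \<epsilon> j (?Y \<omega>) z * X \<omega> j) \<partial>leb n)
        = X \<omega> j * (\<integral>z. cutoff n d (\<lambda>z. g z j) z * kern n \<epsilon> (?Y \<omega>) z \<partial>leb n)" .
    qed
    finally show "- sqrt (real d) * (\<integral>z. cutoff n d v z * (\<integral>\<omega>. dkern n \<epsilon> j (?Y \<omega>) z * X \<omega> j \<partial>?M) \<partial>leb n)
      = - sqrt (real d) * (\<integral>\<omega>. X \<omega> j * (\<integral>z. cutoff n d (\<lambda>z. g z j) z * kern n \<epsilon> (?Y \<omega>) z \<partial>leb n) \<partial>?M)" by simp
  qed
  finally have main: "(\<integral>\<omega>. sph_div d X \<omega> * (\<integral>z. cutoff n d v z * kern n \<epsilon> (?Y \<omega>) z \<partial>leb n) \<partial>?M)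
    = (\<Sum>j<n. - sqrt (real d) * (\<integral>\<omega>. X \<omega> j * (\<integral>z. cutoff n d (\<lambda>z. g z j) z * kern n \<epsilon> (?Y \<omega>) z \<partial>leb n) \<partial>?M))" .
  have norm: "(\<integral>\<omega>. F \<omega> * mollify n \<epsilon> f (?Y \<omega>) \<partial>?M)
      = (\<integral>\<omega>. F \<omega> * (\<integral>z. f z * kern n \<epsilon> (?Y \<omega>) z \<partial>leb n) \<partial>?M) / ?m" for F f
    by (simp only: mollify_def times_divide_eq_right integral_divide_zero)
  show ?thesis
    unfolding norm main by (simp only: sum_divide_distrib sum_negf[symmetric] mult_minus_left minus_divide_left times_divide_eq_right)
qed

text \<open>In the identity for mollifications each side integrates mollified L1 functions against
  functions continuous on the ambient space, so both sides converge as epsilon tends to 0. On the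
  image of the sphere the cutoff is invisible.\<close>

lemma has_weak_sph_grad_lift:
  assumes nd: "Suc n \<le> d" and v: "square_integrable (leb n) v" and g: "has_weak_grad n v g"
  shows "has_weak_sph_grad d (sph_lift n v d) (lift_grad n d g)"
  unfolding has_weak_sph_grad_def
proof (intro conjI allI impI)
  let ?M = "sph_measure d" and ?Y = "scaled_proj n d"
  have n: "n \<le> d" using nd by simp
  have gi: "square_integrable (leb n) (\<lambda>z. g z i)" if "i < n" for i
    using g that by (simp add: has_weak_grad_def)
  have gY: "square_integrable ?M (\<lambda>\<omega>. g (?Y \<omega>) i)" if "i < n" for i
    by (rule square_integrable_scaled_proj[OF nd gi[OF that]])
  show "square_integrable ?M (\<lambda>\<omega>. lift_grad n d g \<omega> j)" if j: "j < Suc d" for j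
  proof -
    have 1: "square_integrable ?M (\<lambda>\<omega>. if j < n then g (?Y \<omega>) j else 0)"
      using gY by (cases "j < n") (auto intro: square_integrable_zero)
    have 2: "square_integrable ?M (\<lambda>\<omega>. \<Sum>i<n. \<omega> i * g (?Y \<omega>) i)"
      using n by (intro square_integrable_sum square_integrable_coordinate_mult gY) auto
    have "square_integrable ?M (\<lambda>\<omega>. sqrt (real d) * ((if j < n then g (?Y \<omega>) j else 0)
        + (-1) * (\<omega> j * (\<Sum>i<n. \<omega> i * g (?Y \<omega>) i))))"
      by (intro square_integrable_cmult square_integrable_add 1 square_integrable_coordinate_mult 2 j)
    then show ?thesis by (simp add: lift_grad_def)
  qed
  show "AE \<omega> in ?M. (\<Sum>j<Suc d. \<omega> j * lift_grad n d g \<omega> j) = 0"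
    using lift_grad_tangent[OF n] by (intro AE_I2) simp
  fix X assume X: "sph_tangent_field d X"
  have smX: "smooth (Suc d) (\<lambda>x. X x j)" if "j < n" for j
    using X that nd by (simp add: sph_tangent_field_def)
  have cutY: "cutoff n d f (?Y \<omega>) = f (?Y \<omega>)" if "\<omega> \<in> Sph d" for f \<omega>
  proof -
    have "\<bar>?Y \<omega> i\<bar> < sqrt (real d) + 2" if "i < n" for i
      using scaled_proj_cube[OF n \<open>\<omega> \<in> Sph d\<close> that] by linarith
    then have "?Y \<omega> \<in> cube n (sqrt (real d) + 2)" by (simp add: mem_cube)
    then show ?thesis by (simp add: cutoff_def)
  qed
  have cv: "integrable (leb n) (cutoff n d v)" by (rule integrable_cutoff[OF v])
  have cg: "integrable (leb n) (cutoff n d (\<lambda>z. g z j))" if "j < n" for j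
    by (rule integrable_cutoff[OF gi[OF that]])
  let ?e = "\<lambda>k. inverse (real (Suc k))"
  have e: "?e k > 0" "?e k \<le> 1" for k by (auto simp: field_simps)
  have "(\<lambda>k. \<integral>\<omega>. sph_div d X \<omega> * mollify n (?e k) (cutoff n d v) (?Y \<omega>) \<partial>?M)
      \<longlonglongrightarrow> (\<integral>\<omega>. sph_div d X \<omega> * cutoff n d v (?Y \<omega>) \<partial>?M)"
    by (rule mollify_tendsto[OF nd cv continuous_on_sph_div[OF X]])
  moreover have "(\<lambda>k. \<integral>\<omega>. sph_div d X \<omega> * mollify n (?e k) (cutoff n d v) (?Y \<omega>) \<partial>?M)
      \<longlonglongrightarrow> - (\<Sum>j<n. sqrt (real d) * (\<integral>\<omega>. X \<omega> j * cutoff n d (\<lambda>z. g z j) (?Y \<omega>) \<partial>?M))"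
    unfolding mollified_weak_grad[OF nd v g X e]
    by (intro tendsto_minus tendsto_sum tendsto_mult tendsto_const mollify_tendsto[OF nd cg]
        smooth_continuous smX) auto
  ultimately have eq: "(\<integral>\<omega>. sph_div d X \<omega> * cutoff n d v (?Y \<omega>) \<partial>?M)
      = - (\<Sum>j<n. sqrt (real d) * (\<integral>\<omega>. X \<omega> j * cutoff n d (\<lambda>z. g z j) (?Y \<omega>) \<partial>?M))"
    by (rule LIMSEQ_unique)
  have "(\<integral>\<omega>. sph_lift n v d \<omega> * sph_div d X \<omega> \<partial>?M) = (\<integral>\<omega>. sph_div d X \<omega> * cutoff n d v (?Y \<omega>) \<partial>?M)"
    by (intro Bochner_Integration.integral_cong) (auto simp: cutY sph_lift_eq)
  also note eq
  also have "(\<Sum>j<n. sqrt (real d) * (\<integral>\<omega>. X \<omega> j * cutoff n d (\<lambda>z. g z j) (?Y \<omega>) \<partial>?M))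
      = (\<integral>\<omega>. (\<Sum>j<n. sqrt (real d) * (X \<omega> j * cutoff n d (\<lambda>z. g z j) (?Y \<omega>))) \<partial>?M)"
  proof -
    have "integrable ?M (\<lambda>\<omega>. sqrt (real d) * (X \<omega> j * cutoff n d (\<lambda>z. g z j) (?Y \<omega>)))" if "j < n" for j
      using that by (intro integrable_mult_right integrable_sph_mult_bounded integrable_scaled_proj[OF nd cg]
          smooth_continuous smX)
    then show ?thesis by (subst Bochner_Integration.integral_sum) auto
  qed
  also have "\<dots> = (\<integral>\<omega>. (\<Sum>j<Suc d. lift_grad n d g \<omega> j * X \<omega> j) \<partial>?M)"
  proof (rule Bochner_Integration.integral_cong[OF refl])
    fix \<omega> assume "\<omega> \<in> space ?M"
    then have \<omega>: "\<omega> \<in> Sph d" by simp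
    \<comment> \<open>Tangency of \<open>X\<close> hides the radial part of
      \<open>lift_grad\<close>, so it may be inserted into the pairing without changing the
      integral.\<close>
    have "(\<Sum>j<Suc d. \<omega> j * X \<omega> j) = 0" using X \<omega> by (simp add: sph_tangent_field_def)
    then show "(\<Sum>j<n. sqrt (real d) * (X \<omega> j * cutoff n d (\<lambda>z. g z j) (?Y \<omega>))) = (\<Sum>j<Suc d. lift_grad n d g \<omega> j * X \<omega> j)"
      unfolding lift_grad_sum[OF n \<omega>] using cutY[OF \<omega>] by (simp add: sum_distrib_left)
  qed
  finally show "(\<integral>\<omega>. sph_lift n v d \<omega> * sph_div d X \<omega> \<partial>?M)
    = - (\<integral>\<omega>. (\<Sum>j<Suc d. lift_grad n d g \<omega> j * X \<omega> j) \<partial>?M)" .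
qed

section \<open>The Gaussian limit\<close>

lemma integrable_exp_sq:
  assumes "c > 0" shows "integrable lborel (\<lambda>x::real. exp (- c * x\<^sup>2))"
proof -
  \<comment> \<open>The deviation with 1 / (2 sigma^2) = c, for which the function is a multiple of
    a normal density.\<close>
  define \<sigma> where "\<sigma> = sqrt (1 / (2 * c))"
  have \<sigma>: "\<sigma> > 0" "\<sigma>\<^sup>2 = 1 / (2 * c)" using assms by (auto simp: \<sigma>_def)
  have "integrable lborel (\<lambda>x. sqrt (2 * pi * \<sigma>\<^sup>2) * normal_density 0 \<sigma> x)"
    using \<sigma>(1) by (intro integrable_mult_right integrable_normal_density)
  also have "(\<lambda>x. sqrt (2 * pi * \<sigma>\<^sup>2) * normal_density 0 \<sigma> x) = (\<lambda>x. exp (- c * x\<^sup>2))"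
    using assms by (auto simp: normal_density_def \<sigma>(2) fun_eq_iff)
  finally show ?thesis .
qed

lemma exp_sum_sq_eq_prod:
  fixes n :: nat
  shows "exp (- c * (\<Sum>i<n. (y i)\<^sup>2)) = (\<Prod>i<n. exp (- c * (y i)\<^sup>2) :: real)"
  by (simp only: sum_distrib_left exp_sum[OF finite_lessThan])

lemma integrable_exp_sum_sq:
  "c > 0 \<Longrightarrow> integrable (leb n) (\<lambda>y. exp (- c * (\<Sum>i<n. (y i)\<^sup>2)) :: real)"
  unfolding leb_def exp_sum_sq_eq_prod
  by (intro lborel_prod.product_integrable_prod[of "{..<n}" "\<lambda>_ t. exp (- c * t\<^sup>2)"] integrable_exp_sq) auto

lemma integral_exp_sum_sq:
  "(\<integral>y. exp (- (1/2) * (\<Sum>i<n. (y i)\<^sup>2)) \<partial>leb n) = (2 * pi) powr (real n / 2)"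
proof -
  have "(\<integral>x. exp (- (1/2) * x\<^sup>2) \<partial>lborel) = (\<integral>x. sqrt (2 * pi) * std_normal_density x \<partial>lborel)"
    by (simp add: std_normal_density_def)
  also have "\<dots> = sqrt (2 * pi)" by simp
  finally have 1: "(\<integral>x. exp (- (1/2) * x\<^sup>2) \<partial>lborel) = sqrt (2 * pi)" .
  have "(\<integral>y. exp (- (1/2) * (\<Sum>i<n. (y i)\<^sup>2)) \<partial>leb n) = (\<Prod>i<n. \<integral>x. exp (- (1/2) * x\<^sup>2) \<partial>lborel)"
    unfolding leb_def exp_sum_sq_eq_prod
    by (intro lborel_prod.product_integral_prod[of "{..<n}" "\<lambda>_ t. exp (- (1/2) * t\<^sup>2)"] integrable_exp_sq) auto
  also have "\<dots> = sqrt (2 * pi) ^ n" unfolding 1 by simp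
  also have "\<dots> = (2 * pi) powr (real n / 2)"
    by (simp add: powr_half_sqrt[symmetric] powr_powr powr_realpow[symmetric] del: powr_half_sqrt)
  finally show ?thesis .
qed

lemma integral_gauss:
  assumes f: "f \<in> borel_measurable (leb n)"
  shows "(\<integral>y. f y \<partial>gauss n) = (\<integral>y. exp (- (1/2) * (\<Sum>i<n. (y i)\<^sup>2)) * f y \<partial>leb n) / (2 * pi) powr (real n / 2)"
proof -
  let ?w = "\<lambda>y. (2 * pi) powr (- (real n / 2)) * exp (- (L2_set y {..<n})\<^sup>2 / 2)"
  have "(\<lambda>y. (L2_set y {..<n})\<^sup>2) \<in> borel_measurable (leb n)"
    unfolding L2_set_lessThan_sq by (rule measurable_sum_sq)
  then have wm: "?w \<in> borel_measurable (leb n)" by measurable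
  have "(\<integral>y. f y \<partial>gauss n) = (\<integral>y. ?w y *\<^sub>R f y \<partial>leb n)"
    unfolding gauss_def by (rule integral_density[OF f wm]) simp
  also have "\<dots> = (\<integral>y. (exp (- (1/2) * (\<Sum>i<n. (y i)\<^sup>2)) * f y) / (2 * pi) powr (real n / 2) \<partial>leb n)"
  proof (rule Bochner_Integration.integral_cong[OF refl])
    fix y :: "nat \<Rightarrow> real"
    have "?w y = exp (- (1/2) * (\<Sum>i<n. (y i)\<^sup>2)) / (2 * pi) powr (real n / 2)"
      by (simp add: L2_set_lessThan_sq powr_minus_divide)
    then show "?w y *\<^sub>R f y = exp (- (1/2) * (\<Sum>i<n. (y i)\<^sup>2)) * f y / (2 * pi) powr (real n / 2)"
      by (simp only: real_scaleR_def times_divide_eq_left)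
  qed
  finally show ?thesis by (simp only: integral_divide_zero)
qed

text \<open>The exponent splits as d/2 - (n + 1)/2. The first part gives the square root of (1 -
  s/d)^d, which tends to exp (-s); the second is a fixed power of a base tending to 1. The base is
  eventually positive, so \<open>max\<close> drops out.\<close>

lemma sph_weight_tendsto: "(\<lambda>d. sph_weight n d y) \<longlonglongrightarrow> exp (- (1/2) * (\<Sum>i<n. (y i)\<^sup>2))"
proof -
  define s where "s = (\<Sum>i<n. (y i)\<^sup>2)"
  have inv: "(\<lambda>d. s / real d) \<longlonglongrightarrow> 0" by (rule lim_const_over_n)
  then have one: "(\<lambda>d. 1 - s / real d) \<longlonglongrightarrow> 1" using tendsto_diff[OF tendsto_const[of 1] inv] by simp
  have "((\<lambda>x. (1 + (- s) / x) powr x) \<longlongrightarrow> exp (- s)) at_top" by (rule tendsto_exp_limit_at_top)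
  from filterlim_compose[OF this filterlim_real_sequentially]
  have "(\<lambda>d. (1 - s / real d) powr real d) \<longlonglongrightarrow> exp (- s)" by simp
  then have "(\<lambda>d. ((1 - s / real d) powr real d) powr (1/2) * (1 - s / real d) powr (- (real n + 1) / 2))
      \<longlonglongrightarrow> exp (- s) powr (1/2) * 1 powr (- (real n + 1) / 2)"
    by (intro tendsto_mult tendsto_powr tendsto_const one) auto
  also have "exp (- s) powr (1/2) * 1 powr (- (real n + 1) / 2) = exp (- (1/2) * s)"
    by (simp add: powr_def)
  finally have lim: "(\<lambda>d. ((1 - s / real d) powr real d) powr (1/2) * (1 - s / real d) powr (- (real n + 1) / 2))
      \<longlonglongrightarrow> exp (- (1/2) * s)" .
  have "\<forall>\<^sub>F d in sequentially. 0 < 1 - s / real d"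
    using order_tendstoD(1)[OF one, of 0] by simp
  then have "\<forall>\<^sub>F d in sequentially. ((1 - s / real d) powr real d) powr (1/2) * (1 - s / real d) powr (- (real n + 1) / 2)
      = sph_weight n d y"
  proof eventually_elim
    case (elim d)
    have "((1 - s / real d) powr real d) powr (1/2) * (1 - s / real d) powr (- (real n + 1) / 2)
        = (1 - s / real d) powr ((real d - real n - 1) / 2)"
      by (simp add: powr_powr powr_add[symmetric] field_simps)
    also have "\<dots> = sph_weight n d y"
      using elim by (simp add: sph_weight_def s_def[symmetric] max_def)
    finally show ?case .
  qed
  with lim show ?thesis unfolding s_def[symmetric] by (rule Lim_transform_eventually)
qed

text \<open>The hypothesis on d makes the exponent at least d/4, and 1 - t <= exp (-t) at t = s/d
  turns this into the rate 1/4.\<close>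

lemma sph_weight_le:
  assumes "2 * Suc n \<le> d"
  shows "sph_weight n d y \<le> exp (- (1/4) * (\<Sum>i<n. (y i)\<^sup>2))"
proof -
  define s where "s = (\<Sum>i<n. (y i)\<^sup>2)"
  have s: "s \<ge> 0" by (simp add: s_def sum_nonneg)
  have d: "real d > 0" and a: "real d / 4 \<le> (real d - real n - 1) / 2" using assms by auto
  have "sph_weight n d y \<le> (exp (- (s / real d))) powr ((real d - real n - 1) / 2)"
    unfolding sph_weight_def s_def[symmetric]
  proof (rule powr_mono2)
    show "0 \<le> (real d - real n - 1) / 2" using a d by linarith
    show "max 0 (1 - s / real d) \<le> exp (- (s / real d))"
      using exp_ge_add_one_self[of "- (s / real d)"] by simp
  qed simp
  also have "\<dots> = exp (- (s / real d * ((real d - real n - 1) / 2)))"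
    by (simp add: powr_def mult.commute)
  also have "\<dots> \<le> exp (- (s / real d * (real d / 4)))"
    using mult_left_mono[OF a, of "s / real d"] s d by simp
  also have "s / real d * (real d / 4) = (1/4) * s" using d by simp
  finally show ?thesis by (simp add: s_def)
qed

lemma integral_sph_weight_tendsto:
  assumes f: "f \<in> borel_measurable (leb n)"
    and int: "integrable (leb n) (\<lambda>y. exp (- (1/4) * (\<Sum>i<n. (y i)\<^sup>2)) * f y)"
  shows "(\<lambda>d. \<integral>y. sph_weight n d y * f y \<partial>leb n) \<longlonglongrightarrow> (\<integral>y. exp (- (1/2) * (\<Sum>i<n. (y i)\<^sup>2)) * f y \<partial>leb n)"
proof (rule LIMSEQ_offset)
  \<comment> \<open>The Gaussian majorant holds from this d on, so the earlier terms are
    skipped.\<close>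
  let ?N = "2 * Suc n"
  show "(\<lambda>k. \<integral>y. sph_weight n (k + ?N) y * f y \<partial>leb n) \<longlonglongrightarrow> (\<integral>y. exp (- (1/2) * (\<Sum>i<n. (y i)\<^sup>2)) * f y \<partial>leb n)"
  proof (rule integral_dominated_convergence[where w="\<lambda>y. \<bar>exp (- (1/4) * (\<Sum>i<n. (y i)\<^sup>2)) * f y\<bar>"])
    show "(\<lambda>y. exp (- (1/2) * (\<Sum>i<n. (y i)\<^sup>2)) * f y) \<in> borel_measurable (leb n)"
      by (intro borel_measurable_times f borel_measurable_integrable[OF integrable_exp_sum_sq]) simp
    show "(\<lambda>y. sph_weight n (k + ?N) y * f y) \<in> borel_measurable (leb n)" for k
      by (intro borel_measurable_times f sph_weight_measurable)
    show "integrable (leb n) (\<lambda>y. \<bar>exp (- (1/4) * (\<Sum>i<n. (y i)\<^sup>2)) * f y\<bar>)"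
      by (rule integrable_abs[OF int])
    show "AE y in leb n. (\<lambda>k. sph_weight n (k + ?N) y * f y) \<longlonglongrightarrow> exp (- (1/2) * (\<Sum>i<n. (y i)\<^sup>2)) * f y"
      by (intro AE_I2 tendsto_mult tendsto_const LIMSEQ_ignore_initial_segment sph_weight_tendsto)
    show "AE y in leb n. norm (sph_weight n (k + ?N) y * f y) \<le> \<bar>exp (- (1/4) * (\<Sum>i<n. (y i)\<^sup>2)) * f y\<bar>" for k
    proof (rule AE_I2)
      fix y
      have "sph_weight n (k + ?N) y \<le> exp (- (1/4) * (\<Sum>i<n. (y i)\<^sup>2))" by (rule sph_weight_le) simp
      then have "sph_weight n (k + ?N) y * \<bar>f y\<bar> \<le> exp (- (1/4) * (\<Sum>i<n. (y i)\<^sup>2)) * \<bar>f y\<bar>"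
        by (rule mult_right_mono) simp
      then show "norm (sph_weight n (k + ?N) y * f y) \<le> \<bar>exp (- (1/4) * (\<Sum>i<n. (y i)\<^sup>2)) * f y\<bar>"
        by (simp only: real_norm_def abs_mult abs_of_nonneg[OF sph_weight_bounds(1)] abs_exp_cancel)
    qed
  qed
qed

text \<open>Numerator and normalising denominator converge separately. The denominator is the case f
  = 1, and its limit is the normalisation of the Gaussian.\<close>

lemma integral_scaled_proj_tendsto:
  assumes f: "f \<in> borel_measurable (leb n)"
    and int: "integrable (leb n) (\<lambda>y. exp (- (1/4) * (\<Sum>i<n. (y i)\<^sup>2)) * f y)"
  shows "(\<lambda>d. \<integral>\<omega>. f (scaled_proj n d \<omega>) \<partial>sph_measure d) \<longlonglongrightarrow> (\<integral>y. f y \<partial>gauss n)"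
proof -
  have "(\<lambda>d. \<integral>y. sph_weight n d y * 1 \<partial>leb n) \<longlonglongrightarrow> (\<integral>y. exp (- (1/2) * (\<Sum>i<n. (y i)\<^sup>2)) * 1 \<partial>leb n)"
    by (rule integral_sph_weight_tendsto) (use integrable_exp_sum_sq[of "1/4" n] in simp_all)
  then have "(\<lambda>d. \<integral>y. sph_weight n d y \<partial>leb n) \<longlonglongrightarrow> (2 * pi) powr (real n / 2)"
    by (simp only: mult_1_right integral_exp_sum_sq)
  from tendsto_divide[OF integral_sph_weight_tendsto[OF f int] this]
  have lim: "(\<lambda>d. (\<integral>y. sph_weight n d y * f y \<partial>leb n) / (\<integral>y. sph_weight n d y \<partial>leb n)) \<longlonglongrightarrow> (\<integral>y. f y \<partial>gauss n)"
    unfolding integral_gauss[OF f] by simp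
  have "\<forall>\<^sub>F d in sequentially. (\<integral>y. sph_weight n d y * f y \<partial>leb n) / (\<integral>y. sph_weight n d y \<partial>leb n)
      = (\<integral>\<omega>. f (scaled_proj n d \<omega>) \<partial>sph_measure d)"
    using eventually_ge_at_top[of "Suc n"] by eventually_elim (simp add: integral_scaled_proj f)
  with lim show ?thesis by (rule Lim_transform_eventually)
qed

lemma integrable_exp_mult:
  assumes "integrable (leb n) f"
  shows "integrable (leb n) (\<lambda>y. exp (- (1/4) * (\<Sum>i<n. (y i)\<^sup>2)) * f y :: real)"
proof (rule Bochner_Integration.integrable_bound[OF assms])
  show "(\<lambda>y. exp (- (1/4) * (\<Sum>i<n. (y i)\<^sup>2)) * f y) \<in> borel_measurable (leb n)"
    using assms by (intro borel_measurable_times borel_measurable_integrable[OF integrable_exp_sum_sq]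
        borel_measurable_integrable[OF assms]) simp
  have "exp (- (1/4) * (\<Sum>i<n. (y i)\<^sup>2)) \<le> (1::real)" for y :: "nat \<Rightarrow> real"
    by (simp add: sum_nonneg)
  then show "AE y in leb n. norm (exp (- (1/4) * (\<Sum>i<n. (y i)\<^sup>2)) * f y) \<le> norm (f y)"
    by (intro AE_I2) (simp only: real_norm_def abs_mult abs_exp_cancel mult_left_le_one_le abs_ge_zero exp_ge_zero)
qed

section \<open>Convergence of the gradient energy and the conclusion\<close>

lemma Lp_norm_2_sq: "(Lp_norm M 2 f)\<^sup>2 = (\<integral>x. (f x)\<^sup>2 \<partial>M)"
proof -
  have "\<bar>t\<bar> powr 2 = t\<^sup>2" for t :: real
    by (cases "t = 0") simp_all
  then show ?thesis
    by (simp add: Lp_norm_def powr_half_sqrt)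
qed

text \<open>From x/4 <= exp (x/4). With x = |y|^2 the Gaussian majorant absorbs the factor |y|^2
  that Cauchy-Schwarz produces.\<close>

lemma x_exp_le: "x * exp (- (1/4) * x) \<le> (4 :: real)"
proof -
  have "x / 4 \<le> exp (x / 4)" using exp_ge_add_one_self[of "x / 4"] by linarith
  then have "x / 4 * exp (- (x / 4)) \<le> exp (x / 4) * exp (- (x / 4))" by (intro mult_right_mono) auto
  also have "\<dots> = 1" by (simp add: exp_minus)
  finally show ?thesis by simp
qed

text \<open>The means of (y . g)^2 converge, so the factor 1/d sends the radial loss to 0. With
  \<open>g\<close> merely in L2, the majorant 4 |g|^2 gives the integrability against exp (-|y|^2/4)
  behind this convergence.\<close>

lemma lift_grad_energy_tendsto:
  assumes g: "\<And>i. i < n \<Longrightarrow> square_integrable (leb n) (\<lambda>y. g y i)"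
  shows "(\<lambda>d. (\<integral>\<omega>. (\<Sum>j<Suc d. (lift_grad n d g \<omega> j)\<^sup>2) \<partial>sph_measure d) / real d)
    \<longlonglongrightarrow> (\<integral>y. (\<Sum>i<n. (g y i)\<^sup>2) \<partial>gauss n)"
proof -
  let ?q = "\<lambda>y. \<Sum>i<n. (g y i)\<^sup>2" and ?r = "\<lambda>y. (\<Sum>i<n. y i * g y i)\<^sup>2"
  have gm: "(\<lambda>y. g y i) \<in> borel_measurable (leb n)" if "i < n" for i
    using g[OF that] by (simp add: square_integrable_def)
  have qm: "?q \<in> borel_measurable (leb n)"
    by (intro borel_measurable_sum borel_measurable_power gm) simp
  have qi: "integrable (leb n) ?q"
    using g by (intro Bochner_Integration.integrable_sum) (simp add: square_integrable_def)
  have rm: "?r \<in> borel_measurable (leb n)"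
    by (intro borel_measurable_sum borel_measurable_power borel_measurable_times measurable_leb_component gm) simp_all
  have ri: "integrable (leb n) (\<lambda>y. exp (- (1/4) * (\<Sum>i<n. (y i)\<^sup>2)) * ?r y)"
  proof (rule Bochner_Integration.integrable_bound)
    show "integrable (leb n) (\<lambda>y. 4 * ?q y)" using qi by simp
    show "(\<lambda>y. exp (- (1/4) * (\<Sum>i<n. (y i)\<^sup>2)) * ?r y) \<in> borel_measurable (leb n)"
      by (intro borel_measurable_times rm borel_measurable_integrable[OF integrable_exp_sum_sq]) simp
    show "AE y in leb n. norm (exp (- (1/4) * (\<Sum>i<n. (y i)\<^sup>2)) * ?r y) \<le> norm (4 * ?q y)"
    proof (rule AE_I2)
      fix y :: "nat \<Rightarrow> real"
      let ?s = "\<Sum>i<n. (y i)\<^sup>2"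
      have q0: "?q y \<ge> 0" by (simp add: sum_nonneg)
      have "exp (- (1/4) * ?s) * ?r y \<le> exp (- (1/4) * ?s) * (?s * ?q y)"
        by (intro mult_left_mono Cauchy_Schwarz_ineq_sum) simp
      also have "\<dots> = (?s * exp (- (1/4) * ?s)) * ?q y" by (simp only: mult_ac)
      also have "\<dots> \<le> 4 * ?q y" by (intro mult_right_mono x_exp_le q0)
      finally show "norm (exp (- (1/4) * ?s) * ?r y) \<le> norm (4 * ?q y)"
        using q0 by (simp only: real_norm_def abs_mult abs_exp_cancel abs_power2 abs_numeral abs_of_nonneg)
    qed
  qed
  have lq: "(\<lambda>d. \<integral>\<omega>. ?q (scaled_proj n d \<omega>) \<partial>sph_measure d) \<longlonglongrightarrow> (\<integral>y. ?q y \<partial>gauss n)"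
    by (rule integral_scaled_proj_tendsto[OF qm integrable_exp_mult[OF qi]])
  have lr: "(\<lambda>d. \<integral>\<omega>. ?r (scaled_proj n d \<omega>) \<partial>sph_measure d) \<longlonglongrightarrow> (\<integral>y. ?r y \<partial>gauss n)"
    by (rule integral_scaled_proj_tendsto[OF rm ri])
  have "(\<lambda>d. (\<integral>\<omega>. ?q (scaled_proj n d \<omega>) \<partial>sph_measure d) - 1 / real d * (\<integral>\<omega>. ?r (scaled_proj n d \<omega>) \<partial>sph_measure d))
      \<longlonglongrightarrow> (\<integral>y. ?q y \<partial>gauss n) - 0 * (\<integral>y. ?r y \<partial>gauss n)"
    by (intro tendsto_diff tendsto_mult lq lr lim_1_over_n)
  then have lim: "(\<lambda>d. (\<integral>\<omega>. ?q (scaled_proj n d \<omega>) \<partial>sph_measure d) - 1 / real d * (\<integral>\<omega>. ?r (scaled_proj n d \<omega>) \<partial>sph_measure d))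
      \<longlonglongrightarrow> (\<integral>y. ?q y \<partial>gauss n)" by simp
  have "\<forall>\<^sub>F d in sequentially. (\<integral>\<omega>. ?q (scaled_proj n d \<omega>) \<partial>sph_measure d) - 1 / real d * (\<integral>\<omega>. ?r (scaled_proj n d \<omega>) \<partial>sph_measure d)
      = (\<integral>\<omega>. (\<Sum>j<Suc d. (lift_grad n d g \<omega> j)\<^sup>2) \<partial>sph_measure d) / real d"
    using eventually_ge_at_top[of "Suc n"]
  proof eventually_elim
    case (elim d)
    then have n: "n \<le> d" and d: "real d > 0" by auto
    let ?M = "sph_measure d" and ?Y = "scaled_proj n d"
    let ?t = "\<lambda>\<omega>. (\<Sum>i<n. \<omega> i * g (?Y \<omega>) i)\<^sup>2"
    \<comment> \<open>The image point is sqrt d times the first n coordinates, so this form of the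
      radial term carries an extra factor d; dividing it out leaves the 1/d of the limit.\<close>
    have rt: "?r (?Y \<omega>) = real d * ?t \<omega>" for \<omega>
    proof -
      have "(\<Sum>i<n. ?Y \<omega> i * g (?Y \<omega>) i) = sqrt (real d) * (\<Sum>i<n. \<omega> i * g (?Y \<omega>) i)"
        by (simp add: scaled_proj_def sum_distrib_left mult.assoc)
      then show ?thesis by (simp only: power_mult_distrib real_sqrt_pow2 of_nat_0_le_iff)
    qed
    have iq: "integrable ?M (\<lambda>\<omega>. ?q (?Y \<omega>))" by (rule integrable_scaled_proj[OF elim qi])
    have it: "integrable ?M ?t"
    proof -
      have "square_integrable ?M (\<lambda>\<omega>. \<Sum>i<n. \<omega> i * g (?Y \<omega>) i)"
        using n by (intro square_integrable_sum square_integrable_coordinate_mult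
            square_integrable_scaled_proj[OF elim] g) auto
      then show ?thesis by (simp only: square_integrable_def)
    qed
    have "(\<integral>\<omega>. (\<Sum>j<Suc d. (lift_grad n d g \<omega> j)\<^sup>2) \<partial>?M) = (\<integral>\<omega>. real d * (?q (?Y \<omega>) - ?t \<omega>) \<partial>?M)"
      by (intro Bochner_Integration.integral_cong lift_grad_norm[OF n]) auto
    also have "\<dots> = real d * ((\<integral>\<omega>. ?q (?Y \<omega>) \<partial>?M) - (\<integral>\<omega>. ?t \<omega> \<partial>?M))"
      by (simp only: integral_mult_right_zero Bochner_Integration.integral_diff[OF iq it])
    finally have 1: "(\<integral>\<omega>. (\<Sum>j<Suc d. (lift_grad n d g \<omega> j)\<^sup>2) \<partial>?M) / real d
        = (\<integral>\<omega>. ?q (?Y \<omega>) \<partial>?M) - (\<integral>\<omega>. ?t \<omega> \<partial>?M)"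
      using d by simp
    have "(\<integral>\<omega>. ?r (?Y \<omega>) \<partial>?M) = real d * (\<integral>\<omega>. ?t \<omega> \<partial>?M)"
      by (simp only: rt integral_mult_right_zero)
    then show ?case unfolding 1 using d by simp
  qed
  with lim show ?thesis by (rule Lim_transform_eventually)
qed

text \<open>The existence of \<open>lift_grad\<close> makes \<open>SOME\<close> return a genuine
  weak gradient; uniqueness in each of the finitely many components then gives equal lengths almost
  everywhere.\<close>

lemma sph_grad_energy:
  assumes nd: "Suc n \<le> d" and v: "square_integrable (leb n) v" and g: "has_weak_grad n v g"
  shows "(\<integral>\<omega>. (\<Sum>j<Suc d. (sph_grad d (sph_lift n v d) \<omega> j)\<^sup>2) \<partial>sph_measure d)
    = (\<integral>\<omega>. (\<Sum>j<Suc d. (lift_grad n d g \<omega> j)\<^sup>2) \<partial>sph_measure d)"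
proof (rule integral_cong_AE)
  let ?M = "sph_measure d" and ?u = "sph_lift n v d"
  have L: "has_weak_sph_grad d ?u (lift_grad n d g)" by (rule has_weak_sph_grad_lift[OF nd v g])
  have S: "has_weak_sph_grad d ?u (sph_grad d ?u)"
    unfolding sph_grad_def by (rule someI[where P="has_weak_sph_grad d ?u", OF L])
  have meas: "(\<lambda>\<omega>. \<Sum>j<Suc d. (G \<omega> j)\<^sup>2) \<in> borel_measurable ?M" if "has_weak_sph_grad d ?u G" for G
    using that by (intro borel_measurable_sum borel_measurable_power) (simp add: has_weak_sph_grad_def square_integrable_def)
  show "(\<lambda>\<omega>. \<Sum>j<Suc d. (sph_grad d ?u \<omega> j)\<^sup>2) \<in> borel_measurable ?M" by (rule meas[OF S])
  show "(\<lambda>\<omega>. \<Sum>j<Suc d. (lift_grad n d g \<omega> j)\<^sup>2) \<in> borel_measurable ?M" by (rule meas[OF L])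
  have "AE \<omega> in ?M. \<forall>j\<in>{..<Suc d}. sph_grad d ?u \<omega> j = lift_grad n d g \<omega> j"
    by (intro AE_finite_allI has_weak_sph_grad_unique[OF S L]) auto
  then show "AE \<omega> in ?M. (\<Sum>j<Suc d. (sph_grad d ?u \<omega> j)\<^sup>2) = (\<Sum>j<Suc d. (lift_grad n d g \<omega> j)\<^sup>2)"
    by eventually_elim (intro sum.cong, auto)
qed

text \<open>Membership in \<open>sph_H1\<close> belongs to the conclusion because it is what makes
  \<open>sph_grad\<close> a weak gradient rather than an arbitrary choice.\<close>

theorem theorem1:
  fixes n :: nat and p :: real and v :: "(nat \<Rightarrow> real) \<Rightarrow> real"
  assumes "n > 0" and "1 \<le> p" and "p < 2"
    and "v \<in> H1 n" and "compactly_supported n v"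
  shows "(\<forall>\<^sub>F d in sequentially. sph_lift n v d \<in> sph_H1 d) \<and>
    ((\<lambda>d. 1 / real d *
        ((Lp_norm (sph_measure d) 2 (\<lambda>\<omega>. L2_set (sph_grad d (sph_lift n v d) \<omega>) {..<Suc d}))\<^sup>2
          - real d / (2 - p) *
              ((Lp_norm (sph_measure d) 2 (sph_lift n v d))\<^sup>2 - (Lp_norm (sph_measure d) p (sph_lift n v d))\<^sup>2)))
      \<longlonglongrightarrow>
        (Lp_norm (gauss n) 2 (\<lambda>y. L2_set (weak_grad n v y) {..<n}))\<^sup>2
          - 1 / (2 - p) * ((Lp_norm (gauss n) 2 v)\<^sup>2 - (Lp_norm (gauss n) p v)\<^sup>2))"
proof
  define g where "g = weak_grad n v"
  have v: "square_integrable (leb n) v" and "\<exists>g. has_weak_grad n v g"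
    using assms(4) by (auto simp: H1_def)
  then have g: "has_weak_grad n v g" unfolding g_def weak_grad_def by (metis someI_ex)
  have vm: "v \<in> borel_measurable (leb n)" and v2: "integrable (leb n) (\<lambda>y. (v y)\<^sup>2)"
    using v by (auto simp: square_integrable_def)
  have gi: "square_integrable (leb n) (\<lambda>y. g y i)" if "i < n" for i
    using g that by (simp add: has_weak_grad_def)
  show "\<forall>\<^sub>F d in sequentially. sph_lift n v d \<in> sph_H1 d"
    using eventually_ge_at_top[of "Suc n"]
  proof eventually_elim
    case (elim d)
    have "square_integrable (sph_measure d) (sph_lift n v d)"
      using square_integrable_scaled_proj[OF elim v] by (simp add: sph_lift_eq[abs_def])
    with has_weak_sph_grad_lift[OF elim v g] show ?case by (auto simp: sph_H1_def)
  qed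
  have pm: "(\<lambda>y. \<bar>v y\<bar> powr p) \<in> borel_measurable (leb n)" using vm by measurable
  have pint: "integrable (leb n) (\<lambda>y. exp (- (1/4) * (\<Sum>i<n. (y i)\<^sup>2)) * \<bar>v y\<bar> powr p)"
  proof (rule Bochner_Integration.integrable_bound)
    show "integrable (leb n) (\<lambda>y. exp (- (1/4) * (\<Sum>i<n. (y i)\<^sup>2)) + exp (- (1/4) * (\<Sum>i<n. (y i)\<^sup>2)) * (v y)\<^sup>2)"
      by (intro Bochner_Integration.integrable_add integrable_exp_sum_sq integrable_exp_mult v2) simp
    show "(\<lambda>y. exp (- (1/4) * (\<Sum>i<n. (y i)\<^sup>2)) * \<bar>v y\<bar> powr p) \<in> borel_measurable (leb n)"
      by (intro borel_measurable_times pm borel_measurable_integrable[OF integrable_exp_sum_sq]) simp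
    \<comment> \<open>Cut at |t| = 1 and compare p with 2. The constant 1 is not integrable over
      R^n; the Gaussian factor of the majorant pays for it.\<close>
    have "\<bar>t\<bar> powr p \<le> 1 + t\<^sup>2" for t :: real
    proof (cases "\<bar>t\<bar> \<le> 1")
      case True
      then have "\<bar>t\<bar> powr p \<le> 1" using assms(2) by (intro powr_le1) auto
      then show ?thesis using zero_le_power2[of t] by linarith
    next
      case False
      then have "\<bar>t\<bar> powr p \<le> \<bar>t\<bar> powr 2" using assms(3) by (intro powr_mono) auto
      also have "\<dots> = t\<^sup>2" using False by simp
      finally show ?thesis by simp
    qed
    then have "exp e * \<bar>t\<bar> powr p \<le> exp e + exp e * t\<^sup>2" for e t :: real
      using mult_left_mono[of "\<bar>t\<bar> powr p" "1 + t\<^sup>2" "exp e"] by (simp add: distrib_left)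
    then show "AE y in leb n. norm (exp (- (1/4) * (\<Sum>i<n. (y i)\<^sup>2)) * \<bar>v y\<bar> powr p)
        \<le> norm (exp (- (1/4) * (\<Sum>i<n. (y i)\<^sup>2)) + exp (- (1/4) * (\<Sum>i<n. (y i)\<^sup>2)) * (v y)\<^sup>2)"
      by (intro AE_I2) (simp add: abs_mult)
  qed
  let ?M = sph_measure and ?u = "\<lambda>d. sph_lift n v d"
  have L2: "(\<lambda>d. (Lp_norm (?M d) 2 (?u d))\<^sup>2) \<longlonglongrightarrow> (Lp_norm (gauss n) 2 v)\<^sup>2"
    unfolding Lp_norm_2_sq sph_lift_eq
    by (rule integral_scaled_proj_tendsto[OF _ integrable_exp_mult[OF v2]]) (use vm in simp)
  have "(\<lambda>d. \<integral>\<omega>. \<bar>v (scaled_proj n d \<omega>)\<bar> powr p \<partial>?M d) \<longlonglongrightarrow> (\<integral>y. \<bar>v y\<bar> powr p \<partial>gauss n)"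
    by (rule integral_scaled_proj_tendsto[OF pm pint])
  \<comment> \<open>The exponent 1/p is positive and the integrals are nonnegative, so the power is
    continuous even at a limit 0.\<close>
  then have Lp: "(\<lambda>d. (Lp_norm (?M d) p (?u d))\<^sup>2) \<longlonglongrightarrow> (Lp_norm (gauss n) p v)\<^sup>2"
    unfolding Lp_norm_def sph_lift_eq using assms(2)
    by (intro tendsto_power tendsto_powr' tendsto_const) (auto intro!: always_eventually integral_nonneg_AE)
  have "\<forall>\<^sub>F d in sequentially. (\<integral>\<omega>. (\<Sum>j<Suc d. (lift_grad n d g \<omega> j)\<^sup>2) \<partial>?M d) / real d
      = 1 / real d * (Lp_norm (?M d) 2 (\<lambda>\<omega>. L2_set (sph_grad d (?u d) \<omega>) {..<Suc d}))\<^sup>2"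
    using eventually_ge_at_top[of "Suc n"]
    by eventually_elim (simp only: Lp_norm_2_sq L2_set_lessThan_sq sph_grad_energy[OF _ v g] divide_inverse mult_1 mult.commute)
  from Lim_transform_eventually[OF lift_grad_energy_tendsto[of n g, OF gi] this]
  have grad: "(\<lambda>d. 1 / real d * (Lp_norm (?M d) 2 (\<lambda>\<omega>. L2_set (sph_grad d (?u d) \<omega>) {..<Suc d}))\<^sup>2)
      \<longlonglongrightarrow> (Lp_norm (gauss n) 2 (\<lambda>y. L2_set (weak_grad n v y) {..<n}))\<^sup>2"
    by (simp only: Lp_norm_2_sq L2_set_lessThan_sq g_def)
  let ?A = "\<lambda>d. (Lp_norm (?M d) 2 (\<lambda>\<omega>. L2_set (sph_grad d (?u d) \<omega>) {..<Suc d}))\<^sup>2"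
    and ?B = "\<lambda>d. (Lp_norm (?M d) 2 (?u d))\<^sup>2 - (Lp_norm (?M d) p (?u d))\<^sup>2"
  have lim: "(\<lambda>d. 1 / real d * ?A d - 1 / (2 - p) * ?B d) \<longlonglongrightarrow>
      (Lp_norm (gauss n) 2 (\<lambda>y. L2_set (weak_grad n v y) {..<n}))\<^sup>2
      - 1 / (2 - p) * ((Lp_norm (gauss n) 2 v)\<^sup>2 - (Lp_norm (gauss n) p v)\<^sup>2)"
    by (intro tendsto_diff tendsto_mult tendsto_const grad L2 Lp)
  \<comment> \<open>The factor d in front of the norm difference cancels only for d > 0, hence the
    rewriting is made eventually.\<close>
  have factor: "1 / real d * A - 1 / (2 - p) * B = 1 / real d * (A - real d / (2 - p) * B)"
    if "d > 0" for d :: nat and A B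
    using that assms(3) by (simp add: field_simps)
  have "\<forall>\<^sub>F d in sequentially. 1 / real d * ?A d - 1 / (2 - p) * ?B d = 1 / real d * (?A d - real d / (2 - p) * ?B d)"
    using eventually_gt_at_top[of 0] by eventually_elim (rule factor)
  with lim show "(\<lambda>d. 1 / real d * (?A d - real d / (2 - p) * ?B d)) \<longlonglongrightarrow>
      (Lp_norm (gauss n) 2 (\<lambda>y. L2_set (weak_grad n v y) {..<n}))\<^sup>2
      - 1 / (2 - p) * ((Lp_norm (gauss n) 2 v)\<^sup>2 - (Lp_norm (gauss n) p v)\<^sup>2)"
    by (rule Lim_transform_eventually)
qed

end
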